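(* It is true in $\mathbf{ZF}$ that $\mathbf{CMC}$ implies that, for every topological space $\mathbf{X}$, the following conditions are satisfied: (i) if $\mathbf{X}$ is realcompact, then, for every $S\in\mathfrak{Ba}(\mathbf{X})$, the subspace $\mathbf{S}$ of $\mathbf{X}$ with underlying set $S$ is realcompact; (ii) if $\mathbf{X}$ is $\mathbb{N}$-compact, then, for every $S\in\mathfrak{Ba}_0(\mathbf{X})$, the subspace $\mathbf{S}$ of $\mathbf{X}$ with underlying set $S$ is $\mathbb{N}$-compact.
   Context: The base theory is $\mathbf{ZF}$ (the Axiom of Choice is not assumed). $\mathbf{CMC}$ is the statement: for every family $\{A_n:n\in\omega\}$ of non-empty sets there is a function assigning to each $n\in\omega$ a non-empty finite subset of $A_n$. A space is realcompact (respectively, $\mathbb{N}$-compact) if for some non-empty set $J$ it is homeomorphic with a closed subspace of $\mathbb{R}^J$ with $\mathbb{R}$ carrying its usual topology (respectively, of $\mathbb{N}^J$ with $\mathbb{N}$ discrete). A field of subsets on a set $X$ is a family $\mathfrak{M}\subseteq\mathcal{P}(X)$ with $\emptyset\in\mathfrak{M}$ and $A\cup B, A\setminus B\in\mathfrak{M}$ for all $A,B\in\mathfrak{M}$; a $\sigma$-field is a field such that $\bigcup\mathcal{C}\in\mathfrak{M}$ for every countable $\mathcal{C}\subseteq\mathfrak{M}$. The $\sigma$-field generated by a family $\mathcal{A}\subseteq\mathcal{P}(X)$ is the intersection of all $\sigma$-fields on $X$ containing $\mathcal{A}$. $\mathfrak{Ba}(\mathbf{X})$ (the Baire sets) is the $\sigma$-field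 generated by the family of zero-sets $f^{-1}[\{0\}]$, $f:\mathbf{X}\to\mathbb{R}$ continuous; $\mathfrak{Ba}_0(\mathbf{X})$ (the zero-Baire sets) is the $\sigma$-field generated by the family of all clopen subsets of $\mathbf{X}$. *)

theory Defs
  imports Main
begin

text \<open>
  Hilbert's choice operator is built into HOL, so a statement about HOL sets could not express
  provability from ZF without choice. The theorem is therefore read semantically: it holds in
  every model of first-order ZF (equivalently, by completeness, it is provable in ZF). The
  universe of the model is a type and its membership relation is an arbitrary binary relation
  \<open>mem\<close>. The separation and replacement schemes range over first-order formulas with parameters
  only. If they ranged over all HOL predicates, choice would hold in every model.
\<close>

section \<open>Formulas of set theory and models of ZF\<close>

text \<open>Variables are de Bruijn indices; an assignment is a function from indices to sets.\<close>

datatype fm = Mem nat nat | Eq nat nat | Neg fm | Conj fm fm | Exi fm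

primrec sat :: "('a \<Rightarrow> 'a \<Rightarrow> bool) \<Rightarrow> fm \<Rightarrow> (nat \<Rightarrow> 'a) \<Rightarrow> bool" where
  "sat mem (Mem i j) e \<longleftrightarrow> mem (e i) (e j)"
| "sat mem (Eq i j) e \<longleftrightarrow> e i = e j"
| "sat mem (Neg p) e \<longleftrightarrow> \<not> sat mem p e"
| "sat mem (Conj p q) e \<longleftrightarrow> sat mem p e \<and> sat mem q e"
| "sat mem (Exi p) e \<longleftrightarrow> (\<exists>a. sat mem p (case_nat a e))"

locale membership =
  fixes mem :: "'a \<Rightarrow> 'a \<Rightarrow> bool"  (infix "\<^bold>\<in>" 50)

locale ZF_model = membership +
  assumes extensionality: "(\<forall>x. x \<^bold>\<in> a \<longleftrightarrow> x \<^bold>\<in> b) \<Longrightarrow> a = b"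
    and foundation: "\<exists>x. x \<^bold>\<in> a \<Longrightarrow> \<exists>x. x \<^bold>\<in> a \<and> \<not> (\<exists>y. y \<^bold>\<in> x \<and> y \<^bold>\<in> a)"
    and pairing: "\<exists>c. \<forall>x. x \<^bold>\<in> c \<longleftrightarrow> x = a \<or> x = b"
    and union: "\<exists>u. \<forall>x. x \<^bold>\<in> u \<longleftrightarrow> (\<exists>y. x \<^bold>\<in> y \<and> y \<^bold>\<in> a)"
    and powerset: "\<exists>p. \<forall>x. x \<^bold>\<in> p \<longleftrightarrow> (\<forall>y. y \<^bold>\<in> x \<longrightarrow> y \<^bold>\<in> a)"
    and infinity: "\<exists>i. (\<exists>z. z \<^bold>\<in> i \<and> (\<forall>x. \<not> x \<^bold>\<in> z)) \<and>
                      (\<forall>x. x \<^bold>\<in> i \<longrightarrow> (\<exists>y. y \<^bold>\<in> i \<and> (\<forall>u. u \<^bold>\<in> y \<longleftrightarrow> u \<^bold>\<in> x \<or> u = x)))"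
    and separation: "\<exists>b. \<forall>x. x \<^bold>\<in> b \<longleftrightarrow> x \<^bold>\<in> a \<and> sat mem p (case_nat x e)"
    and replacement:
      "\<forall>x. x \<^bold>\<in> a \<longrightarrow> (\<exists>!y. sat mem p (case_nat x (case_nat y e))) \<Longrightarrow>
       \<exists>b. \<forall>y. y \<^bold>\<in> b \<longleftrightarrow> (\<exists>x. x \<^bold>\<in> a \<and> sat mem p (case_nat x (case_nat y e)))"

section \<open>Notions of set theory inside a model\<close>

text \<open>
  All quantifiers and variables below, except the predicate argument of \<open>Coll\<close>, range over the
  universe \<open>'a\<close> of the model, so every definition is the interpretation in the model of a formula
  in the language of set theory. In particular \<open>f\<close>, \<open>J\<close>, \<open>X\<close>, \<open>T\<close>, \<dots> are sets of the model,
  and a function or topology exists only if the model contains it.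
\<close>

context membership
begin

abbreviation elts :: "'a \<Rightarrow> 'a set" where
  "elts a \<equiv> {x. x \<^bold>\<in> a}"

text \<open>
  \<open>Coll P\<close> is the set whose elements are the \<open>x\<close> with \<open>P x\<close>. It is used only where ZF proves that
  this collection is a set, and there extensionality makes it unique.
\<close>

definition Coll :: "('a \<Rightarrow> bool) \<Rightarrow> 'a" where
  "Coll P = (THE a. \<forall>x. x \<^bold>\<in> a \<longleftrightarrow> P x)"

definition sub :: "'a \<Rightarrow> 'a \<Rightarrow> bool"  (infix "\<^bold>\<subseteq>" 50) where
  "a \<^bold>\<subseteq> b \<longleftrightarrow> (\<forall>x\<in>elts a. x \<^bold>\<in> b)"

definition empty :: 'a where
  "empty = Coll (\<lambda>x. False)"

definition upair :: "'a \<Rightarrow> 'a \<Rightarrow> 'a" where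
  "upair a b = Coll (\<lambda>x. x = a \<or> x = b)"

definition opair :: "'a \<Rightarrow> 'a \<Rightarrow> 'a" where
  "opair a b = upair (upair a a) (upair a b)"

definition un :: "'a \<Rightarrow> 'a \<Rightarrow> 'a"  (infixl "\<^bold>\<union>" 65) where
  "a \<^bold>\<union> b = Coll (\<lambda>x. x \<^bold>\<in> a \<or> x \<^bold>\<in> b)"

definition int :: "'a \<Rightarrow> 'a \<Rightarrow> 'a"  (infixl "\<^bold>\<inter>" 70) where
  "a \<^bold>\<inter> b = Coll (\<lambda>x. x \<^bold>\<in> a \<and> x \<^bold>\<in> b)"

definition diff :: "'a \<Rightarrow> 'a \<Rightarrow> 'a"  (infixl "\<^bold>-" 65) where
  "a \<^bold>- b = Coll (\<lambda>x. x \<^bold>\<in> a \<and> \<not> x \<^bold>\<in> b)"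

definition bigun :: "'a \<Rightarrow> 'a" where
  "bigun a = Coll (\<lambda>x. \<exists>y\<in>elts a. x \<^bold>\<in> y)"

definition pow :: "'a \<Rightarrow> 'a" where
  "pow a = Coll (\<lambda>x. x \<^bold>\<subseteq> a)"

definition cprod :: "'a \<Rightarrow> 'a \<Rightarrow> 'a"  (infixr "\<^bold>\<times>" 80) where
  "a \<^bold>\<times> b = Coll (\<lambda>z. \<exists>x\<in>elts a. \<exists>y\<in>elts b. z = opair x y)"

definition fun_on :: "'a \<Rightarrow> 'a \<Rightarrow> bool" where
  "fun_on f a \<longleftrightarrow> (\<forall>z\<in>elts f. \<exists>x\<in>elts a. \<exists>y. z = opair x y) \<and>
                      (\<forall>x\<in>elts a. \<exists>!y. opair x y \<^bold>\<in> f)"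

definition app :: "'a \<Rightarrow> 'a \<Rightarrow> 'a" where
  "app f x = (THE y. opair x y \<^bold>\<in> f)"

definition func :: "'a \<Rightarrow> 'a \<Rightarrow> 'a \<Rightarrow> bool" where
  "func f a b \<longleftrightarrow> fun_on f a \<and> (\<forall>x\<in>elts a. app f x \<^bold>\<in> b)"

definition injective :: "'a \<Rightarrow> 'a \<Rightarrow> bool" where
  "injective f a \<longleftrightarrow> (\<forall>x\<in>elts a. \<forall>y\<in>elts a. app f x = app f y \<longrightarrow> x = y)"

definition bijection :: "'a \<Rightarrow> 'a \<Rightarrow> 'a \<Rightarrow> bool" where
  "bijection f a b \<longleftrightarrow> func f a b \<and> injective f a \<and> (\<forall>y\<in>elts b. \<exists>x\<in>elts a. app f x = y)"

definition image :: "'a \<Rightarrow> 'a \<Rightarrow> 'a" where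
  "image f u = Coll (\<lambda>y. \<exists>x\<in>elts u. y = app f x)"

definition preimage :: "'a \<Rightarrow> 'a \<Rightarrow> 'a \<Rightarrow> 'a" where
  "preimage f a v = Coll (\<lambda>x. x \<^bold>\<in> a \<and> app f x \<^bold>\<in> v)"

definition exponent :: "'a \<Rightarrow> 'a \<Rightarrow> 'a" where
  "exponent b j = Coll (\<lambda>f. func f j b)"

definition is_inductive :: "'a \<Rightarrow> bool" where
  "is_inductive i \<longleftrightarrow> empty \<^bold>\<in> i \<and> (\<forall>n\<in>elts i. n \<^bold>\<union> upair n n \<^bold>\<in> i)"

definition omega :: 'a where
  "omega = Coll (\<lambda>n. \<forall>i. is_inductive i \<longrightarrow> n \<^bold>\<in> i)"

definition finite_set :: "'a \<Rightarrow> bool" where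
  "finite_set a \<longleftrightarrow> (\<exists>n\<in>elts omega. \<exists>f. bijection f n a)"

definition countable_set :: "'a \<Rightarrow> bool" where
  "countable_set a \<longleftrightarrow> (\<exists>f. func f a omega \<and> injective f a)"

definition CMC :: bool where
  "CMC \<longleftrightarrow> (\<forall>A. fun_on A omega \<and> (\<forall>n\<in>elts omega. app A n \<noteq> empty) \<longrightarrow>
     (\<exists>F. fun_on F omega \<and>
        (\<forall>n\<in>elts omega. app F n \<^bold>\<subseteq> app A n \<and> app F n \<noteq> empty \<and> finite_set (app F n))))"

section \<open>Topology inside a model\<close>

definition topology :: "'a \<Rightarrow> 'a \<Rightarrow> bool" where
  "topology X T \<longleftrightarrow> T \<^bold>\<subseteq> pow X \<and> empty \<^bold>\<in> T \<and> X \<^bold>\<in> T \<and>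
     (\<forall>U\<in>elts T. \<forall>V\<in>elts T. U \<^bold>\<inter> V \<^bold>\<in> T) \<and>
     (\<forall>\<U>. \<U> \<^bold>\<subseteq> T \<longrightarrow> bigun \<U> \<^bold>\<in> T)"

definition closed_in :: "'a \<Rightarrow> 'a \<Rightarrow> 'a \<Rightarrow> bool" where
  "closed_in X T C \<longleftrightarrow> C \<^bold>\<subseteq> X \<and> X \<^bold>- C \<^bold>\<in> T"

definition subspace_top :: "'a \<Rightarrow> 'a \<Rightarrow> 'a" where
  "subspace_top T S = Coll (\<lambda>V. \<exists>U\<in>elts T. V = U \<^bold>\<inter> S)"

definition continuous :: "'a \<Rightarrow> 'a \<Rightarrow> 'a \<Rightarrow> 'a \<Rightarrow> 'a \<Rightarrow> bool" where
  "continuous X T Y T' f \<longleftrightarrow> func f X Y \<and> (\<forall>V\<in>elts T'. preimage f X V \<^bold>\<in> T)"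

definition homeomorphic :: "'a \<Rightarrow> 'a \<Rightarrow> 'a \<Rightarrow> 'a \<Rightarrow> bool" where
  "homeomorphic X T Y T' \<longleftrightarrow>
     (\<exists>f. bijection f X Y \<and> continuous X T Y T' f \<and> (\<forall>U\<in>elts T. image f U \<^bold>\<in> T'))"

definition generated_topology :: "'a \<Rightarrow> 'a \<Rightarrow> 'a" where
  "generated_topology X \<S> = Coll (\<lambda>V. \<forall>T. topology X T \<and> \<S> \<^bold>\<subseteq> T \<longrightarrow> V \<^bold>\<in> T)"

text \<open>The product topology on the power \<open>E\<^sup>J\<close>, with the preimages of open sets under the
  projections as subbase.\<close>

definition power_top :: "'a \<Rightarrow> 'a \<Rightarrow> 'a \<Rightarrow> 'a" where
  "power_top E TE J = generated_topology (exponent E J)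
     (Coll (\<lambda>W. \<exists>j\<in>elts J. \<exists>U\<in>elts TE. W = Coll (\<lambda>x. x \<^bold>\<in> exponent E J \<and> app x j \<^bold>\<in> U)))"

definition compact_over :: "'a \<Rightarrow> 'a \<Rightarrow> 'a \<Rightarrow> 'a \<Rightarrow> bool" where
  "compact_over E TE X T \<longleftrightarrow>
     (\<exists>J. J \<noteq> empty \<and>
       (\<exists>C. closed_in (exponent E J) (power_top E TE J) C \<and>
            homeomorphic X T C (subspace_top (power_top E TE J) C)))"

definition N_compact :: "'a \<Rightarrow> 'a \<Rightarrow> bool" where
  "N_compact X T \<longleftrightarrow> compact_over omega (pow omega) X T"

section \<open>The real line inside a model\<close>

text \<open>
  The real line of the model is a Dedekind complete ordered field in the model, which ZF proves to
  exist and to be unique up to isomorphism. Completeness is internal: it concerns only the subsets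
  of \<open>R\<close> that belong to the model.
\<close>

definition complete_ordered_field :: "'a \<Rightarrow> 'a \<Rightarrow> 'a \<Rightarrow> 'a \<Rightarrow> 'a \<Rightarrow> 'a \<Rightarrow> bool" where
  "complete_ordered_field R add mul zero one le \<longleftrightarrow>
     (let plus = (\<lambda>x y. app add (opair x y));
          times = (\<lambda>x y. app mul (opair x y));
          leq = (\<lambda>x y. opair x y \<^bold>\<in> le) in
      func add (R \<^bold>\<times> R) R \<and> func mul (R \<^bold>\<times> R) R \<and> zero \<^bold>\<in> R \<and> one \<^bold>\<in> R \<and> zero \<noteq> one \<and>
      (\<forall>x\<in>elts R. \<forall>y\<in>elts R. \<forall>z\<in>elts R. plus (plus x y) z = plus x (plus y z)) \<and>
      (\<forall>x\<in>elts R. \<forall>y\<in>elts R. plus x y = plus y x) \<and>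
      (\<forall>x\<in>elts R. plus x zero = x) \<and>
      (\<forall>x\<in>elts R. \<exists>y\<in>elts R. plus x y = zero) \<and>
      (\<forall>x\<in>elts R. \<forall>y\<in>elts R. \<forall>z\<in>elts R. times (times x y) z = times x (times y z)) \<and>
      (\<forall>x\<in>elts R. \<forall>y\<in>elts R. times x y = times y x) \<and>
      (\<forall>x\<in>elts R. times x one = x) \<and>
      (\<forall>x\<in>elts R. x \<noteq> zero \<longrightarrow> (\<exists>y\<in>elts R. times x y = one)) \<and>
      (\<forall>x\<in>elts R. \<forall>y\<in>elts R. \<forall>z\<in>elts R. times x (plus y z) = plus (times x y) (times x z)) \<and>
      le \<^bold>\<subseteq> R \<^bold>\<times> R \<and>
      (\<forall>x\<in>elts R. \<forall>y\<in>elts R. leq x y \<or> leq y x) \<and>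
      (\<forall>x\<in>elts R. \<forall>y\<in>elts R. leq x y \<and> leq y x \<longrightarrow> x = y) \<and>
      (\<forall>x\<in>elts R. \<forall>y\<in>elts R. \<forall>z\<in>elts R. leq x y \<and> leq y z \<longrightarrow> leq x z) \<and>
      (\<forall>x\<in>elts R. \<forall>y\<in>elts R. \<forall>z\<in>elts R. leq x y \<longrightarrow> leq (plus x z) (plus y z)) \<and>
      (\<forall>x\<in>elts R. \<forall>y\<in>elts R. leq zero x \<and> leq zero y \<longrightarrow> leq zero (times x y)) \<and>
      (\<forall>A. A \<^bold>\<subseteq> R \<and> A \<noteq> empty \<and> (\<exists>b\<in>elts R. \<forall>x\<in>elts A. leq x b) \<longrightarrow>
         (\<exists>s\<in>elts R. (\<forall>x\<in>elts A. leq x s) \<and>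
            (\<forall>b\<in>elts R. (\<forall>x\<in>elts A. leq x b) \<longrightarrow> leq s b))))"

definition real_top :: "'a \<Rightarrow> 'a \<Rightarrow> 'a" where
  "real_top R le =
     (let less = (\<lambda>x y. opair x y \<^bold>\<in> le \<and> x \<noteq> y) in
      Coll (\<lambda>V. V \<^bold>\<subseteq> R \<and>
        (\<forall>x\<in>elts V. \<exists>a\<in>elts R. \<exists>b\<in>elts R. less a x \<and> less x b \<and>
           (\<forall>y\<in>elts R. less a y \<and> less y b \<longrightarrow> y \<^bold>\<in> V))))"

definition realcompact :: "'a \<Rightarrow> 'a \<Rightarrow> 'a \<Rightarrow> 'a \<Rightarrow> bool" where
  "realcompact R le X T \<longleftrightarrow> compact_over R (real_top R le) X T"

section \<open>Baire sets and zero-Baire sets inside a model\<close>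

definition set_field :: "'a \<Rightarrow> 'a \<Rightarrow> bool" where
  "set_field X \<M> \<longleftrightarrow> \<M> \<^bold>\<subseteq> pow X \<and> empty \<^bold>\<in> \<M> \<and>
     (\<forall>A\<in>elts \<M>. \<forall>B\<in>elts \<M>. A \<^bold>\<union> B \<^bold>\<in> \<M> \<and> A \<^bold>- B \<^bold>\<in> \<M>)"

definition sigma_field :: "'a \<Rightarrow> 'a \<Rightarrow> bool" where
  "sigma_field X \<M> \<longleftrightarrow> set_field X \<M> \<and>
     (\<forall>\<C>. \<C> \<^bold>\<subseteq> \<M> \<and> countable_set \<C> \<longrightarrow> bigun \<C> \<^bold>\<in> \<M>)"

definition generated_sigma_field :: "'a \<Rightarrow> 'a \<Rightarrow> 'a" where
  "generated_sigma_field X \<A> = Coll (\<lambda>S. \<forall>\<M>. sigma_field X \<M> \<and> \<A> \<^bold>\<subseteq> \<M> \<longrightarrow> S \<^bold>\<in> \<M>)"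

definition zero_sets :: "'a \<Rightarrow> 'a \<Rightarrow> 'a \<Rightarrow> 'a \<Rightarrow> 'a \<Rightarrow> 'a" where
  "zero_sets R le zero X T =
     Coll (\<lambda>Z. \<exists>f. continuous X T R (real_top R le) f \<and> Z = preimage f X (upair zero zero))"

definition clopen_sets :: "'a \<Rightarrow> 'a \<Rightarrow> 'a" where
  "clopen_sets X T = Coll (\<lambda>U. U \<^bold>\<in> T \<and> closed_in X T U)"

definition Baire :: "'a \<Rightarrow> 'a \<Rightarrow> 'a \<Rightarrow> 'a \<Rightarrow> 'a \<Rightarrow> 'a" where
  "Baire R le zero X T = generated_sigma_field X (zero_sets R le zero X T)"

definition zero_Baire :: "'a \<Rightarrow> 'a \<Rightarrow> 'a" where
  "zero_Baire X T = generated_sigma_field X (clopen_sets X T)"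

end

end

theory Submission
  imports Defs
begin

text \<open>
  Both parts of the theorem are instances of one argument about a linearly ordered space \<open>E\<close> without
  greatest element in which bounded sets have suprema: the real line, or \<open>\<omega>\<close> with the discrete
  topology. The central notion is a \<^emph>\<open>scale\<close> on \<open>X\<close>, a continuous map \<open>g\<close>
  from \<open>X\<close> to \<open>E \<union> {\<infinity>}\<close>. It is coded by the set of pairs \<open>(x,
  c)\<close> with \<open>g x < c\<close>, so that an infimum of scales is a union of sets and no value of
  \<open>g\<close> has to be computed in order to form it. The set where \<open>g\<close> is finite plays the part of a
  cozero-set.

  Embedding (\<open>compact_over_subspace\<close>). Suppose that every point \<open>p\<close> of \<open>X\<close>
  outside \<open>S\<close> has a scale that is finite on \<open>S\<close> and infinite at \<open>p\<close>. Map \<open>x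
  \<in> S\<close> to the family of the values at \<open>x\<close> of \<^emph>\<open>all\<close> scales that are finite
  on \<open>S\<close>; since all of them are used, nothing is chosen. The coordinates of the given closed embedding of
  \<open>X\<close> are among these scales, so a point in the closure of the image comes from a point \<open>x\<close> of
  \<open>X\<close>. The graph of a scale over its finite part is closed in \<open>X \<times> E\<close>, so all the
  scales used are finite at \<open>x\<close>, and \<open>x \<in> S\<close> by the hypothesis.

  Sigma-field (\<open>scale_separated_countable_union\<close>). Call \<open>S\<close> separated if for each \<open>p
  \<in> X\<close> there is a scale that is infinite at \<open>p\<close> and finite at all points of \<open>X\<close>
  that \<open>S\<close> distinguishes from \<open>p\<close>. Points distinguished by a union are distinguished by one of
  its members. Hence the countable case amounts to combining scales \<open>g\<^sub>n\<close>, all infinite at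
  \<open>p\<close>, into one that is finite where at least one \<open>g\<^sub>n\<close> is; the combination is
  \<open>inf\<^sub>n max(g\<^sub>n, n)\<close>, which is continuous because only finitely many \<open>n\<close> matter
  below a given level. Choosing the \<open>g\<^sub>n\<close> is the only appeal to a choice principle, and multiple
  choice suffices: for a non-empty finite set of candidates for each \<open>n\<close>, the infimum is taken over all
  candidates.

  Generators. A clopen set is separated by scales that are constant on it and infinite off it, or conversely; the
  zero-set of \<open>f\<close> is separated by the scales \<open>1 / \<bar>f - f p\<bar>\<close>. Therefore all
  zero-Baire sets and all Baire sets are separated, and the embedding applies to them.

  Every set used in this argument has to exist in the model, where only first-order separation is available. A predicate
  is called definable if a formula with parameters expresses it; such predicates are closed under the logical
  operations, and every set below is cut out by one.
\<close>

section \<open>Definability with parameters\<close>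

primrec rename :: "(nat \<Rightarrow> nat) \<Rightarrow> fm \<Rightarrow> fm" where
  "rename r (Mem i j) = Mem (r i) (r j)"
| "rename r (Eq i j) = Eq (r i) (r j)"
| "rename r (Neg p) = Neg (rename r p)"
| "rename r (Conj p q) = Conj (rename r p) (rename r q)"
| "rename r (Exi p) = Exi (rename (case_nat 0 (\<lambda>i. Suc (r i))) p)"

lemma sat_rename: "sat mem (rename r p) e \<longleftrightarrow> sat mem p (\<lambda>i. e (r i))"
proof (induction p arbitrary: r e)
  case (Exi p)
  have "(\<lambda>i. case_nat a e (case_nat 0 (\<lambda>i. Suc (r i)) i)) = case_nat a (\<lambda>i. e (r i))" for a
    by (rule ext) (simp split: nat.split)
  then show ?case by (simp add: Exi.IH)
qed auto

text \<open>
  An index of a formula is sent either to an index of the environment or to a parameter from the model, so that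
  parameters do not move when a quantifier shifts the environment.
\<close>

definition assign :: "(nat \<Rightarrow> nat + 'a) \<Rightarrow> (nat \<Rightarrow> 'a) \<Rightarrow> nat \<Rightarrow> 'a" where
  "assign s e i = (case s i of Inl j \<Rightarrow> e j | Inr c \<Rightarrow> c)"

context membership
begin

text \<open>
  Environments are functions on indices, and a bound variable is the entry at index 0 of a shifted environment. Stated
  in this way, the closure rules match HOL terms directly: a predicate is proved definable by resolving along its
  syntax, without writing its formula down.
\<close>

definition definable :: "((nat \<Rightarrow> 'a) \<Rightarrow> bool) \<Rightarrow> bool" where
  "definable P \<longleftrightarrow> (\<exists>p s. \<forall>e. P e \<longleftrightarrow> sat mem p (assign s e))"

text \<open>
  A term is definable if its graph is. The term itself need not be expressible in the language, which has no function
  symbols.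
\<close>

definition definable_fun :: "((nat \<Rightarrow> 'a) \<Rightarrow> 'a) \<Rightarrow> bool" where
  "definable_fun t \<longleftrightarrow> definable (\<lambda>e. e 0 = t (\<lambda>i. e (Suc i)))"

lemma definable_rename:
  assumes "definable P" shows "definable (\<lambda>e. P (\<lambda>i. e (r i)))"
proof -
  obtain p s where ps: "\<And>e. P e \<longleftrightarrow> sat mem p (assign s e)"
    using assms unfolding definable_def by blast
  have "assign s (\<lambda>i. e (r i)) = assign (\<lambda>i. map_sum r id (s i)) e" for e
    by (rule ext) (simp add: assign_def split: sum.split)
  then show ?thesis unfolding definable_def using ps by metis
qed

lemma definable_fun_rename:
  assumes "definable_fun t" shows "definable_fun (\<lambda>e. t (\<lambda>i. e (r i)))"
  using definable_rename[OF assms[unfolded definable_fun_def], of "case_nat 0 (\<lambda>i. Suc (r i))"]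
  by (simp add: definable_fun_def)

lemma definable_not:
  assumes "definable P" shows "definable (\<lambda>e. \<not> P e)"
proof -
  obtain p s where "\<And>e. P e \<longleftrightarrow> sat mem p (assign s e)"
    using assms unfolding definable_def by blast
  then have "\<forall>e. \<not> P e \<longleftrightarrow> sat mem (Neg p) (assign s e)" by simp
  then show ?thesis unfolding definable_def by blast
qed

lemma definable_conj:
  assumes "definable P" "definable Q" shows "definable (\<lambda>e. P e \<and> Q e)"
proof -
  obtain p s where p: "\<And>e. P e \<longleftrightarrow> sat mem p (assign s e)"
    using assms unfolding definable_def by blast
  obtain q t where q: "\<And>e. Q e \<longleftrightarrow> sat mem q (assign t e)"
    using assms unfolding definable_def by blast
  define u where "u = (\<lambda>i. if even i then s (i div 2) else t (i div 2))"
  have 1: "assign u e (2 * i) = assign s e i" for e i by (simp add: assign_def u_def)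
  have 2: "assign u e (Suc (2 * i)) = assign t e i" for e i by (simp add: assign_def u_def)
  have "P e \<and> Q e \<longleftrightarrow>
      sat mem (Conj (rename (\<lambda>i. 2 * i) p) (rename (\<lambda>i. Suc (2 * i)) q)) (assign u e)" for e
    by (simp only: sat.simps sat_rename 1 2 p q)
  then show ?thesis unfolding definable_def by blast
qed

text \<open>
  Index 0 of the environment, and nothing else, has to become the variable of the new quantifier; all other indices and
  all parameters move up by one. The lemma serves both the quantifier and the separated variable of the separation
  scheme.
\<close>

lemma sat_assign_case_nat:
  assumes "\<And>e. P e \<longleftrightarrow> sat mem p (assign s e)"
  shows "\<exists>q t. \<forall>a e. P (case_nat a e) \<longleftrightarrow> sat mem q (case_nat a (assign t e))"
proof -
  define r where "r = (\<lambda>i. if s i = Inl 0 then 0 else Suc i)"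
  define t where "t = (\<lambda>i. map_sum (\<lambda>j. j - 1) id (s i))"
  have "assign s (case_nat a e) = (\<lambda>i. case_nat a (assign t e) (r i))" for a e
    by (rule ext) (auto simp: assign_def r_def t_def split: sum.split nat.split)
  then have "P (case_nat a e) \<longleftrightarrow> sat mem (rename r p) (case_nat a (assign t e))" for a e
    by (simp add: assms sat_rename)
  then show ?thesis by blast
qed

lemma definable_ex:
  assumes "definable (\<lambda>e. P (\<lambda>i. e (Suc i)) (e 0))" shows "definable (\<lambda>e. \<exists>x. P e x)"
proof -
  obtain p s where ps: "\<And>e. P (\<lambda>i. e (Suc i)) (e 0) \<longleftrightarrow> sat mem p (assign s e)"
    using assms unfolding definable_def by blast
  obtain q t where "\<forall>a e. P e a \<longleftrightarrow> sat mem q (case_nat a (assign t e))"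
    using sat_assign_case_nat[OF ps] by auto
  then have "\<And>e. (\<exists>x. P e x) \<longleftrightarrow> sat mem (Exi q) (assign t e)" by simp
  then show ?thesis unfolding definable_def by blast
qed

lemma definable_const: "definable (\<lambda>e. Q)"
proof -
  have "definable (\<lambda>e. True)" unfolding definable_def
    by (rule exI[of _ "Eq 0 0"]) simp
  then show ?thesis using definable_not[of "\<lambda>e. True"] by (cases Q) simp_all
qed

lemma definable_disj:
  assumes "definable P" "definable Q" shows "definable (\<lambda>e. P e \<or> Q e)"
proof -
  have "definable (\<lambda>e. \<not> (\<not> P e \<and> \<not> Q e))"
    by (intro definable_not definable_conj assms)
  then show ?thesis by simp
qed

lemma definable_imp:
  assumes "definable P" "definable Q" shows "definable (\<lambda>e. P e \<longrightarrow> Q e)"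
  unfolding imp_conv_disj by (intro definable_disj definable_not assms)

lemma definable_iff:
  assumes "definable P" "definable Q" shows "definable (\<lambda>e. P e \<longleftrightarrow> Q e)"
  unfolding iff_conv_conj_imp by (intro definable_conj definable_imp assms)

lemma definable_all:
  assumes "definable (\<lambda>e. P (\<lambda>i. e (Suc i)) (e 0))" shows "definable (\<lambda>e. \<forall>x. P e x)"
  using definable_not[OF definable_ex[OF definable_not[OF assms]]] by simp

lemma definable_fun_var: "definable_fun (\<lambda>e. e i)"
proof -
  have "e 0 = e (Suc i) \<longleftrightarrow> sat mem (Eq 0 1) (assign (case_nat (Inl 0) (\<lambda>_. Inl (Suc i))) e)" for e
    by (simp add: assign_def)
  then show ?thesis unfolding definable_fun_def definable_def by blast
qed

lemma definable_fun_const: "definable_fun (\<lambda>e. c)"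
proof -
  have "e 0 = c \<longleftrightarrow> sat mem (Eq 0 1) (assign (case_nat (Inl 0) (\<lambda>_. Inr c)) e)" for e
    by (simp add: assign_def)
  then show ?thesis unfolding definable_fun_def definable_def by blast
qed

lemma definable_var_eq:
  "definable_fun t \<Longrightarrow> definable (\<lambda>e. e i = t e)"
  unfolding definable_fun_def
  using definable_rename[where r = "case_nat i (\<lambda>j. j)" and P = "\<lambda>e. e 0 = t (\<lambda>i. e (Suc i))"]
  by simp

lemma definable_eq:
  assumes "definable_fun t" "definable_fun u" shows "definable (\<lambda>e. t e = u e)"
proof -
  have "definable (\<lambda>e. \<exists>x. x = t e \<and> x = u e)"
    by (intro definable_ex definable_conj definable_var_eq assms[THEN definable_fun_rename])
  then show ?thesis by simp
qed

text \<open>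
  A formula relates variables only, so the two terms are first named by quantified variables.
\<close>

lemma definable_mem:
  assumes "definable_fun t" "definable_fun u" shows "definable (\<lambda>e. t e \<^bold>\<in> u e)"
proof -
  have "e 1 \<^bold>\<in> e 0 \<longleftrightarrow> sat mem (Mem 1 0) (assign (\<lambda>i. Inl i) e)" for e
    by (simp add: assign_def)
  then have *: "definable (\<lambda>e. e 1 \<^bold>\<in> e 0)" unfolding definable_def by blast
  have "definable (\<lambda>e. \<exists>x. x = t e \<and> (\<exists>y. y = u e \<and> x \<^bold>\<in> y))"
    using * by (intro definable_ex definable_conj definable_var_eq assms[THEN definable_fun_rename])
      simp
  then show ?thesis by simp
qed

lemma definable_Ball:
  assumes "definable_fun t" "definable (\<lambda>e. P (\<lambda>i. e (Suc i)) (e 0))"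
  shows "definable (\<lambda>e. \<forall>x\<in>elts (t e). P e x)"
  unfolding Ball_def mem_Collect_eq
  by (intro definable_all definable_imp definable_mem definable_fun_var
      definable_fun_rename[OF assms(1)] assms(2))

lemma definable_Bex:
  assumes "definable_fun t" "definable (\<lambda>e. P (\<lambda>i. e (Suc i)) (e 0))"
  shows "definable (\<lambda>e. \<exists>x\<in>elts (t e). P e x)"
  unfolding Bex_def mem_Collect_eq
  by (intro definable_ex definable_conj definable_mem definable_fun_var
      definable_fun_rename[OF assms(1)] assms(2))

lemma definable_sub:
  assumes "definable_fun t" "definable_fun u" shows "definable (\<lambda>e. t e \<^bold>\<subseteq> u e)"
  unfolding sub_def
  by (intro definable_Ball definable_mem definable_fun_var assms[THEN definable_fun_rename])

lemmas definable_intros =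
  definable_const definable_not definable_conj definable_disj definable_imp definable_iff
  definable_Ball definable_Bex definable_ex definable_all definable_eq definable_mem
  definable_sub definable_fun_var definable_fun_const

end

section \<open>Elementary set theory in a model\<close>

context ZF_model
begin

lemma set_eqI: "(\<And>x. x \<^bold>\<in> a \<longleftrightarrow> x \<^bold>\<in> b) \<Longrightarrow> a = b"
  using extensionality by blast

lemma mem_Coll:
  assumes "\<exists>b. \<forall>x. x \<^bold>\<in> b \<longleftrightarrow> P x" shows "x \<^bold>\<in> Coll P \<longleftrightarrow> P x"
proof -
  have "\<exists>!b. \<forall>x. x \<^bold>\<in> b \<longleftrightarrow> P x" using assms by (metis set_eqI)
  then have "\<forall>x. x \<^bold>\<in> Coll P \<longleftrightarrow> P x" unfolding Coll_def by (rule theI')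
  then show ?thesis by blast
qed

lemma separation_definable:
  assumes "definable (\<lambda>e. P (e 0))" shows "\<exists>b. \<forall>x. x \<^bold>\<in> b \<longleftrightarrow> x \<^bold>\<in> a \<and> P x"
proof -
  obtain p s where ps: "\<And>e. P (e 0) \<longleftrightarrow> sat mem p (assign s e)"
    using assms unfolding definable_def by blast
  obtain q t where "\<forall>x e. P x \<longleftrightarrow> sat mem q (case_nat x (assign t e))"
    using sat_assign_case_nat[OF ps] by auto
  then show ?thesis using separation[of a q "assign t (\<lambda>_. undefined)"] by simp
qed

text \<open>
  The form in which separation is applied to the notions of set theory in the model: each is the collection of all sets
  with some property, and needs a bounding set.
\<close>

lemma mem_Coll_bounded:
  assumes "definable (\<lambda>e. P (e 0))" "\<And>x. P x \<Longrightarrow> x \<^bold>\<in> a"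
  shows "x \<^bold>\<in> Coll P \<longleftrightarrow> P x"
  using separation_definable[OF assms(1), of a] assms(2) by (intro mem_Coll) blast

lemma mem_empty [simp]: "\<not> x \<^bold>\<in> empty"
proof -
  have "\<exists>b. \<forall>x. x \<^bold>\<in> b \<longleftrightarrow> x \<^bold>\<in> a \<and> False" for a
    by (rule separation_definable) (rule definable_const)
  then show ?thesis unfolding empty_def using mem_Coll[of "\<lambda>x. False" x] by simp
qed

lemma empty_iff: "a = empty \<longleftrightarrow> (\<forall>x. \<not> x \<^bold>\<in> a)"
  using set_eqI[of a empty] by auto

lemma mem_upair [simp]: "x \<^bold>\<in> upair a b \<longleftrightarrow> x = a \<or> x = b"
  unfolding upair_def by (rule mem_Coll) (rule pairing)

lemma mem_bigun [simp]: "x \<^bold>\<in> bigun a \<longleftrightarrow> (\<exists>y. y \<^bold>\<in> a \<and> x \<^bold>\<in> y)"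
proof -
  have "x \<^bold>\<in> bigun a \<longleftrightarrow> (\<exists>y\<in>elts a. x \<^bold>\<in> y)"
    unfolding bigun_def by (rule mem_Coll) (use union[of a] in \<open>auto simp: conj_commute\<close>)
  then show ?thesis by auto
qed

lemma mem_pow [simp]: "x \<^bold>\<in> pow a \<longleftrightarrow> x \<^bold>\<subseteq> a"
  unfolding pow_def by (rule mem_Coll) (use powerset[of a] in \<open>auto simp: sub_def\<close>)

lemma mem_un [simp]: "x \<^bold>\<in> a \<^bold>\<union> b \<longleftrightarrow> x \<^bold>\<in> a \<or> x \<^bold>\<in> b"
proof -
  have "\<forall>x. x \<^bold>\<in> bigun (upair a b) \<longleftrightarrow> x \<^bold>\<in> a \<or> x \<^bold>\<in> b" by auto
  then show ?thesis unfolding un_def by (intro mem_Coll) blast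
qed

lemma mem_int [simp]: "x \<^bold>\<in> a \<^bold>\<inter> b \<longleftrightarrow> x \<^bold>\<in> a \<and> x \<^bold>\<in> b"
  unfolding int_def by (rule mem_Coll_bounded[of _ a]) (intro definable_intros | simp)+

lemma mem_diff [simp]: "x \<^bold>\<in> a \<^bold>- b \<longleftrightarrow> x \<^bold>\<in> a \<and> \<not> x \<^bold>\<in> b"
  unfolding diff_def by (rule mem_Coll_bounded[of _ a]) (intro definable_intros | simp)+

lemma upair_eq_iff: "upair a b = upair c d \<longleftrightarrow> a = c \<and> b = d \<or> a = d \<and> b = c"
proof
  assume "upair a b = upair c d"
  then have "x = a \<or> x = b \<longleftrightarrow> x = c \<or> x = d" for x by (metis mem_upair)
  from this[of a] this[of b] this[of c] this[of d]
  show "a = c \<and> b = d \<or> a = d \<and> b = c" by blast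
qed (auto intro!: set_eqI)

lemma opair_eq [simp]: "opair a b = opair c d \<longleftrightarrow> a = c \<and> b = d"
  unfolding opair_def by (auto simp: upair_eq_iff)

text \<open>
  By extensionality, a term is definable once membership in its value is.
\<close>

lemma definable_fun_extensional:
  assumes "\<And>x e. x \<^bold>\<in> t e \<longleftrightarrow> Q e x"
    and "definable (\<lambda>e. Q (\<lambda>i. e (Suc (Suc i))) (e 0))"
  shows "definable_fun t"
proof -
  have eq: "y = t e \<longleftrightarrow> (\<forall>x. x \<^bold>\<in> y \<longleftrightarrow> Q e x)" for y e
    using set_eqI[of y "t e"] assms(1) by auto
  show ?thesis unfolding definable_fun_def eq by (intro definable_intros assms(2))
qed

lemma definable_fun_upair:
  assumes "definable_fun t" "definable_fun u" shows "definable_fun (\<lambda>e. upair (t e) (u e))"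
  by (rule definable_fun_extensional, rule mem_upair)
    (intro definable_intros assms[THEN definable_fun_rename])

lemma definable_fun_opair:
  assumes "definable_fun t" "definable_fun u" shows "definable_fun (\<lambda>e. opair (t e) (u e))"
  unfolding opair_def by (intro definable_fun_upair assms)

lemmas def_intros = definable_intros definable_fun_opair

lemma mem_cprod: "z \<^bold>\<in> a \<^bold>\<times> b \<longleftrightarrow> (\<exists>x y. x \<^bold>\<in> a \<and> y \<^bold>\<in> b \<and> z = opair x y)"
proof -
  have "z \<^bold>\<in> a \<^bold>\<times> b \<longleftrightarrow> (\<exists>x\<in>elts a. \<exists>y\<in>elts b. z = opair x y)"
    unfolding cprod_def
  proof (rule mem_Coll_bounded[of _ "pow (pow (a \<^bold>\<union> b))"])
    show "definable (\<lambda>e. \<exists>x\<in>elts a. \<exists>y\<in>elts b. e 0 = opair x y)" by (intro def_intros)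
  qed (auto simp: opair_def sub_def)
  then show ?thesis by auto
qed

lemma opair_mem_cprod [simp]: "opair x y \<^bold>\<in> a \<^bold>\<times> b \<longleftrightarrow> x \<^bold>\<in> a \<and> y \<^bold>\<in> b"
  by (auto simp: mem_cprod)

lemma definable_fun_int:
  assumes "definable_fun t" "definable_fun u" shows "definable_fun (\<lambda>e. t e \<^bold>\<inter> u e)"
  by (rule definable_fun_extensional, rule mem_int)
    (intro def_intros assms[THEN definable_fun_rename])

lemma definable_fun_bigun:
  assumes "definable_fun t" shows "definable_fun (\<lambda>e. bigun (t e))"
  by (rule definable_fun_extensional, rule mem_bigun)
    (intro def_intros assms[THEN definable_fun_rename])

lemma definable_fun_un:
  assumes "definable_fun t" "definable_fun u" shows "definable_fun (\<lambda>e. t e \<^bold>\<union> u e)"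
  by (rule definable_fun_extensional, rule mem_un)
    (intro def_intros assms[THEN definable_fun_rename])

lemma definable_fun_diff:
  assumes "definable_fun t" "definable_fun u" shows "definable_fun (\<lambda>e. t e \<^bold>- u e)"
  by (rule definable_fun_extensional, rule mem_diff)
    (intro def_intros assms[THEN definable_fun_rename])

lemma definable_fun_cprod:
  assumes "definable_fun t" "definable_fun u" shows "definable_fun (\<lambda>e. t e \<^bold>\<times> u e)"
  by (rule definable_fun_extensional, rule mem_cprod)
    (intro def_intros assms[THEN definable_fun_rename])

lemma sub_refl [simp]: "a \<^bold>\<subseteq> a" by (simp add: sub_def)
lemma subD: "a \<^bold>\<subseteq> b \<Longrightarrow> x \<^bold>\<in> a \<Longrightarrow> x \<^bold>\<in> b" by (simp add: sub_def)

subsection \<open>Functions\<close>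

lemma app_eqI: "fun_on f a \<Longrightarrow> opair x y \<^bold>\<in> f \<Longrightarrow> app f x = y"
  unfolding fun_on_def app_def by (rule the1_equality) (auto 4 4)

lemma fun_on_pair_iff:
  assumes "fun_on f a" shows "opair x y \<^bold>\<in> f \<longleftrightarrow> x \<^bold>\<in> a \<and> app f x = y"
proof
  assume xy: "opair x y \<^bold>\<in> f"
  then obtain x' y' where "x' \<^bold>\<in> a" "opair x y = opair x' y'"
    using assms unfolding fun_on_def by blast
  then show "x \<^bold>\<in> a \<and> app f x = y" using app_eqI[OF assms xy] by simp
next
  assume xy: "x \<^bold>\<in> a \<and> app f x = y"
  then obtain z where "opair x z \<^bold>\<in> f" using assms unfolding fun_on_def by blast
  then show "opair x y \<^bold>\<in> f" using app_eqI[OF assms] xy by metis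
qed

lemma func_pair_iff: "func f a b \<Longrightarrow> opair x y \<^bold>\<in> f \<longleftrightarrow> x \<^bold>\<in> a \<and> app f x = y"
  by (simp add: func_def fun_on_pair_iff)

lemma func_app: "func f a b \<Longrightarrow> x \<^bold>\<in> a \<Longrightarrow> app f x \<^bold>\<in> b"
  by (simp add: func_def)

lemma func_sub: "func f a b \<Longrightarrow> f \<^bold>\<subseteq> a \<^bold>\<times> b"
proof -
  assume f: "func f a b"
  have "z \<^bold>\<in> a \<^bold>\<times> b" if z: "z \<^bold>\<in> f" for z
  proof -
    obtain x y where "x \<^bold>\<in> a" "z = opair x y"
      using f z unfolding func_def fun_on_def by blast
    then show ?thesis using func_pair_iff[OF f] func_app[OF f] z by auto
  qed
  then show ?thesis by (simp add: sub_def)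
qed

lemma funcI:
  assumes "f \<^bold>\<subseteq> a \<^bold>\<times> b" "\<And>x. x \<^bold>\<in> a \<Longrightarrow> \<exists>!y. opair x y \<^bold>\<in> f"
  shows "func f a b"
proof -
  have 1: "fun_on f a" using assms by (auto simp: fun_on_def sub_def mem_cprod)
  moreover have "app f x \<^bold>\<in> b" if "x \<^bold>\<in> a" for x
    by (metis 1 assms app_eqI opair_mem_cprod subD that)
  ultimately show ?thesis by (simp add: func_def)
qed

lemma func_iff: "func f a b \<longleftrightarrow> f \<^bold>\<subseteq> a \<^bold>\<times> b \<and>
    (\<forall>x\<in>elts a. \<exists>y. opair x y \<^bold>\<in> f \<and> (\<forall>z. opair x z \<^bold>\<in> f \<longrightarrow> z = y))"
proof
  assume f: "func f a b"
  then show "f \<^bold>\<subseteq> a \<^bold>\<times> b \<and> (\<forall>x\<in>elts a. \<exists>y. opair x y \<^bold>\<in> f \<and> (\<forall>z. opair x z \<^bold>\<in> f \<longrightarrow> z = y))"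
    by (simp add: func_sub func_pair_iff[OF f])
next
  assume *: "f \<^bold>\<subseteq> a \<^bold>\<times> b \<and>
    (\<forall>x\<in>elts a. \<exists>y. opair x y \<^bold>\<in> f \<and> (\<forall>z. opair x z \<^bold>\<in> f \<longrightarrow> z = y))"
  show "func f a b"
  proof (rule funcI)
    show "f \<^bold>\<subseteq> a \<^bold>\<times> b" using * by blast
    show "\<exists>!y. opair x y \<^bold>\<in> f" if "x \<^bold>\<in> a" for x using * that by (metis mem_Collect_eq)
  qed
qed

lemma func_eqI:
  assumes "func f a b" "func g a c" "\<And>x. x \<^bold>\<in> a \<Longrightarrow> app f x = app g x"
  shows "f = g"
proof (rule set_eqI)
  fix z
  have "opair x y \<^bold>\<in> f \<longleftrightarrow> opair x y \<^bold>\<in> g" for x y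
    using assms(3) by (auto simp: func_pair_iff[OF assms(1)] func_pair_iff[OF assms(2)])
  moreover have "\<exists>x y. z = opair x y" if "z \<^bold>\<in> f \<or> z \<^bold>\<in> g"
    using that func_sub[OF assms(1)] func_sub[OF assms(2)] by (auto dest!: subD simp: mem_cprod)
  ultimately show "z \<^bold>\<in> f \<longleftrightarrow> z \<^bold>\<in> g" by blast
qed

lemma unique_in_setI:
  "a \<^bold>\<in> b \<Longrightarrow> P a \<Longrightarrow> (\<And>x. x \<^bold>\<in> b \<Longrightarrow> P x \<Longrightarrow> x = a) \<Longrightarrow>
    \<exists>y. y \<^bold>\<in> b \<and> (\<forall>x. x \<^bold>\<in> b \<longrightarrow> P x \<longleftrightarrow> x = y)"
  by blast

text \<open>
  When the values lie in a known set, separation on the product replaces the replacement scheme. The conclusion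
  determines the function by the defining relation rather than by a term, since application is not a definable term: off
  functions, \<open>app\<close> is an arbitrary value of the description operator.
\<close>

lemma ex_func:
  assumes "definable (\<lambda>e. P (e 0) (e (Suc 0)))"
    and "\<And>x. x \<^bold>\<in> a \<Longrightarrow> \<exists>y. y \<^bold>\<in> b \<and> (\<forall>z. z \<^bold>\<in> b \<longrightarrow> P x z \<longleftrightarrow> z = y)"
  shows "\<exists>f. func f a b \<and> (\<forall>x. x \<^bold>\<in> a \<longrightarrow> P x (app f x)) \<and>
    (\<forall>x y. x \<^bold>\<in> a \<longrightarrow> y \<^bold>\<in> b \<longrightarrow> (app f x = y \<longleftrightarrow> P x y))"
proof -
  have "definable (\<lambda>e. P (e (Suc 0)) (e 0))"
    using definable_rename[OF assms(1), of "\<lambda>i. if i = 0 then 1 else 0"] by simp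
  then have "definable (\<lambda>e. \<exists>x y. e 0 = opair x y \<and> P x y)"
    by (intro def_intros)
  from separation_definable[OF this, of "a \<^bold>\<times> b"] obtain f where
    f: "\<And>z. z \<^bold>\<in> f \<longleftrightarrow> z \<^bold>\<in> a \<^bold>\<times> b \<and> (\<exists>x y. z = opair x y \<and> P x y)" by blast
  have f': "opair x y \<^bold>\<in> f \<longleftrightarrow> x \<^bold>\<in> a \<and> y \<^bold>\<in> b \<and> P x y" for x y by (auto simp: f)
  have *: "func f a b"
  proof (rule funcI)
    show "f \<^bold>\<subseteq> a \<^bold>\<times> b" by (simp add: sub_def f)
    show "\<exists>!y. opair x y \<^bold>\<in> f" if "x \<^bold>\<in> a" for x using assms(2)[OF that] that f' by blast
  qed
  then have **: "app f x = y \<longleftrightarrow> P x y" if "x \<^bold>\<in> a" "y \<^bold>\<in> b" for x y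
    using func_pair_iff[OF *, of x y] f' that by blast
  then show ?thesis using * func_app[OF *] by blast
qed

lemma mem_exponent [simp]: "f \<^bold>\<in> exponent b j \<longleftrightarrow> func f j b"
  unfolding exponent_def
proof (rule mem_Coll_bounded[of _ "pow (j \<^bold>\<times> b)"])
  show "definable (\<lambda>e. func (e 0) j b)" unfolding func_iff by (intro def_intros)
qed (simp add: func_sub)

lemma mem_preimage:
  assumes "func f a b" shows "x \<^bold>\<in> preimage f a v \<longleftrightarrow> x \<^bold>\<in> a \<and> app f x \<^bold>\<in> v"
  unfolding preimage_def
proof (rule mem_Coll)
  have "definable (\<lambda>e. \<exists>y. opair (e 0) y \<^bold>\<in> f \<and> y \<^bold>\<in> v)" by (intro def_intros)
  from separation_definable[OF this, of a]
  show "\<exists>c. \<forall>x. x \<^bold>\<in> c \<longleftrightarrow> x \<^bold>\<in> a \<and> app f x \<^bold>\<in> v"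
    by (auto simp: func_pair_iff[OF assms])
qed

lemma mem_image:
  assumes "func f a b" "u \<^bold>\<subseteq> a"
  shows "y \<^bold>\<in> image f u \<longleftrightarrow> (\<exists>x. x \<^bold>\<in> u \<and> y = app f x)"
proof -
  have "definable (\<lambda>e. \<exists>x. x \<^bold>\<in> u \<and> opair x (e 0) \<^bold>\<in> f)" by (intro def_intros)
  from separation_definable[OF this, of b] obtain c where
    c: "\<And>y. y \<^bold>\<in> c \<longleftrightarrow> y \<^bold>\<in> b \<and> (\<exists>x. x \<^bold>\<in> u \<and> opair x y \<^bold>\<in> f)" by blast
  have "y \<^bold>\<in> c \<longleftrightarrow> (\<exists>x\<in>elts u. y = app f x)" for y
    using func_app[OF assms(1)] subD[OF assms(2)] by (auto simp: c func_pair_iff[OF assms(1)])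
  then show ?thesis unfolding image_def using mem_Coll[of "\<lambda>y. \<exists>x\<in>elts u. y = app f x" y] by auto
qed

subsection \<open>Natural numbers\<close>

abbreviation succ :: "'a \<Rightarrow> 'a" where "succ n \<equiv> n \<^bold>\<union> upair n n"

lemma mem_omega: "n \<^bold>\<in> omega \<longleftrightarrow> (\<forall>i. is_inductive i \<longrightarrow> n \<^bold>\<in> i)"
proof -
  have eq: "is_inductive i \<longleftrightarrow> empty \<^bold>\<in> i \<and>
      (\<forall>n\<in>elts i. \<exists>m. m \<^bold>\<in> i \<and> (\<forall>x. x \<^bold>\<in> m \<longleftrightarrow> x \<^bold>\<in> n \<or> x = n))" for i
  proof -
    have "(\<exists>m. m \<^bold>\<in> i \<and> (\<forall>x. x \<^bold>\<in> m \<longleftrightarrow> x \<^bold>\<in> n \<or> x = n)) \<longleftrightarrow> succ n \<^bold>\<in> i" for n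
    proof
      assume "\<exists>m. m \<^bold>\<in> i \<and> (\<forall>x. x \<^bold>\<in> m \<longleftrightarrow> x \<^bold>\<in> n \<or> x = n)"
      then obtain m where m: "m \<^bold>\<in> i" "\<And>x. x \<^bold>\<in> m \<longleftrightarrow> x \<^bold>\<in> n \<or> x = n" by blast
      have "m = succ n" by (rule set_eqI) (auto simp: m(2))
      then show "succ n \<^bold>\<in> i" using m(1) by simp
    qed (rule exI[of _ "succ n"], simp)
    then show ?thesis unfolding is_inductive_def by simp
  qed
  obtain i where "is_inductive i" using infinity eq by (metis empty_iff mem_Collect_eq)
  show ?thesis unfolding omega_def
  proof (rule mem_Coll_bounded[of _ i])
    show "definable (\<lambda>e. \<forall>i. is_inductive i \<longrightarrow> e 0 \<^bold>\<in> i)" unfolding eq by (intro def_intros)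
  qed (use \<open>is_inductive i\<close> in blast)
qed

lemma zero_omega [simp]: "empty \<^bold>\<in> omega" by (simp add: mem_omega is_inductive_def)

lemma succ_omega [simp]: "n \<^bold>\<in> omega \<Longrightarrow> succ n \<^bold>\<in> omega"
  by (simp add: mem_omega is_inductive_def)

text \<open>
  Induction is available for definable predicates only: \<open>\<omega>\<close> of the model is its least inductive
  \<^emph>\<open>set\<close> and may be nonstandard.
\<close>

lemma omega_induct:
  assumes n: "n \<^bold>\<in> omega" and D: "definable (\<lambda>e. P (e 0))" and 0: "P empty"
    and S: "\<And>n. n \<^bold>\<in> omega \<Longrightarrow> P n \<Longrightarrow> P (succ n)"
  shows "P n"
proof -
  obtain i where i: "\<And>x. x \<^bold>\<in> i \<longleftrightarrow> x \<^bold>\<in> omega \<and> P x"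
    using separation_definable[OF D, of omega] by blast
  have "is_inductive i" using 0 S by (simp add: is_inductive_def i)
  then show ?thesis using n i mem_omega by blast
qed

lemma omega_cases:
  assumes "n \<^bold>\<in> omega" obtains "n = empty" | m where "m \<^bold>\<in> omega" "n = succ m"
proof -
  have "n = empty \<or> (\<exists>m. m \<^bold>\<in> omega \<and> (\<forall>x. x \<^bold>\<in> n \<longleftrightarrow> x \<^bold>\<in> m \<or> x = m))"
    by (rule omega_induct[OF assms, of "\<lambda>n. n = empty \<or> (\<exists>m. m \<^bold>\<in> omega \<and> (\<forall>x. x \<^bold>\<in> n \<longleftrightarrow> x \<^bold>\<in> m \<or> x = m))"])
      (intro def_intros, auto)
  then show thesis
  proof
    assume "\<exists>m. m \<^bold>\<in> omega \<and> (\<forall>x. x \<^bold>\<in> n \<longleftrightarrow> x \<^bold>\<in> m \<or> x = m)"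
    then obtain m where "m \<^bold>\<in> omega" "\<forall>x. x \<^bold>\<in> n \<longleftrightarrow> x \<^bold>\<in> m \<or> x = m" by blast
    then have "n = succ m" by (intro set_eqI) auto
    then show thesis using that(2) \<open>m \<^bold>\<in> omega\<close> by blast
  qed (rule that)
qed

lemma omega_trans:
  assumes "n \<^bold>\<in> omega" "m \<^bold>\<in> n" shows "m \<^bold>\<in> omega" "m \<^bold>\<subseteq> n"
proof -
  have "\<forall>m\<in>elts n. m \<^bold>\<in> omega \<and> m \<^bold>\<subseteq> n"
    by (rule omega_induct[OF assms(1), of "\<lambda>n. \<forall>m\<in>elts n. m \<^bold>\<in> omega \<and> m \<^bold>\<subseteq> n"])
      (intro def_intros, auto simp: sub_def)
  then show "m \<^bold>\<in> omega" "m \<^bold>\<subseteq> n" using assms(2) by auto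
qed

lemma not_mem_mem: "\<not> (x \<^bold>\<in> y \<and> y \<^bold>\<in> x)"
  using foundation[of "upair x y"] by auto

lemma mem_irrefl: "\<not> x \<^bold>\<in> x"
  using not_mem_mem[of x x] by blast

lemma succ_neq_empty: "succ n \<noteq> empty"
  by (metis mem_empty mem_un mem_upair)

lemma succ_inject: "succ m = succ n \<longleftrightarrow> m = n"
  by (metis mem_un mem_upair not_mem_mem)

lemma zero_mem_omega:
  assumes "n \<^bold>\<in> omega" shows "n = empty \<or> empty \<^bold>\<in> n"
proof (rule omega_induct[OF assms, of "\<lambda>n. n = empty \<or> empty \<^bold>\<in> n"])
  show "definable (\<lambda>e. e 0 = empty \<or> empty \<^bold>\<in> e 0)" by (intro def_intros)
qed auto

lemma succ_mem_omega:
  assumes "n \<^bold>\<in> omega" "m \<^bold>\<in> n" shows "succ m \<^bold>\<in> n \<or> succ m = n"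
proof -
  have "\<forall>m. m \<^bold>\<in> n \<longrightarrow> succ m \<^bold>\<in> n \<or> succ m = n"
  proof (rule omega_induct[OF assms(1), of "\<lambda>n. \<forall>m. m \<^bold>\<in> n \<longrightarrow> succ m \<^bold>\<in> n \<or> succ m = n"])
    show "definable (\<lambda>e. \<forall>m. m \<^bold>\<in> e 0 \<longrightarrow> succ m \<^bold>\<in> e 0 \<or> succ m = e 0)"
      by (intro def_intros definable_fun_un definable_fun_upair)
  qed auto
  then show ?thesis using assms(2) by blast
qed

lemma omega_trichotomy:
  assumes "m \<^bold>\<in> omega" "n \<^bold>\<in> omega" shows "m \<^bold>\<in> n \<or> m = n \<or> n \<^bold>\<in> m"
proof -
  have "\<forall>m\<in>elts omega. m \<^bold>\<in> n \<or> m = n \<or> n \<^bold>\<in> m"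
  proof (rule omega_induct[OF assms(2), of "\<lambda>n. \<forall>m\<in>elts omega. m \<^bold>\<in> n \<or> m = n \<or> n \<^bold>\<in> m"])
    show "definable (\<lambda>e. \<forall>m\<in>elts omega. m \<^bold>\<in> e 0 \<or> m = e 0 \<or> e 0 \<^bold>\<in> m)"
      by (intro def_intros)
    show "\<forall>m\<in>elts omega. m \<^bold>\<in> empty \<or> m = empty \<or> empty \<^bold>\<in> m" using zero_mem_omega by auto
    fix n assume "\<forall>m\<in>elts omega. m \<^bold>\<in> n \<or> m = n \<or> n \<^bold>\<in> m"
    then show "\<forall>m\<in>elts omega. m \<^bold>\<in> succ n \<or> m = succ n \<or> succ n \<^bold>\<in> m"
      using succ_mem_omega by (metis mem_Collect_eq mem_un mem_upair)
  qed
  then show ?thesis using assms(1) by blast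
qed

section \<open>Topology in a model\<close>

abbreviation near :: "'a \<Rightarrow> 'a \<Rightarrow> ('a \<Rightarrow> bool) \<Rightarrow> bool" where
  "near T x P \<equiv> \<exists>U. U \<^bold>\<in> T \<and> x \<^bold>\<in> U \<and> (\<forall>y. y \<^bold>\<in> U \<longrightarrow> P y)"

lemma topology_sub: "topology X T \<Longrightarrow> U \<^bold>\<in> T \<Longrightarrow> U \<^bold>\<subseteq> X"
  by (auto simp: topology_def dest: subD)

lemma topology_space: "topology X T \<Longrightarrow> X \<^bold>\<in> T"
  by (simp add: topology_def)

lemma topology_int: "topology X T \<Longrightarrow> U \<^bold>\<in> T \<Longrightarrow> V \<^bold>\<in> T \<Longrightarrow> U \<^bold>\<inter> V \<^bold>\<in> T"
  by (simp add: topology_def)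

text \<open>
  The union of all open subsets of \<open>U\<close> is a set of the model by separation, and it is \<open>U\<close>. No
  neighbourhoods are chosen, and openness may be checked pointwise.
\<close>

lemma open_locally:
  assumes T: "topology X T" and "\<And>x. x \<^bold>\<in> U \<Longrightarrow> \<exists>V. V \<^bold>\<in> T \<and> x \<^bold>\<in> V \<and> V \<^bold>\<subseteq> U"
  shows "U \<^bold>\<in> T"
proof -
  have "definable (\<lambda>e. e 0 \<^bold>\<subseteq> U)" by (intro def_intros)
  from separation_definable[OF this, of T] obtain \<V> where
    V: "\<And>V. V \<^bold>\<in> \<V> \<longleftrightarrow> V \<^bold>\<in> T \<and> V \<^bold>\<subseteq> U" by blast
  have "U = bigun \<V>"
    by (rule set_eqI) (use assms(2) in \<open>auto simp: V dest: subD\<close>)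
  moreover have "\<V> \<^bold>\<subseteq> T" by (simp add: sub_def V)
  ultimately show ?thesis using T by (simp add: topology_def)
qed

lemma mem_subspace_top: "V \<^bold>\<in> subspace_top T S \<longleftrightarrow> (\<exists>U. U \<^bold>\<in> T \<and> V = U \<^bold>\<inter> S)"
proof -
  have "V \<^bold>\<in> subspace_top T S \<longleftrightarrow> (\<exists>U\<in>elts T. V = U \<^bold>\<inter> S)"
    unfolding subspace_top_def
  proof (rule mem_Coll_bounded[of _ "pow S"])
    show "definable (\<lambda>e. \<exists>U\<in>elts T. e 0 = U \<^bold>\<inter> S)"
      by (intro def_intros definable_fun_int)
  qed (auto simp: sub_def)
  then show ?thesis by auto
qed

lemma subspace_open_locally:
  assumes T: "topology X T" and "V \<^bold>\<subseteq> S"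
    and "\<And>x. x \<^bold>\<in> V \<Longrightarrow> \<exists>U. U \<^bold>\<in> T \<and> x \<^bold>\<in> U \<and> U \<^bold>\<inter> S \<^bold>\<subseteq> V"
  shows "V \<^bold>\<in> subspace_top T S"
proof -
  have "definable (\<lambda>e. e 0 \<^bold>\<inter> S \<^bold>\<subseteq> V)" by (intro def_intros definable_fun_int)
  from separation_definable[OF this, of T] obtain \<U> where
    U: "\<And>U. U \<^bold>\<in> \<U> \<longleftrightarrow> U \<^bold>\<in> T \<and> U \<^bold>\<inter> S \<^bold>\<subseteq> V" by blast
  have "\<U> \<^bold>\<subseteq> T" by (simp add: sub_def U)
  then have "bigun \<U> \<^bold>\<in> T" using T by (simp add: topology_def)
  moreover have "V = bigun \<U> \<^bold>\<inter> S"
  proof (rule set_eqI)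
    fix x
    show "x \<^bold>\<in> V \<longleftrightarrow> x \<^bold>\<in> bigun \<U> \<^bold>\<inter> S"
      using assms(3)[of x] subD[OF assms(2), of x] by (auto simp: U sub_def)
  qed
  ultimately show ?thesis unfolding mem_subspace_top by blast
qed

lemma definable_topology:
  assumes "definable_fun t" shows "definable (\<lambda>e. topology X (t e))"
  unfolding topology_def
  by (intro def_intros definable_fun_int definable_fun_bigun assms definable_fun_rename[OF assms])

lemma topology_pow: "topology X (pow X)"
  by (auto simp: topology_def sub_def)

lemma mem_generated_topology:
  assumes "\<S> \<^bold>\<subseteq> pow X"
  shows "V \<^bold>\<in> generated_topology X \<S> \<longleftrightarrow> (\<forall>T. topology X T \<and> \<S> \<^bold>\<subseteq> T \<longrightarrow> V \<^bold>\<in> T)"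
  unfolding generated_topology_def
proof (rule mem_Coll_bounded[of _ "pow X"])
  show "definable (\<lambda>e. \<forall>T. topology X T \<and> \<S> \<^bold>\<subseteq> T \<longrightarrow> e 0 \<^bold>\<in> T)"
    by (intro def_intros definable_topology)
qed (use assms topology_pow in blast)

lemma topology_generated:
  assumes "\<S> \<^bold>\<subseteq> pow X" shows "topology X (generated_topology X \<S>)"
proof -
  note mem = mem_generated_topology[OF assms]
  have "\<U> \<^bold>\<subseteq> T" if "\<U> \<^bold>\<subseteq> generated_topology X \<S>" "topology X T" "\<S> \<^bold>\<subseteq> T" for \<U> T
    using that by (simp add: sub_def mem)
  then have "bigun \<U> \<^bold>\<in> generated_topology X \<S>" if "\<U> \<^bold>\<subseteq> generated_topology X \<S>" for \<U>
    using that unfolding mem by (metis topology_def)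
  moreover have "generated_topology X \<S> \<^bold>\<subseteq> pow X"
    using assms topology_pow by (metis mem mem_Collect_eq sub_def)
  ultimately show ?thesis
    unfolding topology_def by (auto simp: mem) (auto simp: topology_def)
qed

text \<open>
  The product topology is only known as the least topology of the model that contains the slabs over open sets of
  \<open>E\<close>; facts about its open sets are derived from this minimality.
\<close>

lemma mem_power_top:
  "V \<^bold>\<in> power_top E TE J \<longleftrightarrow> (\<forall>T. topology (exponent E J) T \<and>
     (\<forall>j U W. j \<^bold>\<in> J \<longrightarrow> U \<^bold>\<in> TE \<longrightarrow> (\<forall>x. x \<^bold>\<in> W \<longleftrightarrow> func x J E \<and> app x j \<^bold>\<in> U) \<longrightarrow> W \<^bold>\<in> T)
     \<longrightarrow> V \<^bold>\<in> T)" (is ?A)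
  and topology_power_top: "topology (exponent E J) (power_top E TE J)" (is ?B)
proof -
  define slab where "slab j U = Coll (\<lambda>x. x \<^bold>\<in> exponent E J \<and> app x j \<^bold>\<in> U)" for j U
  have slab: "x \<^bold>\<in> slab j U \<longleftrightarrow> func x J E \<and> app x j \<^bold>\<in> U" if "j \<^bold>\<in> J" for x j U
    unfolding slab_def mem_exponent
  proof (rule mem_Coll)
    have "definable (\<lambda>e. \<exists>y. opair j y \<^bold>\<in> e 0 \<and> y \<^bold>\<in> U)" by (intro def_intros)
    from separation_definable[OF this, of "exponent E J"] obtain c where
      c: "\<And>x. x \<^bold>\<in> c \<longleftrightarrow> func x J E \<and> (\<exists>y. opair j y \<^bold>\<in> x \<and> y \<^bold>\<in> U)" by auto
    have "x \<^bold>\<in> c \<longleftrightarrow> func x J E \<and> app x j \<^bold>\<in> U" for x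
      unfolding c using that by (auto simp: func_pair_iff)
    then show "\<exists>b. \<forall>x. x \<^bold>\<in> b \<longleftrightarrow> func x J E \<and> app x j \<^bold>\<in> U" by blast
  qed
  have slab_eq: "W = slab j U \<longleftrightarrow>
      (\<forall>x. x \<^bold>\<in> W \<longleftrightarrow> x \<^bold>\<in> exponent E J \<and> (\<exists>y. opair j y \<^bold>\<in> x \<and> y \<^bold>\<in> U))" if "j \<^bold>\<in> J" for W j U
  proof
    assume "\<forall>x. x \<^bold>\<in> W \<longleftrightarrow> x \<^bold>\<in> exponent E J \<and> (\<exists>y. opair j y \<^bold>\<in> x \<and> y \<^bold>\<in> U)"
    then show "W = slab j U" using that by (intro set_eqI) (auto simp: slab func_pair_iff)
  qed (use that in \<open>auto simp: slab func_pair_iff\<close>)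
  define \<S> where "\<S> = Coll (\<lambda>W. \<exists>j\<in>elts J. \<exists>U\<in>elts TE. W = slab j U)"
  have S: "W \<^bold>\<in> \<S> \<longleftrightarrow> (\<exists>j\<in>elts J. \<exists>U\<in>elts TE. W = slab j U)" for W
    unfolding \<S>_def
  proof (rule mem_Coll_bounded[of _ "pow (exponent E J)"])
    have "definable (\<lambda>e. \<exists>j\<in>elts J. \<exists>U\<in>elts TE. \<forall>x. x \<^bold>\<in> e 0 \<longleftrightarrow>
        x \<^bold>\<in> exponent E J \<and> (\<exists>y. opair j y \<^bold>\<in> x \<and> y \<^bold>\<in> U))" by (intro def_intros)
    moreover have "(\<exists>j\<in>elts J. \<exists>U\<in>elts TE. W = slab j U) \<longleftrightarrow>
        (\<exists>j\<in>elts J. \<exists>U\<in>elts TE. \<forall>x. x \<^bold>\<in> W \<longleftrightarrow>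
          x \<^bold>\<in> exponent E J \<and> (\<exists>y. opair j y \<^bold>\<in> x \<and> y \<^bold>\<in> U))" for W
      by (intro bex_cong refl slab_eq) simp
    ultimately show "definable (\<lambda>e. \<exists>j\<in>elts J. \<exists>U\<in>elts TE. e 0 = slab j U)"
      by simp
  qed (auto simp: sub_def slab)
  have sub: "\<S> \<^bold>\<subseteq> pow (exponent E J)"
    by (auto simp: sub_def S slab)
  have eq: "power_top E TE J = generated_topology (exponent E J) \<S>"
    by (simp only: power_top_def \<S>_def slab_def)
  show ?B unfolding eq by (rule topology_generated[OF sub])
  have "\<S> \<^bold>\<subseteq> T \<longleftrightarrow> (\<forall>j U W. j \<^bold>\<in> J \<longrightarrow> U \<^bold>\<in> TE \<longrightarrow>
      (\<forall>x. x \<^bold>\<in> W \<longleftrightarrow> func x J E \<and> app x j \<^bold>\<in> U) \<longrightarrow> W \<^bold>\<in> T)" (is "_ \<longleftrightarrow> ?R") for T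
  proof
    assume T: "\<S> \<^bold>\<subseteq> T"
    show ?R
    proof (intro allI impI)
      fix j U W assume j: "j \<^bold>\<in> J" "U \<^bold>\<in> TE" and W: "\<forall>x. x \<^bold>\<in> W \<longleftrightarrow> func x J E \<and> app x j \<^bold>\<in> U"
      have "W = slab j U" by (rule set_eqI) (simp add: W slab j)
      then show "W \<^bold>\<in> T" using T j by (auto simp: S sub_def)
    qed
  next
    assume ?R then show "\<S> \<^bold>\<subseteq> T" unfolding sub_def S using slab by blast
  qed
  then show ?A unfolding eq mem_generated_topology[OF sub] by simp
qed

lemma power_top_slab:
  assumes "j \<^bold>\<in> J" "U \<^bold>\<in> TE"
  shows "\<exists>W. W \<^bold>\<in> power_top E TE J \<and> (\<forall>x. x \<^bold>\<in> W \<longleftrightarrow> func x J E \<and> app x j \<^bold>\<in> U)"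
proof -
  have "definable (\<lambda>e. \<exists>y. opair j y \<^bold>\<in> e 0 \<and> y \<^bold>\<in> U)" by (intro def_intros)
  from separation_definable[OF this, of "exponent E J"] obtain W where
    W: "\<And>x. x \<^bold>\<in> W \<longleftrightarrow> func x J E \<and> (\<exists>y. opair j y \<^bold>\<in> x \<and> y \<^bold>\<in> U)" by auto
  have "x \<^bold>\<in> W \<longleftrightarrow> func x J E \<and> app x j \<^bold>\<in> U" for x
    unfolding W using assms by (auto simp: func_pair_iff)
  then show ?thesis unfolding mem_power_top using assms by blast
qed

text \<open>
  The sets of \<open>E\<^sup>J\<close> whose preimage is open form a topology of the model that contains the slabs,
  hence all open sets of the product. The preimage is tested pointwise with open sets of \<open>X\<close>, which spares
  the subspace topology on \<open>S\<close>.
\<close>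

lemma continuous_into_power:
  assumes T: "topology X T" and S: "S \<^bold>\<subseteq> X" and f: "func f S (exponent E J)"
    and coord: "\<And>j U x. j \<^bold>\<in> J \<Longrightarrow> U \<^bold>\<in> TE \<Longrightarrow> x \<^bold>\<in> S \<Longrightarrow> app (app f x) j \<^bold>\<in> U \<Longrightarrow>
      near T x (\<lambda>y. y \<^bold>\<in> S \<longrightarrow> app (app f y) j \<^bold>\<in> U)"
    and Q: "Q \<^bold>\<in> power_top E TE J" and x: "x \<^bold>\<in> S" "app f x \<^bold>\<in> Q"
  shows "near T x (\<lambda>y. y \<^bold>\<in> S \<longrightarrow> app f y \<^bold>\<in> Q)"
proof -
  let ?P = "\<lambda>Q. \<forall>x. x \<^bold>\<in> S \<longrightarrow> app f x \<^bold>\<in> Q \<longrightarrow>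
    (near T x (\<lambda>y. y \<^bold>\<in> S \<longrightarrow> app f y \<^bold>\<in> Q))"
  have "definable (\<lambda>e. \<forall>x z. opair x z \<^bold>\<in> f \<longrightarrow> z \<^bold>\<in> e 0 \<longrightarrow>
    (\<exists>V. V \<^bold>\<in> T \<and> x \<^bold>\<in> V \<and> (\<forall>y w. y \<^bold>\<in> V \<longrightarrow> opair y w \<^bold>\<in> f \<longrightarrow> w \<^bold>\<in> e 0)))"
    by (intro def_intros)
  from separation_definable[OF this, of "pow (exponent E J)"] obtain \<T> where
    \<T>: "\<And>Q. Q \<^bold>\<in> \<T> \<longleftrightarrow> Q \<^bold>\<subseteq> exponent E J \<and> ?P Q"
    by (auto simp: func_pair_iff[OF f])
  have "topology (exponent E J) \<T>"
    unfolding topology_def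
  proof (intro conjI ballI allI impI; clarsimp?)
    show "\<T> \<^bold>\<subseteq> pow (exponent E J)" by (simp add: sub_def \<T>)
    show "empty \<^bold>\<in> \<T>" by (simp add: sub_def \<T>)
    show "exponent E J \<^bold>\<in> \<T>"
      using topology_space[OF T] subD[OF S] func_app[OF f] by (auto simp: \<T>)
  next
    fix U V assume UV: "U \<^bold>\<in> \<T>" "V \<^bold>\<in> \<T>"
    show "U \<^bold>\<inter> V \<^bold>\<in> \<T>" unfolding \<T>
    proof (intro conjI allI impI)
      show "U \<^bold>\<inter> V \<^bold>\<subseteq> exponent E J" using UV by (simp add: \<T> sub_def)
      fix x assume x: "x \<^bold>\<in> S" "app f x \<^bold>\<in> U \<^bold>\<inter> V"
      obtain A where "A \<^bold>\<in> T" "x \<^bold>\<in> A" "\<forall>y. y \<^bold>\<in> A \<longrightarrow> y \<^bold>\<in> S \<longrightarrow> app f y \<^bold>\<in> U"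
        using UV x by (auto simp: \<T>)
      moreover obtain B where "B \<^bold>\<in> T" "x \<^bold>\<in> B" "\<forall>y. y \<^bold>\<in> B \<longrightarrow> y \<^bold>\<in> S \<longrightarrow> app f y \<^bold>\<in> V"
        using UV x by (auto simp: \<T>)
      ultimately show "near T x (\<lambda>y. y \<^bold>\<in> S \<longrightarrow> app f y \<^bold>\<in> U \<^bold>\<inter> V)"
        using topology_int[OF T] by (intro exI[of _ "A \<^bold>\<inter> B"]) auto
    qed
  next
    fix \<U> assume U: "\<U> \<^bold>\<subseteq> \<T>"
    show "bigun \<U> \<^bold>\<in> \<T>" unfolding \<T>
    proof (intro conjI allI impI)
      have "A \<^bold>\<subseteq> exponent E J" if "A \<^bold>\<in> \<U>" for A using subD[OF U that] by (simp add: \<T>)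
      then show "bigun \<U> \<^bold>\<subseteq> exponent E J" by (auto simp: sub_def)
      fix x assume x: "x \<^bold>\<in> S" "app f x \<^bold>\<in> bigun \<U>"
      then obtain Q where Q: "Q \<^bold>\<in> \<U>" "app f x \<^bold>\<in> Q" by auto
      then have "?P Q" using U by (auto simp: sub_def \<T>)
      with Q x show "near T x (\<lambda>y. y \<^bold>\<in> S \<longrightarrow> app f y \<^bold>\<in> bigun \<U>)"
        unfolding mem_bigun by blast
    qed
  qed
  moreover have "W \<^bold>\<in> \<T>" if "j \<^bold>\<in> J" "U \<^bold>\<in> TE" "\<forall>x. x \<^bold>\<in> W \<longleftrightarrow> func x J E \<and> app x j \<^bold>\<in> U" for j U W
    unfolding \<T>
  proof (intro conjI allI impI)
    show "W \<^bold>\<subseteq> exponent E J" using that(3) by (simp add: sub_def)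
    fix x assume "x \<^bold>\<in> S" "app f x \<^bold>\<in> W"
    then show "near T x (\<lambda>y. y \<^bold>\<in> S \<longrightarrow> app f y \<^bold>\<in> W)"
      using coord[OF that(1,2), of x] func_app[OF f] that(3) by auto
  qed
  ultimately have "Q \<^bold>\<in> \<T>" using Q unfolding mem_power_top by blast
  then show ?thesis using x by (simp add: \<T>)
qed

text \<open>
  Finiteness is that of the model, so the intersection of the neighbourhoods has to be formed by induction on
  \<open>k\<close> inside the model.
\<close>

lemma omega_neighbourhood:
  assumes T: "topology X T" and x: "x \<^bold>\<in> X" and D: "definable (\<lambda>e. \<Phi> (e 0) (e (Suc 0)))"
    and k: "k \<^bold>\<in> omega"
    and ex: "\<And>i. i \<^bold>\<in> k \<Longrightarrow> near T x (\<lambda>y. \<Phi> y i)"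
  shows "\<exists>U. U \<^bold>\<in> T \<and> x \<^bold>\<in> U \<and> (\<forall>y i. y \<^bold>\<in> U \<longrightarrow> i \<^bold>\<in> k \<longrightarrow> \<Phi> y i)"
proof -
  have D': "definable (\<lambda>e. \<Phi> (e i) (e j))" for i j
    using definable_rename[OF D, of "\<lambda>n. if n = 0 then i else j"] by simp
  have "(\<forall>i. i \<^bold>\<in> k \<longrightarrow> (near T x (\<lambda>y. \<Phi> y i))) \<longrightarrow>
      (\<exists>U. U \<^bold>\<in> T \<and> x \<^bold>\<in> U \<and> (\<forall>y i. y \<^bold>\<in> U \<longrightarrow> i \<^bold>\<in> k \<longrightarrow> \<Phi> y i))" (is "?P k")
  proof (rule omega_induct[OF k, of ?P])
    show "definable (\<lambda>e. ?P (e 0))" by (intro def_intros D')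
    show "?P empty" using topology_space[OF T] x by auto
    fix n assume IH: "?P n"
    show "?P (succ n)"
    proof
      assume all: "\<forall>i. i \<^bold>\<in> succ n \<longrightarrow> (near T x (\<lambda>y. \<Phi> y i))"
      then obtain U where U: "U \<^bold>\<in> T" "x \<^bold>\<in> U" "\<And>y i. y \<^bold>\<in> U \<Longrightarrow> i \<^bold>\<in> n \<Longrightarrow> \<Phi> y i"
        using IH by auto
      obtain V where V: "V \<^bold>\<in> T" "x \<^bold>\<in> V" "\<And>y. y \<^bold>\<in> V \<Longrightarrow> \<Phi> y n" using all by auto
      show "\<exists>U. U \<^bold>\<in> T \<and> x \<^bold>\<in> U \<and> (\<forall>y i. y \<^bold>\<in> U \<longrightarrow> i \<^bold>\<in> succ n \<longrightarrow> \<Phi> y i)"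
        using U V topology_int[OF T U(1) V(1)] by (intro exI[of _ "U \<^bold>\<inter> V"]) auto
    qed
  qed
  then show ?thesis using ex by blast
qed

lemma finite_neighbourhood:
  assumes T: "topology X T" and x: "x \<^bold>\<in> X" and D: "definable (\<lambda>e. \<Phi> (e 0) (e (Suc 0)))"
    and a: "finite_set a"
    and ex: "\<And>i. i \<^bold>\<in> a \<Longrightarrow> near T x (\<lambda>y. \<Phi> y i)"
  shows "\<exists>U. U \<^bold>\<in> T \<and> x \<^bold>\<in> U \<and> (\<forall>y i. y \<^bold>\<in> U \<longrightarrow> i \<^bold>\<in> a \<longrightarrow> \<Phi> y i)"
proof -
  obtain n f where n: "n \<^bold>\<in> omega" and f: "bijection f n a" using a by (auto simp: finite_set_def)
  have f_fun: "func f n a" using f by (simp add: bijection_def)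
  have D': "definable (\<lambda>e. \<Phi> (e i) (e j))" for i j
    using definable_rename[OF D, of "\<lambda>n. if n = 0 then i else j"] by simp
  have "\<exists>U. U \<^bold>\<in> T \<and> x \<^bold>\<in> U \<and> (\<forall>y i. y \<^bold>\<in> U \<longrightarrow> i \<^bold>\<in> n \<longrightarrow> (\<forall>w. opair i w \<^bold>\<in> f \<longrightarrow> \<Phi> y w))"
  proof (rule omega_neighbourhood[OF T x _ n])
    show "definable (\<lambda>e. \<forall>w. opair (e (Suc 0)) w \<^bold>\<in> f \<longrightarrow> \<Phi> (e 0) w)" by (intro def_intros D')
    fix i assume "i \<^bold>\<in> n"
    then show "near T x (\<lambda>y. (\<forall>w. opair i w \<^bold>\<in> f \<longrightarrow> \<Phi> y w))"
      using ex[OF func_app[OF f_fun]] by (auto simp: func_pair_iff[OF f_fun])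
  qed
  then obtain U where U: "U \<^bold>\<in> T" "x \<^bold>\<in> U" "\<And>y i. y \<^bold>\<in> U \<Longrightarrow> i \<^bold>\<in> n \<Longrightarrow> \<Phi> y (app f i)"
    by (auto simp: func_pair_iff[OF f_fun])
  have "\<exists>j. j \<^bold>\<in> n \<and> app f j = i" if "i \<^bold>\<in> a" for i using f that unfolding bijection_def by blast
  then show ?thesis using U by blast
qed

end

section \<open>Scales on ordered spaces\<close>

text \<open>
  The order properties shared by the real line and \<open>\<omega>\<close>. The topology \<open>TE\<close> contains the
  open rays, and each point of an open set is the end of half-open intervals inside that set, the lower one possibly
  unbounded. The relation \<open>W\<close> stands for \<open>c \<le> n\<close> between \<open>n \<in> \<omega>\<close>
  and \<open>c \<in> E\<close>. It is described by monotonicity and growth alone, so that for the reals it can be a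
  least closed relation instead of an embedding of \<open>\<omega>\<close>; \<open>z0\<close> is a point below all of
  \<open>\<omega>\<close>.
\<close>

locale ordered_space = ZF_model +
  fixes E TE le W z0 :: 'a
  assumes le_total: "a \<^bold>\<in> E \<Longrightarrow> b \<^bold>\<in> E \<Longrightarrow> opair a b \<^bold>\<in> le \<or> opair b a \<^bold>\<in> le"
    and le_antisym: "a \<^bold>\<in> E \<Longrightarrow> b \<^bold>\<in> E \<Longrightarrow> opair a b \<^bold>\<in> le \<Longrightarrow> opair b a \<^bold>\<in> le \<Longrightarrow> a = b"
    and le_trans: "a \<^bold>\<in> E \<Longrightarrow> b \<^bold>\<in> E \<Longrightarrow> c \<^bold>\<in> E \<Longrightarrow> opair a b \<^bold>\<in> le \<Longrightarrow> opair b c \<^bold>\<in> le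
      \<Longrightarrow> opair a c \<^bold>\<in> le"
    and lub_exists: "A \<^bold>\<subseteq> E \<Longrightarrow> a \<^bold>\<in> A \<Longrightarrow> b \<^bold>\<in> E \<Longrightarrow> \<forall>x\<in>elts A. opair x b \<^bold>\<in> le \<Longrightarrow>
      \<exists>s\<in>elts E. (\<forall>x\<in>elts A. opair x s \<^bold>\<in> le) \<and>
        (\<forall>b\<in>elts E. (\<forall>x\<in>elts A. opair x b \<^bold>\<in> le) \<longrightarrow> opair s b \<^bold>\<in> le)"
    and no_top: "a \<^bold>\<in> E \<Longrightarrow> \<exists>b. b \<^bold>\<in> E \<and> opair a b \<^bold>\<in> le \<and> a \<noteq> b"
    and up_ray: "a \<^bold>\<in> E \<Longrightarrow> \<exists>V. V \<^bold>\<in> TE \<and> (\<forall>x. x \<^bold>\<in> V \<longleftrightarrow> x \<^bold>\<in> E \<and> opair a x \<^bold>\<in> le \<and> a \<noteq> x)"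
    and down_ray: "a \<^bold>\<in> E \<Longrightarrow> \<exists>V. V \<^bold>\<in> TE \<and> (\<forall>x. x \<^bold>\<in> V \<longleftrightarrow> x \<^bold>\<in> E \<and> opair x a \<^bold>\<in> le \<and> x \<noteq> a)"
    and open_below: "V \<^bold>\<in> TE \<Longrightarrow> z \<^bold>\<in> V \<Longrightarrow> z \<^bold>\<in> E \<Longrightarrow>
      (\<forall>y. y \<^bold>\<in> E \<longrightarrow> opair y z \<^bold>\<in> le \<longrightarrow> y \<^bold>\<in> V) \<or>
      (\<exists>a. a \<^bold>\<in> E \<and> opair a z \<^bold>\<in> le \<and> a \<noteq> z \<and>
        (\<forall>y. y \<^bold>\<in> E \<longrightarrow> opair a y \<^bold>\<in> le \<longrightarrow> a \<noteq> y \<longrightarrow> opair y z \<^bold>\<in> le \<longrightarrow> y \<^bold>\<in> V))"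
    and open_above: "V \<^bold>\<in> TE \<Longrightarrow> z \<^bold>\<in> V \<Longrightarrow> z \<^bold>\<in> E \<Longrightarrow>
      \<exists>b. b \<^bold>\<in> E \<and> opair z b \<^bold>\<in> le \<and> z \<noteq> b \<and>
        (\<forall>y. y \<^bold>\<in> E \<longrightarrow> opair z y \<^bold>\<in> le \<longrightarrow> opair y b \<^bold>\<in> le \<longrightarrow> y \<noteq> b \<longrightarrow> y \<^bold>\<in> V)"
    and open_sub: "V \<^bold>\<in> TE \<Longrightarrow> V \<^bold>\<subseteq> E"
    and z0: "z0 \<^bold>\<in> E"
    and W_down: "n \<^bold>\<in> omega \<Longrightarrow> c \<^bold>\<in> E \<Longrightarrow> d \<^bold>\<in> E \<Longrightarrow> opair c d \<^bold>\<in> le \<Longrightarrow> opair n d \<^bold>\<in> W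
      \<Longrightarrow> opair n c \<^bold>\<in> W"
    and W_z0: "n \<^bold>\<in> omega \<Longrightarrow> opair n z0 \<^bold>\<in> W"
    and W_bounded: "n \<^bold>\<in> omega \<Longrightarrow> \<exists>c. c \<^bold>\<in> E \<and> \<not> opair n c \<^bold>\<in> W"
    and W_cofinal: "d \<^bold>\<in> E \<Longrightarrow> \<exists>N. N \<^bold>\<in> omega \<and>
      (\<forall>n. n \<^bold>\<in> omega \<longrightarrow> \<not> n \<^bold>\<in> N \<longrightarrow> opair n d \<^bold>\<in> W)"
begin

abbreviation leq where "leq a b \<equiv> opair a b \<^bold>\<in> le"
abbreviation lt where "lt a b \<equiv> leq a b \<and> a \<noteq> b"

lemma leq_refl: "a \<^bold>\<in> E \<Longrightarrow> leq a a" using le_total by blast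
lemma not_leq: "a \<^bold>\<in> E \<Longrightarrow> b \<^bold>\<in> E \<Longrightarrow> \<not> leq a b \<longleftrightarrow> lt b a"
  using le_total le_antisym leq_refl by blast
lemma le_lt_trans: "a \<^bold>\<in> E \<Longrightarrow> b \<^bold>\<in> E \<Longrightarrow> c \<^bold>\<in> E \<Longrightarrow> leq a b \<Longrightarrow> lt b c \<Longrightarrow> lt a c"
  using le_trans le_antisym by blast
lemma lt_le_trans: "a \<^bold>\<in> E \<Longrightarrow> b \<^bold>\<in> E \<Longrightarrow> c \<^bold>\<in> E \<Longrightarrow> lt a b \<Longrightarrow> leq b c \<Longrightarrow> lt a c"
  using le_trans le_antisym by blast

text \<open>
  On the real line this is \<open>e < d\<close>, whereas a point with an immediate predecessor is also way below itself.
  It describes to what extent "\<open>g x \<ge> d\<close>" implies "\<open>g \<ge> e\<close> near \<open>x\<close>" for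
  a continuous \<open>g\<close>, uniformly for dense and for discrete orders.
\<close>

definition way_below :: "'a \<Rightarrow> 'a \<Rightarrow> bool" where
  "way_below e d \<longleftrightarrow> (\<exists>c\<in>elts E. lt c d \<and> (\<forall>b\<in>elts E. lt c b \<longrightarrow> leq e b))"

lemma way_below_le: "d \<^bold>\<in> E \<Longrightarrow> way_below e d \<Longrightarrow> leq e d"
  unfolding way_below_def by blast

text \<open>
  If no point lies strictly between \<open>c\<close> and \<open>d\<close>, then \<open>d\<close> has the predecessor
  \<open>c\<close> and is way below itself.
\<close>

lemma interpolate:
  assumes "c \<^bold>\<in> E" "d \<^bold>\<in> E" "lt c d" shows "\<exists>e. e \<^bold>\<in> E \<and> lt c e \<and> way_below e d"
proof (cases "\<exists>b. b \<^bold>\<in> E \<and> lt c b \<and> lt b d")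
  case True
  then show ?thesis unfolding way_below_def by auto
next
  case False
  then have "\<forall>b\<in>elts E. lt c b \<longrightarrow> leq d b" using not_leq assms by blast
  then have "way_below d d" unfolding way_below_def using assms by blast
  then show ?thesis using assms by blast
qed

text \<open>
  With \<open>(x, c) \<in> G\<close> read as \<open>g x < c\<close>, the conditions say in turn: sections grow with
  \<open>c\<close>; \<open>g x\<close> is not \<open>-\<infinity>\<close>; \<open>g\<close> is upper semicontinuous;
  \<open>g\<close> is lower semicontinuous.
\<close>

definition scale :: "'a \<Rightarrow> 'a \<Rightarrow> 'a \<Rightarrow> bool" where
  "scale X T G \<longleftrightarrow> G \<^bold>\<subseteq> X \<^bold>\<times> E \<and>
    (\<forall>x\<in>elts X. \<forall>c\<in>elts E. \<forall>d\<in>elts E. opair x c \<^bold>\<in> G \<longrightarrow> leq c d \<longrightarrow> opair x d \<^bold>\<in> G) \<and>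
    (\<forall>x\<in>elts X. \<exists>c\<in>elts E. \<not> opair x c \<^bold>\<in> G) \<and>
    (\<forall>x\<in>elts X. \<forall>c\<in>elts E. opair x c \<^bold>\<in> G \<longrightarrow>
       (\<exists>U\<in>elts T. x \<^bold>\<in> U \<and> (\<forall>y\<in>elts U. opair y c \<^bold>\<in> G))) \<and>
    (\<forall>x\<in>elts X. \<forall>d\<in>elts E. \<forall>e\<in>elts E. way_below e d \<longrightarrow> \<not> opair x d \<^bold>\<in> G \<longrightarrow>
       (\<exists>U\<in>elts T. x \<^bold>\<in> U \<and> (\<forall>y\<in>elts U. \<not> opair y e \<^bold>\<in> G)))"

definition finite_at :: "'a \<Rightarrow> 'a \<Rightarrow> bool" where
  "finite_at G x \<longleftrightarrow> (\<exists>c\<in>elts E. opair x c \<^bold>\<in> G)"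

text \<open>
  The value \<open>g x\<close> is recovered as the supremum of all \<open>c\<close> with \<open>c \<le> g x\<close>. The
  dual description as the infimum of all \<open>c\<close> with \<open>g x < c\<close> would be wrong in a discrete
  order.
\<close>

definition val :: "'a \<Rightarrow> 'a \<Rightarrow> 'a \<Rightarrow> bool" where
  "val G x v \<longleftrightarrow> v \<^bold>\<in> E \<and> (\<forall>c\<in>elts E. \<not> opair x c \<^bold>\<in> G \<longrightarrow> leq c v) \<and>
    (\<forall>b\<in>elts E. (\<forall>c\<in>elts E. \<not> opair x c \<^bold>\<in> G \<longrightarrow> leq c b) \<longrightarrow> leq v b)"

lemma definable_way_below:
  assumes "definable_fun t" "definable_fun u"
  shows "definable (\<lambda>e. way_below (t e) (u e))"
  unfolding way_below_def
  by (intro def_intros assms[THEN definable_fun_rename])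

lemma definable_scale: "definable_fun t \<Longrightarrow> definable (\<lambda>e. scale X T (t e))"
proof -
  assume t: "definable_fun t"
  show ?thesis unfolding scale_def
    by (intro def_intros definable_way_below t definable_fun_rename[OF t])
qed

lemma definable_finite_at:
  assumes "definable_fun t" "definable_fun u"
  shows "definable (\<lambda>e. finite_at (t e) (u e))"
  unfolding finite_at_def
  by (intro def_intros assms[THEN definable_fun_rename])

lemma definable_val:
  assumes "definable_fun t" "definable_fun u" "definable_fun w"
  shows "definable (\<lambda>e. val (t e) (u e) (w e))"
  unfolding val_def
  by (intro def_intros assms assms[THEN definable_fun_rename])

lemmas scale_intros = def_intros definable_way_below definable_scale definable_finite_at definable_val

lemma scale_sub: "scale X T G \<Longrightarrow> G \<^bold>\<subseteq> X \<^bold>\<times> E"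
  by (simp add: scale_def)
lemma scale_mem: "scale X T G \<Longrightarrow> opair x c \<^bold>\<in> G \<Longrightarrow> x \<^bold>\<in> X \<and> c \<^bold>\<in> E"
  using subD[OF scale_sub, of X T G "opair x c"] by simp
lemma scale_up: "scale X T G \<Longrightarrow> opair x c \<^bold>\<in> G \<Longrightarrow> d \<^bold>\<in> E \<Longrightarrow> leq c d \<Longrightarrow> opair x d \<^bold>\<in> G"
  using scale_mem[of X T G x c] unfolding scale_def by blast
lemma scale_bounded: "scale X T G \<Longrightarrow> x \<^bold>\<in> X \<Longrightarrow> \<exists>c. c \<^bold>\<in> E \<and> \<not> opair x c \<^bold>\<in> G"
  unfolding scale_def by auto
lemma scale_open: "scale X T G \<Longrightarrow> opair x c \<^bold>\<in> G \<Longrightarrow>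
    near T x (\<lambda>y. opair y c \<^bold>\<in> G)"
  using scale_mem[of X T G x c] unfolding scale_def by blast
lemma scale_closed: "scale X T G \<Longrightarrow> x \<^bold>\<in> X \<Longrightarrow> d \<^bold>\<in> E \<Longrightarrow> e \<^bold>\<in> E \<Longrightarrow> way_below e d \<Longrightarrow>
    \<not> opair x d \<^bold>\<in> G \<Longrightarrow> near T x (\<lambda>y. \<not> opair y e \<^bold>\<in> G)"
  unfolding scale_def by blast

lemma scaleI:
  assumes "G \<^bold>\<subseteq> X \<^bold>\<times> E"
    "\<And>x c d. x \<^bold>\<in> X \<Longrightarrow> c \<^bold>\<in> E \<Longrightarrow> d \<^bold>\<in> E \<Longrightarrow> opair x c \<^bold>\<in> G \<Longrightarrow> leq c d \<Longrightarrow> opair x d \<^bold>\<in> G"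
    "\<And>x. x \<^bold>\<in> X \<Longrightarrow> \<exists>c. c \<^bold>\<in> E \<and> \<not> opair x c \<^bold>\<in> G"
    "\<And>x c. x \<^bold>\<in> X \<Longrightarrow> c \<^bold>\<in> E \<Longrightarrow> opair x c \<^bold>\<in> G \<Longrightarrow>
      near T x (\<lambda>y. opair y c \<^bold>\<in> G)"
    "\<And>x d e. x \<^bold>\<in> X \<Longrightarrow> d \<^bold>\<in> E \<Longrightarrow> e \<^bold>\<in> E \<Longrightarrow> way_below e d \<Longrightarrow> \<not> opair x d \<^bold>\<in> G \<Longrightarrow>
      near T x (\<lambda>y. \<not> opair y e \<^bold>\<in> G)"
  shows "scale X T G"
  unfolding scale_def Ball_def Bex_def mem_Collect_eq using assms by blast

lemma val_in: "val G x v \<Longrightarrow> v \<^bold>\<in> E"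
  by (simp add: val_def)

lemma val_unique: "val G x v \<Longrightarrow> val G x w \<Longrightarrow> v = w"
  unfolding val_def by (auto intro: le_antisym)

lemma val_finite_at: "val G x v \<Longrightarrow> finite_at G x"
  using no_top[of v] le_antisym[of v] unfolding val_def finite_at_def by blast

lemma val_exists:
  assumes G: "scale X T G" and x: "x \<^bold>\<in> X" and fin: "finite_at G x"
  shows "\<exists>v. val G x v"
proof -
  have "definable (\<lambda>e. \<not> opair x (e 0) \<^bold>\<in> G)" by (intro def_intros)
  from separation_definable[OF this, of E] obtain A where
    A: "\<And>c. c \<^bold>\<in> A \<longleftrightarrow> c \<^bold>\<in> E \<and> \<not> opair x c \<^bold>\<in> G" by blast
  obtain b where b: "b \<^bold>\<in> E" "opair x b \<^bold>\<in> G" using fin by (auto simp: finite_at_def)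
  obtain a where "a \<^bold>\<in> A" using scale_bounded[OF G x] A by blast
  moreover have "\<forall>c\<in>elts A. leq c b"
    using scale_up[OF G b(2)] le_total b(1) by (auto simp: A)
  ultimately have "\<exists>s\<in>elts E. (\<forall>c\<in>elts A. leq c s) \<and>
      (\<forall>b\<in>elts E. (\<forall>c\<in>elts A. leq c b) \<longrightarrow> leq s b)"
    using b by (intro lub_exists[of A a b]) (auto simp: sub_def A)
  then show ?thesis unfolding val_def by (auto simp: A)
qed

text \<open>
  The point \<open>c\<close> witnesses \<open>g x > z\<close>, and this includes \<open>g x = \<infinity>\<close>. The
  bound \<open>e\<close> is uniform on the neighbourhood, which is what separates the graph from the point \<open>(x,
  z)\<close>.
\<close>

lemma val_above_locally:
  assumes G: "scale X T G" and x: "x \<^bold>\<in> X" and z: "z \<^bold>\<in> E" and c: "c \<^bold>\<in> E" "lt z c" "\<not> opair x c \<^bold>\<in> G"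
  shows "\<exists>e U. e \<^bold>\<in> E \<and> lt z e \<and> U \<^bold>\<in> T \<and> x \<^bold>\<in> U \<and>
    (\<forall>y v. y \<^bold>\<in> U \<longrightarrow> val G y v \<longrightarrow> leq e v)"
proof -
  obtain e where e: "e \<^bold>\<in> E" "lt z e" "way_below e c" using interpolate[OF z c(1,2)] by blast
  obtain U where "U \<^bold>\<in> T" "x \<^bold>\<in> U" "\<forall>y. y \<^bold>\<in> U \<longrightarrow> \<not> opair y e \<^bold>\<in> G"
    using scale_closed[OF G x c(1) e(1,3) c(3)] by blast
  then show ?thesis using e by (intro exI[of _ e] exI[of _ U]) (auto simp: val_def)
qed

text \<open>
  The hypothesis on \<open>b\<close> says \<open>g x \<le> b\<close>. A point \<open>e\<close> between \<open>b\<close>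
  and \<open>z\<close> bounds \<open>g\<close> near \<open>x\<close>; if there is none, then \<open>g < z\<close> near
  \<open>x\<close> already forces \<open>g \<le> b\<close>.
\<close>

lemma val_below_locally:
  assumes G: "scale X T G" and x: "x \<^bold>\<in> X" and z: "z \<^bold>\<in> E"
    and b: "b \<^bold>\<in> E" "lt b z" "\<And>c. c \<^bold>\<in> E \<Longrightarrow> \<not> opair x c \<^bold>\<in> G \<Longrightarrow> leq c b"
  shows "\<exists>e U. e \<^bold>\<in> E \<and> lt e z \<and> U \<^bold>\<in> T \<and> x \<^bold>\<in> U \<and>
    (\<forall>y v. y \<^bold>\<in> U \<longrightarrow> val G y v \<longrightarrow> leq v e)"
proof -
  have *: "near T x (\<lambda>y. opair y c \<^bold>\<in> G)" if "c \<^bold>\<in> E" "lt b c" for c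
    using scale_open[OF G, of x c] b(1) b(3)[of c] le_antisym[of b c] that by blast
  have **: "lt c d" if "opair y d \<^bold>\<in> G" "\<not> opair y c \<^bold>\<in> G" "c \<^bold>\<in> E" "d \<^bold>\<in> E" for c d y
    using that scale_up[OF G that(1,3)] not_leq[of d c] by blast
  show ?thesis
  proof (cases "\<exists>e. e \<^bold>\<in> E \<and> lt b e \<and> lt e z")
    case True
    then obtain e where e: "e \<^bold>\<in> E" "lt b e" "lt e z" by blast
    obtain U where U: "U \<^bold>\<in> T" "x \<^bold>\<in> U" "\<forall>y. y \<^bold>\<in> U \<longrightarrow> opair y e \<^bold>\<in> G" using * e by blast
    have "leq v e" if "y \<^bold>\<in> U" "val G y v" for y v
      using that U(3) **[of y e] e(1) unfolding val_def by blast
    then show ?thesis using e U by blast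
  next
    case False
    obtain U where U: "U \<^bold>\<in> T" "x \<^bold>\<in> U" "\<forall>y. y \<^bold>\<in> U \<longrightarrow> opair y z \<^bold>\<in> G" using *[of z] z b by blast
    have "leq v b" if "y \<^bold>\<in> U" "val G y v" for y v
    proof -
      have "leq c b" if "c \<^bold>\<in> E" "\<not> opair y c \<^bold>\<in> G" for c
        using **[of y z c] U(3) \<open>y \<^bold>\<in> U\<close> that z False not_leq[of c b] b(1) by blast
      then show ?thesis using that b(1) unfolding val_def by blast
    qed
    then show ?thesis using b U by blast
  qed
qed

text \<open>
  The graph is closed in all of \<open>X \<times> E\<close>, not just over the finite part: since \<open>E\<close> has
  no greatest element, a point with \<open>g x = \<infinity>\<close> falls under the first case.
\<close>

lemma val_closed_graph:
  assumes G: "scale X T G" and x: "x \<^bold>\<in> X" and z: "z \<^bold>\<in> E" and n: "\<not> val G x z"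
  shows "\<exists>U V. U \<^bold>\<in> T \<and> x \<^bold>\<in> U \<and> V \<^bold>\<in> TE \<and> z \<^bold>\<in> V \<and>
    (\<forall>y v. y \<^bold>\<in> U \<longrightarrow> v \<^bold>\<in> V \<longrightarrow> \<not> val G y v)"
proof -
  consider c where "c \<^bold>\<in> E" "\<not> opair x c \<^bold>\<in> G" "\<not> leq c z"
    | b where "b \<^bold>\<in> E" "\<And>c. c \<^bold>\<in> E \<Longrightarrow> \<not> opair x c \<^bold>\<in> G \<Longrightarrow> leq c b" "\<not> leq z b"
    using n z unfolding val_def by blast
  then show ?thesis
  proof cases
    case 1
    then obtain e U where e: "e \<^bold>\<in> E" "lt z e" "U \<^bold>\<in> T" "x \<^bold>\<in> U"
      "\<forall>y v. y \<^bold>\<in> U \<longrightarrow> val G y v \<longrightarrow> leq e v"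
      using val_above_locally[OF G x z, of c] not_leq z by blast
    obtain V where V: "V \<^bold>\<in> TE" "\<And>v. v \<^bold>\<in> V \<longleftrightarrow> v \<^bold>\<in> E \<and> lt v e" using down_ray[OF e(1)] by blast
    have "\<not> val G y v" if "y \<^bold>\<in> U" "v \<^bold>\<in> V" for y v
      using e(1,5) that le_antisym[of v e] unfolding V(2) by blast
    then show ?thesis using e V z by blast
  next
    case 2
    then obtain e U where e: "e \<^bold>\<in> E" "lt e z" "U \<^bold>\<in> T" "x \<^bold>\<in> U"
      "\<forall>y v. y \<^bold>\<in> U \<longrightarrow> val G y v \<longrightarrow> leq v e"
      using val_below_locally[OF G x z, of b] not_leq z by blast
    obtain V where V: "V \<^bold>\<in> TE" "\<And>v. v \<^bold>\<in> V \<longleftrightarrow> v \<^bold>\<in> E \<and> lt e v" using up_ray[OF e(1)] by blast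
    have "\<not> val G y v" if "y \<^bold>\<in> U" "v \<^bold>\<in> V" for y v
      using e(1,5) that le_antisym[of v e] unfolding V(2) by blast
    then show ?thesis using e V z by blast
  qed
qed

lemma val_continuous:
  assumes T: "topology X T" and G: "scale X T G" and x: "x \<^bold>\<in> X"
    and v: "val G x v" and V: "V \<^bold>\<in> TE" "v \<^bold>\<in> V"
  shows "\<exists>U. U \<^bold>\<in> T \<and> x \<^bold>\<in> U \<and> (\<forall>y w. y \<^bold>\<in> U \<longrightarrow> val G y w \<longrightarrow> w \<^bold>\<in> V)"
proof -
  have vE: "v \<^bold>\<in> E" using v by (rule val_in)
  obtain b where b: "b \<^bold>\<in> E" "lt v b" "\<And>y. y \<^bold>\<in> E \<Longrightarrow> leq v y \<Longrightarrow> lt y b \<Longrightarrow> y \<^bold>\<in> V"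
    using open_above[OF V vE] by blast
  obtain e1 U1 where U1: "e1 \<^bold>\<in> E" "lt e1 b" "U1 \<^bold>\<in> T" "x \<^bold>\<in> U1"
    "\<And>y w. y \<^bold>\<in> U1 \<Longrightarrow> val G y w \<Longrightarrow> leq w e1"
    using val_below_locally[OF G x b(1) vE b(2)] v unfolding val_def by blast
  have up: "w \<^bold>\<in> V" if "y \<^bold>\<in> U1" "val G y w" "leq v w" for y w
  proof -
    have "lt w b" by (rule le_lt_trans[OF _ U1(1) b(1) U1(5)[OF that(1,2)] U1(2)]) (rule val_in[OF that(2)])
    then show ?thesis using b(3) that val_in by blast
  qed
  have "\<exists>U2. U2 \<^bold>\<in> T \<and> x \<^bold>\<in> U2 \<and> (\<forall>y w. y \<^bold>\<in> U2 \<longrightarrow> val G y w \<longrightarrow> leq w v \<longrightarrow> w \<^bold>\<in> V)"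
    using open_below[OF V vE]
  proof
    assume *: "\<forall>y. y \<^bold>\<in> E \<longrightarrow> leq y v \<longrightarrow> y \<^bold>\<in> V"
    show ?thesis
      using * topology_space[OF T] x val_in by blast
  next
    assume "\<exists>a. a \<^bold>\<in> E \<and> leq a v \<and> a \<noteq> v \<and>
      (\<forall>y. y \<^bold>\<in> E \<longrightarrow> leq a y \<longrightarrow> a \<noteq> y \<longrightarrow> leq y v \<longrightarrow> y \<^bold>\<in> V)"
    then obtain a where a: "a \<^bold>\<in> E" "lt a v" "\<And>y. y \<^bold>\<in> E \<Longrightarrow> lt a y \<Longrightarrow> leq y v \<Longrightarrow> y \<^bold>\<in> V"
      by blast
    obtain c where "c \<^bold>\<in> E" "lt a c" "\<not> opair x c \<^bold>\<in> G"
      using v a(1,2) not_leq[of _ a] le_antisym[OF a(1) vE] unfolding val_def by blast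
    from val_above_locally[OF G x a(1) this]
    obtain e U where U: "e \<^bold>\<in> E" "lt a e" "U \<^bold>\<in> T" "x \<^bold>\<in> U"
      "\<And>y w. y \<^bold>\<in> U \<Longrightarrow> val G y w \<Longrightarrow> leq e w" by blast
    have "w \<^bold>\<in> V" if "y \<^bold>\<in> U" "val G y w" "leq w v" for y w
      using a(3)[OF val_in[OF that(2)] lt_le_trans[OF a(1) U(1) val_in[OF that(2)] U(2) U(5)[OF that(1,2)]] that(3)] .
    then show ?thesis using U by blast
  qed
  then obtain U2 where U2: "U2 \<^bold>\<in> T" "x \<^bold>\<in> U2" "\<And>y w. y \<^bold>\<in> U2 \<Longrightarrow> val G y w \<Longrightarrow> leq w v \<Longrightarrow> w \<^bold>\<in> V"
    by blast
  have "w \<^bold>\<in> V" if "y \<^bold>\<in> U1 \<^bold>\<inter> U2" "val G y w" for y w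
    using that up[of y w] U2(3)[of y w] le_total[OF vE val_in[OF that(2)]] by auto
  then show ?thesis using topology_int[OF T U1(3) U2(1)] U1(4) U2(2) by (metis mem_int)
qed

end

section \<open>Subspaces separated by scales\<close>

context ordered_space
begin

text \<open>
  This turns the coordinates of an embedding into scales. Lower semicontinuity uses the point below \<open>d\<close>
  that witnesses \<open>way_below e d\<close>: above it, all values are at least \<open>e\<close>.
\<close>

lemma scale_below_function:
  assumes T: "topology X T" and f: "\<And>x. x \<^bold>\<in> X \<Longrightarrow> f x \<^bold>\<in> E"
    and cont: "\<And>x V. x \<^bold>\<in> X \<Longrightarrow> V \<^bold>\<in> TE \<Longrightarrow> f x \<^bold>\<in> V \<Longrightarrow>
      near T x (\<lambda>y. f y \<^bold>\<in> V)"
    and G: "G \<^bold>\<subseteq> X \<^bold>\<times> E" "\<And>x c. x \<^bold>\<in> X \<Longrightarrow> c \<^bold>\<in> E \<Longrightarrow> opair x c \<^bold>\<in> G \<longleftrightarrow> lt (f x) c"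
  shows "scale X T G" "\<And>x. x \<^bold>\<in> X \<Longrightarrow> val G x v \<longleftrightarrow> v = f x" "\<And>x. x \<^bold>\<in> X \<Longrightarrow> finite_at G x"
proof -
  show "scale X T G"
  proof (rule scaleI[OF G(1)])
    show "opair x d \<^bold>\<in> G" if "x \<^bold>\<in> X" "c \<^bold>\<in> E" "d \<^bold>\<in> E" "opair x c \<^bold>\<in> G" "leq c d" for x c d
      using lt_le_trans[of "f x" c d] that f G(2) by blast
    show "\<exists>c. c \<^bold>\<in> E \<and> \<not> opair x c \<^bold>\<in> G" if "x \<^bold>\<in> X" for x
      using that f G(2) by blast
    show "near T x (\<lambda>y. opair y c \<^bold>\<in> G)"
      if x: "x \<^bold>\<in> X" and c: "c \<^bold>\<in> E" and "opair x c \<^bold>\<in> G" for x c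
    proof -
      obtain V where V: "V \<^bold>\<in> TE" "\<And>v. v \<^bold>\<in> V \<longleftrightarrow> v \<^bold>\<in> E \<and> lt v c" using down_ray[OF c] by blast
      have "f x \<^bold>\<in> V" using that V f G(2) by blast
      with cont[OF x V(1)] obtain U where "U \<^bold>\<in> T" "x \<^bold>\<in> U" "\<And>y. y \<^bold>\<in> U \<Longrightarrow> f y \<^bold>\<in> V" by blast
      then show ?thesis using V(2) G(2)[OF _ c] subD[OF topology_sub[OF T]] by blast
    qed
    show "near T x (\<lambda>y. \<not> opair y e \<^bold>\<in> G)"
      if x: "x \<^bold>\<in> X" and d: "d \<^bold>\<in> E" and e: "e \<^bold>\<in> E" and "way_below e d" "\<not> opair x d \<^bold>\<in> G" for x d e
    proof -
      obtain c where c: "c \<^bold>\<in> E" "lt c d" "\<And>b. b \<^bold>\<in> E \<Longrightarrow> lt c b \<Longrightarrow> leq e b"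
        using \<open>way_below e d\<close> unfolding way_below_def by blast
      obtain V where V: "V \<^bold>\<in> TE" "\<And>v. v \<^bold>\<in> V \<longleftrightarrow> v \<^bold>\<in> E \<and> lt c v" using up_ray[OF c(1)] by blast
      have "leq d (f x)" using that f G(2)[OF x d] not_leq[of d "f x"] by blast
      then have "f x \<^bold>\<in> V" using lt_le_trans[OF c(1) d f[OF x] c(2)] V(2) f x by blast
      with cont[OF x V(1)] obtain U where U: "U \<^bold>\<in> T" "x \<^bold>\<in> U" "\<And>y. y \<^bold>\<in> U \<Longrightarrow> f y \<^bold>\<in> V" by blast
      have "\<not> opair y e \<^bold>\<in> G" if "y \<^bold>\<in> U" for y
      proof -
        have y: "y \<^bold>\<in> X" using subD[OF topology_sub[OF T U(1)] that] .
        have "leq e (f y)" using c(3) U(3)[OF that] V(2) by blast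
        then show ?thesis using G(2)[OF y e] le_antisym[OF e f[OF y]] by blast
      qed
      then show ?thesis using U by blast
    qed
  qed
  have *: "val G x (f x)" if "x \<^bold>\<in> X" for x
    unfolding val_def using f[OF that] G(2)[OF that] not_leq[of _ "f x"] leq_refl[of "f x"] by blast
  show "val G x v \<longleftrightarrow> v = f x" if "x \<^bold>\<in> X" for x v
    using *[OF that] val_unique by blast
  show "finite_at G x" if "x \<^bold>\<in> X" for x
    using *[OF that] val_finite_at by blast
qed

text \<open>
  With \<open>K\<close> the set of all scales that are finite on \<open>S\<close>, the map \<open>\<epsilon>\<close>
  sends \<open>x \<in> S\<close> to the family of values at \<open>x\<close> of the members of \<open>K\<close>. The
  coordinates of the given embedding \<open>h\<close> are members of \<open>K\<close>, selected by \<open>\<gamma> : J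
  \<rightarrow> K\<close>; composition with \<open>\<gamma>\<close> is a continuous map \<open>\<rho>\<close> of powers
  with \<open>\<rho> \<circ> \<epsilon> = h\<close> on \<open>S\<close>. This relation yields injectivity and openness
  of \<open>\<epsilon>\<close>, and it reduces closedness of the image to points \<open>z\<close> for which
  \<open>\<rho> z\<close> is some \<open>h x\<close>.
\<close>

theorem compact_over_subspace:
  assumes T: "topology X T" and X: "compact_over E TE X T" and S: "S \<^bold>\<subseteq> X"
    and sep: "\<And>p. p \<^bold>\<in> X \<Longrightarrow> \<not> p \<^bold>\<in> S \<Longrightarrow>
      \<exists>G. scale X T G \<and> (\<forall>x. x \<^bold>\<in> S \<longrightarrow> finite_at G x) \<and> \<not> finite_at G p"
  shows "compact_over E TE S (subspace_top T S)"
proof -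
  obtain J C h where J: "J \<noteq> empty" and C: "closed_in (exponent E J) (power_top E TE J) C"
    and h: "bijection h X C"
    and hcont: "continuous X T C (subspace_top (power_top E TE J) C) h"
    and hopen: "\<And>U. U \<^bold>\<in> T \<Longrightarrow> image h U \<^bold>\<in> subspace_top (power_top E TE J) C"
    using X unfolding compact_over_def homeomorphic_def by blast
  let ?PJ = "power_top E TE J"
  have Tsub: "U \<^bold>\<in> T \<Longrightarrow> x \<^bold>\<in> U \<Longrightarrow> x \<^bold>\<in> X" for U x
    using topology_sub[OF T] subD by blast
  have CE: "C \<^bold>\<subseteq> exponent E J" and Cop: "exponent E J \<^bold>- C \<^bold>\<in> ?PJ"
    using C by (auto simp: closed_in_def)
  have hfun: "func h X C" and hinj: "\<And>x y. x \<^bold>\<in> X \<Longrightarrow> y \<^bold>\<in> X \<Longrightarrow> app h x = app h y \<Longrightarrow> x = y"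
    and hsurj: "\<And>y. y \<^bold>\<in> C \<Longrightarrow> \<exists>x. x \<^bold>\<in> X \<and> app h x = y"
    using h unfolding bijection_def injective_def by blast+
  have hx: "func (app h x) J E" if "x \<^bold>\<in> X" for x
    using subD[OF CE func_app[OF hfun that]] by simp
  have hpull: "\<exists>U. U \<^bold>\<in> T \<and> (\<forall>x. x \<^bold>\<in> U \<longleftrightarrow> x \<^bold>\<in> X \<and> app h x \<^bold>\<in> Q)" if "Q \<^bold>\<in> ?PJ" for Q
  proof -
    have "Q \<^bold>\<inter> C \<^bold>\<in> subspace_top ?PJ C" using that by (auto simp: mem_subspace_top)
    then have "preimage h X (Q \<^bold>\<inter> C) \<^bold>\<in> T" using hcont by (simp add: continuous_def)
    then show ?thesis using func_app[OF hfun]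
      by (intro exI[of _ "preimage h X (Q \<^bold>\<inter> C)"]) (auto simp: mem_preimage[OF hfun])
  qed
  have hpush: "\<exists>Q. Q \<^bold>\<in> ?PJ \<and> (\<forall>y. y \<^bold>\<in> X \<longrightarrow> app h y \<^bold>\<in> Q \<longleftrightarrow> y \<^bold>\<in> U)" if U: "U \<^bold>\<in> T" for U
  proof -
    obtain Q where Q: "Q \<^bold>\<in> ?PJ" "image h U = Q \<^bold>\<inter> C" using hopen[OF U] by (auto simp: mem_subspace_top)
    have "app h y \<^bold>\<in> Q \<longleftrightarrow> y \<^bold>\<in> U" if y: "y \<^bold>\<in> X" for y
    proof -
      have "app h y \<^bold>\<in> Q \<longleftrightarrow> app h y \<^bold>\<in> image h U" unfolding Q(2) using func_app[OF hfun y] by simp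
      also have "\<dots> \<longleftrightarrow> y \<^bold>\<in> U"
        using hinj[OF y] Tsub[OF U] by (auto simp: mem_image[OF hfun topology_sub[OF T U]])
      finally show ?thesis .
    qed
    then show ?thesis using Q(1) by blast
  qed
  have hco: "near T x (\<lambda>y. app (app h y) j \<^bold>\<in> V)"
    if j: "j \<^bold>\<in> J" and "x \<^bold>\<in> X" "V \<^bold>\<in> TE" "app (app h x) j \<^bold>\<in> V" for j x V
  proof -
    obtain Q where Q: "Q \<^bold>\<in> ?PJ" "\<And>z. z \<^bold>\<in> Q \<longleftrightarrow> func z J E \<and> app z j \<^bold>\<in> V"
      using power_top_slab[OF j \<open>V \<^bold>\<in> TE\<close>, of E] by blast
    show ?thesis using hpull[OF Q(1)] Q(2) hx that by blast
  qed

  have "definable (\<lambda>e. scale X T (e 0) \<and> (\<forall>x\<in>elts S. finite_at (e 0) x))"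
    by (intro scale_intros)
  from separation_definable[OF this, of "pow (X \<^bold>\<times> E)"] obtain K where
    "\<And>G. G \<^bold>\<in> K \<longleftrightarrow> G \<^bold>\<in> pow (X \<^bold>\<times> E) \<and> scale X T G \<and> (\<forall>x\<in>elts S. finite_at G x)" by blast
  then have K: "G \<^bold>\<in> K \<longleftrightarrow> scale X T G \<and> (\<forall>x. x \<^bold>\<in> S \<longrightarrow> finite_at G x)" for G
    using scale_sub[of X T G] by auto
  note Ks = K[THEN iffD1, THEN conjunct1]
  let ?PK = "power_top E TE K"

  define below where "below j G \<longleftrightarrow> (\<forall>x\<in>elts X. \<forall>c\<in>elts E. opair x c \<^bold>\<in> G \<longleftrightarrow>
      (\<exists>z y. opair x z \<^bold>\<in> h \<and> opair j y \<^bold>\<in> z \<and> lt y c))" for j G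
  have below: "below j G \<longleftrightarrow>
      (\<forall>x c. x \<^bold>\<in> X \<longrightarrow> c \<^bold>\<in> E \<longrightarrow> opair x c \<^bold>\<in> G \<longleftrightarrow> lt (app (app h x) j) c)"
    if j: "j \<^bold>\<in> J" for j G
  proof -
    have "(\<exists>z y. opair x z \<^bold>\<in> h \<and> opair j y \<^bold>\<in> z \<and> lt y c) \<longleftrightarrow> lt (app (app h x) j) c"
      if "x \<^bold>\<in> X" for x c
      using that j by (auto simp: func_pair_iff[OF hfun] func_pair_iff[OF hx])
    then show ?thesis unfolding below_def by simp
  qed
  have coordinate_scale: "\<exists>G. G \<^bold>\<in> K \<and> (\<forall>G'. G' \<^bold>\<in> K \<longrightarrow> below j G' \<longleftrightarrow> G' = G)"
    if j: "j \<^bold>\<in> J" for j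
  proof -
    have "definable (\<lambda>e. \<exists>x c. e 0 = opair x c \<and>
        (\<exists>z y. opair x z \<^bold>\<in> h \<and> opair j y \<^bold>\<in> z \<and> lt y c))" by (intro def_intros)
    from separation_definable[OF this, of "X \<^bold>\<times> E"] obtain G where
      G: "\<And>u. u \<^bold>\<in> G \<longleftrightarrow> u \<^bold>\<in> X \<^bold>\<times> E \<and> (\<exists>x c. u = opair x c \<and>
        (\<exists>z y. opair x z \<^bold>\<in> h \<and> opair j y \<^bold>\<in> z \<and> lt y c))" by blast
    have Gsub: "G \<^bold>\<subseteq> X \<^bold>\<times> E" by (simp add: sub_def G)
    have "below j G" by (auto simp: below_def G)
    then have G': "opair x c \<^bold>\<in> G \<longleftrightarrow> lt (app (app h x) j) c" if "x \<^bold>\<in> X" "c \<^bold>\<in> E" for x c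
      using that unfolding below[OF j] by blast
    have "G \<^bold>\<in> K" unfolding K
      using scale_below_function(1,3)[OF T _ _ Gsub G'] func_app[OF hx j] hco[OF j] subD[OF S] by blast
    moreover note \<open>below j G\<close>
    moreover have "G' = G" if G'K: "G' \<^bold>\<in> K" and "below j G'" for G'
    proof (rule set_eqI)
      fix u
      have "opair x c \<^bold>\<in> G' \<longleftrightarrow> opair x c \<^bold>\<in> G" if "x \<^bold>\<in> X" "c \<^bold>\<in> E" for x c
        using \<open>below j G'\<close> that G'[OF that] unfolding below[OF j] by blast
      then show "u \<^bold>\<in> G' \<longleftrightarrow> u \<^bold>\<in> G"
        using subD[OF scale_sub[OF Ks[OF G'K]], of u] subD[OF Gsub, of u] by (auto simp: mem_cprod)
    qed
    ultimately show ?thesis by (intro unique_in_setI[of G])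
  qed
  have Dg: "definable (\<lambda>e. below (e 0) (e (Suc 0)))" unfolding below_def by (intro def_intros)
  obtain \<gamma> where \<gamma>: "func \<gamma> J K" and \<gamma>_mem: "\<And>j. j \<^bold>\<in> J \<Longrightarrow> below j (app \<gamma> j)"
    using ex_func[OF Dg coordinate_scale] by blast
  have \<gamma>_val: "val (app \<gamma> j) x v \<longleftrightarrow> v = app (app h x) j" if j: "j \<^bold>\<in> J" and x: "x \<^bold>\<in> X" for j x v
  proof (rule scale_below_function(2)[OF T _ _ scale_sub[OF Ks[OF func_app[OF \<gamma> j]]] _ x])
    show "app (app h x) j \<^bold>\<in> E" if "x \<^bold>\<in> X" for x using func_app[OF hx[OF that] j] .
    show "near T x (\<lambda>y. app (app h y) j \<^bold>\<in> V)"
      if "x \<^bold>\<in> X" "V \<^bold>\<in> TE" "app (app h x) j \<^bold>\<in> V" for x V using hco[OF j that] .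
    show "opair x c \<^bold>\<in> app \<gamma> j \<longleftrightarrow> lt (app (app h x) j) c" if "x \<^bold>\<in> X" "c \<^bold>\<in> E" for x c
      using \<gamma>_mem[OF j] that unfolding below[OF j] by blast
  qed
  have K_nonempty: "K \<noteq> empty" using J func_app[OF \<gamma>] by (auto simp: empty_iff)

  define evaluates where "evaluates x z \<longleftrightarrow> (\<forall>G v. opair G v \<^bold>\<in> z \<longrightarrow> val G x v)" for x z
  have De: "definable (\<lambda>e. evaluates (e 0) (e (Suc 0)))"
    unfolding evaluates_def by (intro scale_intros)
  have ex: "\<exists>z. z \<^bold>\<in> exponent E K \<and> (\<forall>z'. z' \<^bold>\<in> exponent E K \<longrightarrow> evaluates x z' \<longleftrightarrow> z' = z)"
    if x: "x \<^bold>\<in> S" for x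
  proof -
    have D: "definable (\<lambda>e. val (e 0) x (e (Suc 0)))" by (intro scale_intros)
    have "\<exists>v. v \<^bold>\<in> E \<and> (\<forall>w. w \<^bold>\<in> E \<longrightarrow> val G x w \<longleftrightarrow> w = v)" if "G \<^bold>\<in> K" for G
      using val_exists[of X T G x] that subD[OF S x] x val_unique val_in unfolding K by blast
    from ex_func[OF D this] obtain z where z: "func z K E" "\<And>G. G \<^bold>\<in> K \<Longrightarrow> val G x (app z G)" by blast
    have "z \<^bold>\<in> exponent E K" using z(1) by simp
    moreover have "z' = z" if "z' \<^bold>\<in> exponent E K" "evaluates x z'" for z'
    proof -
      have z': "func z' K E" using that(1) by simp
      show ?thesis
      proof (rule func_eqI[OF z' z(1)])
        fix G assume "G \<^bold>\<in> K"
        then have "val G x (app z' G)"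
          using \<open>evaluates x z'\<close> unfolding evaluates_def by (simp add: func_pair_iff[OF z'])
        then show "app z' G = app z G" using z(2)[OF \<open>G \<^bold>\<in> K\<close>] by (rule val_unique)
      qed
    qed
    moreover have "evaluates x z" using z by (auto simp: evaluates_def func_pair_iff)
    ultimately show ?thesis by (intro unique_in_setI[of z])
  qed
  obtain \<epsilon> where \<epsilon>: "func \<epsilon> S (exponent E K)"
    and \<epsilon>_eq: "\<And>x z. x \<^bold>\<in> S \<Longrightarrow> z \<^bold>\<in> exponent E K \<Longrightarrow>
      app \<epsilon> x = z \<longleftrightarrow> evaluates x z"
    using ex_func[OF De ex] by blast
  have \<epsilon>_eqI: "app \<epsilon> x = z" if "x \<^bold>\<in> S" "func z K E" "\<And>G. G \<^bold>\<in> K \<Longrightarrow> val G x (app z G)" for x z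
    using \<epsilon>_eq[OF that(1), of z] that by (auto simp: evaluates_def func_pair_iff)
  have \<epsilon>x: "func (app \<epsilon> x) K E" if "x \<^bold>\<in> S" for x using func_app[OF \<epsilon> that] by simp
  have \<epsilon>_val: "val G x (app (app \<epsilon> x) G)" if "x \<^bold>\<in> S" "G \<^bold>\<in> K" for x G
    using \<epsilon>_eq[OF that(1), of "app \<epsilon> x"] \<epsilon>x[OF that(1)] that by (auto simp: evaluates_def func_pair_iff)

  define restricts where "restricts z y \<longleftrightarrow>
      (\<forall>j G v. opair j G \<^bold>\<in> \<gamma> \<longrightarrow> opair G v \<^bold>\<in> z \<longrightarrow> opair j v \<^bold>\<in> y)" for z y
  have Dr: "definable (\<lambda>e. restricts (e 0) (e (Suc 0)))"
    unfolding restricts_def by (intro scale_intros)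
  have rx: "\<exists>y. y \<^bold>\<in> exponent E J \<and> (\<forall>y'. y' \<^bold>\<in> exponent E J \<longrightarrow> restricts z y' \<longleftrightarrow> y' = y)"
    if "z \<^bold>\<in> exponent E K" for z
  proof -
    have z: "func z K E" using that by simp
    have D: "definable (\<lambda>e. \<exists>G. opair (e 0) G \<^bold>\<in> \<gamma> \<and> opair G (e (Suc 0)) \<^bold>\<in> z)" by (intro scale_intros)
    have "\<exists>v. v \<^bold>\<in> E \<and> (\<forall>w. w \<^bold>\<in> E \<longrightarrow> (\<exists>G. opair j G \<^bold>\<in> \<gamma> \<and> opair G w \<^bold>\<in> z) \<longleftrightarrow> w = v)" if "j \<^bold>\<in> J" for j
      using that func_app[OF \<gamma>] func_app[OF z]
      by (intro exI[of _ "app z (app \<gamma> j)"]) (auto simp: func_pair_iff[OF \<gamma>] func_pair_iff[OF z])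
    from ex_func[OF D this] obtain y where y: "func y J E"
      "\<And>j. j \<^bold>\<in> J \<Longrightarrow> \<exists>G. opair j G \<^bold>\<in> \<gamma> \<and> opair G (app y j) \<^bold>\<in> z" by blast
    then have yj: "app y j = app z (app \<gamma> j)" if "j \<^bold>\<in> J" for j
      using that by (auto simp: func_pair_iff[OF \<gamma>] func_pair_iff[OF z])
    have "y \<^bold>\<in> exponent E J" using y(1) by simp
    moreover have "y' = y" if "y' \<^bold>\<in> exponent E J" "restricts z y'" for y'
    proof -
      have y': "func y' J E" using that(1) by simp
      show ?thesis
        using \<open>restricts z y'\<close> yj func_app[OF \<gamma>] unfolding restricts_def
        by (intro func_eqI[OF y' y(1)])
          (simp add: func_pair_iff[OF \<gamma>] func_pair_iff[OF z] func_pair_iff[OF y'])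
    qed
    moreover have "restricts z y"
      using yj by (auto simp: restricts_def func_pair_iff[OF \<gamma>] func_pair_iff[OF z] func_pair_iff[OF y(1)])
    ultimately show ?thesis by (intro unique_in_setI[of y])
  qed
  obtain \<rho> where \<rho>: "func \<rho> (exponent E K) (exponent E J)"
    and \<rho>_P: "\<And>z. z \<^bold>\<in> exponent E K \<Longrightarrow> restricts z (app \<rho> z)"
    using ex_func[OF Dr rx] by blast
  have \<rho>z: "func (app \<rho> z) J E" if "func z K E" for z
    using func_app[OF \<rho>, of z] that by simp
  have \<rho>_app: "app (app \<rho> z) j = app z (app \<gamma> j)" if "func z K E" "j \<^bold>\<in> J" for z j
    using \<rho>_P[of z] that func_app[OF \<gamma>]
    by (auto simp: restricts_def func_pair_iff[OF \<gamma>] func_pair_iff[OF that(1)] func_pair_iff[OF \<rho>z])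
  have \<rho>\<epsilon>: "app \<rho> (app \<epsilon> x) = app h x" if "x \<^bold>\<in> S" for x
  proof (rule func_eqI[OF \<rho>z[OF \<epsilon>x[OF that]] hx])
    show "x \<^bold>\<in> X" using that S subD by blast
    show "app (app \<rho> (app \<epsilon> x)) j = app (app h x) j" if j: "j \<^bold>\<in> J" for j
      using \<epsilon>_val[OF \<open>x \<^bold>\<in> S\<close> func_app[OF \<gamma> j]] \<gamma>_val[OF j \<open>x \<^bold>\<in> X\<close>]
        \<rho>_app[OF \<epsilon>x[OF \<open>x \<^bold>\<in> S\<close>] j] by simp
  qed
  note TK = topology_power_top[of E K TE]
  have \<rho>_cont: "near ?PK z (\<lambda>w. func w K E \<and> app \<rho> w \<^bold>\<in> Q)"
    if "Q \<^bold>\<in> ?PJ" "func z K E" "app \<rho> z \<^bold>\<in> Q" for Q z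
  proof -
    have "near ?PK z (\<lambda>w. w \<^bold>\<in> exponent E K \<longrightarrow> app \<rho> w \<^bold>\<in> Q)"
    proof (rule continuous_into_power[OF TK sub_refl \<rho> _ that(1) _ that(3)])
      show "z \<^bold>\<in> exponent E K" using that by simp
      fix j U x assume *: "j \<^bold>\<in> J" "U \<^bold>\<in> TE" "x \<^bold>\<in> exponent E K" "app (app \<rho> x) j \<^bold>\<in> U"
      obtain V where "V \<^bold>\<in> ?PK" "\<And>w. w \<^bold>\<in> V \<longleftrightarrow> func w K E \<and> app w (app \<gamma> j) \<^bold>\<in> U"
        using power_top_slab[OF func_app[OF \<gamma> *(1)] *(2), of E] by blast
      then show "near ?PK x (\<lambda>y. y \<^bold>\<in> exponent E K \<longrightarrow> app (app \<rho> y) j \<^bold>\<in> U)"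
        using * \<rho>_app by auto
    qed
    then obtain V where V: "V \<^bold>\<in> ?PK" "z \<^bold>\<in> V" "\<And>w. w \<^bold>\<in> V \<Longrightarrow> w \<^bold>\<in> exponent E K \<Longrightarrow> app \<rho> w \<^bold>\<in> Q"
      by blast
    have "w \<^bold>\<in> exponent E K" if "w \<^bold>\<in> V" for w
      using subD[OF topology_sub[OF TK V(1)] that] .
    then show ?thesis using V by (intro exI[of _ V]) simp
  qed

  have "definable (\<lambda>e. \<exists>x. opair x (e 0) \<^bold>\<in> \<epsilon>)" by (intro def_intros)
  from separation_definable[OF this, of "exponent E K"] obtain D where
    "\<And>z. z \<^bold>\<in> D \<longleftrightarrow> z \<^bold>\<in> exponent E K \<and> (\<exists>x. opair x z \<^bold>\<in> \<epsilon>)" by blast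
  then have D: "z \<^bold>\<in> D \<longleftrightarrow> (\<exists>x. x \<^bold>\<in> S \<and> z = app \<epsilon> x)" for z
    using \<epsilon>x by (auto simp: func_pair_iff[OF \<epsilon>])
  have DE: "D \<^bold>\<subseteq> exponent E K" using \<epsilon>x by (auto simp: sub_def D)

  have "exponent E K \<^bold>- D \<^bold>\<in> ?PK"
  proof (rule open_locally[OF TK])
    fix z assume "z \<^bold>\<in> exponent E K \<^bold>- D"
    then have z: "func z K E" "\<not> z \<^bold>\<in> D" by auto
    have "near ?PK z (\<lambda>w. \<not> w \<^bold>\<in> D)"
    proof (cases "app \<rho> z \<^bold>\<in> C")
      case False
      then have "app \<rho> z \<^bold>\<in> exponent E J \<^bold>- C" using \<rho>z z by simp
      from \<rho>_cont[OF Cop z(1) this] obtain V where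
        V: "V \<^bold>\<in> ?PK" "z \<^bold>\<in> V" "\<And>w. w \<^bold>\<in> V \<Longrightarrow> \<not> app \<rho> w \<^bold>\<in> C" by auto
      have "\<not> w \<^bold>\<in> D" if "w \<^bold>\<in> V" for w
        using V(3)[OF that] \<rho>\<epsilon> func_app[OF hfun] subD[OF S] by (auto simp: D)
      then show ?thesis using V by blast
    next
      case True
      then obtain x where x: "x \<^bold>\<in> X" "app h x = app \<rho> z" using hsurj by blast
      \<comment> \<open>If \<open>z\<close> lists the values of all members of \<open>K\<close> at \<open>x\<close>, then all of them are finite at \<open>x\<close>,
        and the separation hypothesis puts \<open>x\<close> into \<open>S\<close>.\<close>
      have "\<exists>G. G \<^bold>\<in> K \<and> \<not> val G x (app z G)"
      proof (rule ccontr)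
        assume "\<nexists>G. G \<^bold>\<in> K \<and> \<not> val G x (app z G)"
        then have all: "\<And>G. G \<^bold>\<in> K \<Longrightarrow> val G x (app z G)" by blast
        then have "x \<^bold>\<in> S" using sep[OF x(1)] val_finite_at unfolding K by blast
        then show False using z \<epsilon>_eqI[OF _ z(1) all] D by blast
      qed
      then obtain G where G: "G \<^bold>\<in> K" "\<not> val G x (app z G)" by blast
      obtain U V where U: "U \<^bold>\<in> T" "x \<^bold>\<in> U" and V: "V \<^bold>\<in> TE" "app z G \<^bold>\<in> V"
        and disj: "\<And>y v. y \<^bold>\<in> U \<Longrightarrow> v \<^bold>\<in> V \<Longrightarrow> \<not> val G y v"
        using val_closed_graph[OF Ks[OF G(1)] x(1) func_app[OF z(1) G(1)] G(2)] by blast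
      obtain Q where Q: "Q \<^bold>\<in> ?PJ" and im: "\<And>y. y \<^bold>\<in> X \<Longrightarrow> app h y \<^bold>\<in> Q \<longleftrightarrow> y \<^bold>\<in> U"
        using hpush[OF U(1)] by blast
      have "app \<rho> z \<^bold>\<in> Q" using im[OF x(1)] U(2) x(2) by simp
      from \<rho>_cont[OF Q z(1) this] obtain A where
        A: "A \<^bold>\<in> ?PK" "z \<^bold>\<in> A" "\<And>w. w \<^bold>\<in> A \<Longrightarrow> app \<rho> w \<^bold>\<in> Q" by blast
      obtain B where B: "B \<^bold>\<in> ?PK" "\<And>w. w \<^bold>\<in> B \<longleftrightarrow> func w K E \<and> app w G \<^bold>\<in> V"
        using power_top_slab[OF G(1) V(1), of E] by blast
      have "\<not> w \<^bold>\<in> D" if w: "w \<^bold>\<in> A \<^bold>\<inter> B" for w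
      proof
        assume "w \<^bold>\<in> D"
        then obtain y where y: "y \<^bold>\<in> S" "w = app \<epsilon> y" by (auto simp: D)
        have "y \<^bold>\<in> U" using A(3)[of w] w \<rho>\<epsilon>[OF y(1)] im[OF subD[OF S y(1)]] y by auto
        moreover have "app w G \<^bold>\<in> V" using w B(2) by simp
        ultimately show False using disj \<epsilon>_val[OF y(1) G(1)] y(2) by blast
      qed
      moreover have "A \<^bold>\<inter> B \<^bold>\<in> ?PK" "z \<^bold>\<in> A \<^bold>\<inter> B"
        using topology_int[OF TK A(1) B(1)] A(2) B(2) z(1) V(2) by auto
      ultimately show ?thesis by blast
    qed
    then obtain V where V: "V \<^bold>\<in> ?PK" "z \<^bold>\<in> V" "\<And>w. w \<^bold>\<in> V \<Longrightarrow> \<not> w \<^bold>\<in> D" by blast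
    moreover have "V \<^bold>\<subseteq> exponent E K \<^bold>- D"
      using V(3) topology_sub[OF TK V(1)] by (auto simp: sub_def)
    ultimately show "\<exists>V. V \<^bold>\<in> ?PK \<and> z \<^bold>\<in> V \<and> V \<^bold>\<subseteq> exponent E K \<^bold>- D" by blast
  qed
  then have Dclosed: "closed_in (exponent E K) ?PK D" using DE by (simp add: closed_in_def)

  have \<epsilon>D: "func \<epsilon> S D"
    using \<epsilon> unfolding func_def by (auto simp: D)
  have "bijection \<epsilon> S D"
    unfolding bijection_def injective_def
  proof (intro conjI ballI impI \<epsilon>D)
    fix x y assume xy: "x \<in> elts S" "y \<in> elts S" "app \<epsilon> x = app \<epsilon> y"
    then have "app h x = app h y" using \<rho>\<epsilon> by (metis mem_Collect_eq)
    then show "x = y" using xy hinj subD[OF S] by blast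
  qed (auto simp: D)
  moreover have "continuous S (subspace_top T S) D (subspace_top ?PK D) \<epsilon>"
    unfolding continuous_def
  proof (intro conjI ballI \<epsilon>D)
    fix V assume "V \<in> elts (subspace_top ?PK D)"
    then obtain Q where Q: "Q \<^bold>\<in> ?PK" "V = Q \<^bold>\<inter> D" by (auto simp: mem_subspace_top)
    show "preimage \<epsilon> S V \<^bold>\<in> subspace_top T S"
    proof (rule subspace_open_locally[OF T])
      show "preimage \<epsilon> S V \<^bold>\<subseteq> S" by (simp add: sub_def mem_preimage[OF \<epsilon>])
      fix x assume "x \<^bold>\<in> preimage \<epsilon> S V"
      then have x: "x \<^bold>\<in> S" "app \<epsilon> x \<^bold>\<in> Q" by (auto simp: mem_preimage[OF \<epsilon>] Q)
      have "near T x (\<lambda>y. y \<^bold>\<in> S \<longrightarrow> app \<epsilon> y \<^bold>\<in> Q)"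
      proof (rule continuous_into_power[OF T S \<epsilon> _ Q(1) x])
        fix G V x assume *: "G \<^bold>\<in> K" "V \<^bold>\<in> TE" "x \<^bold>\<in> S" "app (app \<epsilon> x) G \<^bold>\<in> V"
        from val_continuous[OF T Ks[OF *(1)] subD[OF S *(3)] \<epsilon>_val[OF *(3,1)] *(2,4)] obtain U where
          "U \<^bold>\<in> T" "x \<^bold>\<in> U" "\<And>y w. y \<^bold>\<in> U \<Longrightarrow> val G y w \<Longrightarrow> w \<^bold>\<in> V" by blast
        then show "near T x (\<lambda>y. y \<^bold>\<in> S \<longrightarrow> app (app \<epsilon> y) G \<^bold>\<in> V)"
          using \<epsilon>_val[OF _ *(1)] by blast
      qed
      then obtain U where "U \<^bold>\<in> T" "x \<^bold>\<in> U" "\<And>y. y \<^bold>\<in> U \<Longrightarrow> y \<^bold>\<in> S \<Longrightarrow> app \<epsilon> y \<^bold>\<in> Q" by blast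
      then show "\<exists>U. U \<^bold>\<in> T \<and> x \<^bold>\<in> U \<and> U \<^bold>\<inter> S \<^bold>\<subseteq> preimage \<epsilon> S V"
        by (intro exI[of _ U]) (auto simp: sub_def mem_preimage[OF \<epsilon>] Q D)
    qed
  qed
  moreover have "image \<epsilon> V \<^bold>\<in> subspace_top ?PK D" if V: "V \<^bold>\<in> subspace_top T S" for V
  proof -
    obtain U where U: "U \<^bold>\<in> T" "V = U \<^bold>\<inter> S" using V by (auto simp: mem_subspace_top)
    have VS: "V \<^bold>\<subseteq> S" by (simp add: sub_def U(2))
    have im\<epsilon>: "z \<^bold>\<in> image \<epsilon> V \<longleftrightarrow> (\<exists>x. x \<^bold>\<in> U \<and> x \<^bold>\<in> S \<and> z = app \<epsilon> x)" for z
      unfolding mem_image[OF \<epsilon> VS] by (auto simp: U(2))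
    obtain Q where Q: "Q \<^bold>\<in> ?PJ" and im: "\<And>y. y \<^bold>\<in> X \<Longrightarrow> app h y \<^bold>\<in> Q \<longleftrightarrow> y \<^bold>\<in> U"
      using hpush[OF U(1)] by blast
    show ?thesis
    proof (rule subspace_open_locally[OF TK])
      show "image \<epsilon> V \<^bold>\<subseteq> D" by (auto simp: sub_def im\<epsilon> D)
      fix z assume "z \<^bold>\<in> image \<epsilon> V"
      then obtain x where x: "x \<^bold>\<in> U" "x \<^bold>\<in> S" "z = app \<epsilon> x" by (auto simp: im\<epsilon>)
      have "app \<rho> z \<^bold>\<in> Q" using x \<rho>\<epsilon> im subD[OF S] by simp
      from \<rho>_cont[OF Q _ this] \<epsilon>x x obtain A where
        A: "A \<^bold>\<in> ?PK" "z \<^bold>\<in> A" "\<And>w. w \<^bold>\<in> A \<Longrightarrow> app \<rho> w \<^bold>\<in> Q" by blast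
      have "w \<^bold>\<in> image \<epsilon> V" if w: "w \<^bold>\<in> A \<^bold>\<inter> D" for w
      proof -
        obtain y where y: "y \<^bold>\<in> S" "w = app \<epsilon> y" using w by (auto simp: D)
        then have "y \<^bold>\<in> U" using A(3)[of w] w \<rho>\<epsilon> im subD[OF S] by simp
        then show ?thesis using y by (auto simp: im\<epsilon>)
      qed
      then show "\<exists>A. A \<^bold>\<in> ?PK \<and> z \<^bold>\<in> A \<and> A \<^bold>\<inter> D \<^bold>\<subseteq> image \<epsilon> V"
        using A by (intro exI[of _ A]) (auto simp: sub_def)
    qed
  qed
  ultimately have "homeomorphic S (subspace_top T S) D (subspace_top ?PK D)"
    unfolding homeomorphic_def by blast
  then show ?thesis using K_nonempty Dclosed unfolding compact_over_def by blast
qed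

end

context ZF_model
begin

section \<open>Sigma-fields\<close>

lemma definable_countable_set:
  assumes "definable_fun t" shows "definable (\<lambda>e. countable_set (t e))"
proof -
  \<comment> \<open>Injectivity is restated by membership of pairs, as application is not definable.\<close>
  have eq: "countable_set a \<longleftrightarrow> (\<exists>f. func f a omega \<and>
      (\<forall>x y n. opair x n \<^bold>\<in> f \<longrightarrow> opair y n \<^bold>\<in> f \<longrightarrow> x = y))" for a
    unfolding countable_set_def injective_def
    by (intro ex_cong1 conj_cong refl) (auto simp: func_pair_iff)
  show ?thesis unfolding eq func_iff
    by (intro def_intros definable_fun_cprod assms definable_fun_rename[OF assms])
qed

lemma definable_sigma_field:
  assumes "definable_fun t" shows "definable (\<lambda>e. sigma_field X (t e))"
  unfolding sigma_field_def set_field_def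
  by (intro def_intros definable_fun_un definable_fun_diff definable_fun_bigun
      definable_countable_set assms definable_fun_rename[OF assms])

text \<open>
  The least sigma-field is a set of the model as soon as some sigma-field \<open>\<M>\<close> contains the generators,
  and here \<open>\<M>\<close> itself serves as the bound for separation.
\<close>

lemma generated_sigma_field_least:
  assumes M: "sigma_field X \<M>" "\<A> \<^bold>\<subseteq> \<M>" and S: "S \<^bold>\<in> generated_sigma_field X \<A>"
  shows "S \<^bold>\<in> \<M>"
proof -
  have "S \<^bold>\<in> generated_sigma_field X \<A> \<longleftrightarrow> (\<forall>\<M>. sigma_field X \<M> \<and> \<A> \<^bold>\<subseteq> \<M> \<longrightarrow> S \<^bold>\<in> \<M>)"
    unfolding generated_sigma_field_def
  proof (rule mem_Coll_bounded[of _ \<M>])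
    show "definable (\<lambda>e. \<forall>\<M>. sigma_field X \<M> \<and> \<A> \<^bold>\<subseteq> \<M> \<longrightarrow> e 0 \<^bold>\<in> \<M>)"
      by (intro def_intros definable_sigma_field)
  qed (use M in blast)
  then show ?thesis using assms by blast
qed

end

context ordered_space
begin

section \<open>The sigma-field of separated sets\<close>

text \<open>The union is the pointwise minimum.\<close>

lemma scale_union:
  assumes T: "topology X T" and G: "scale X T G" and H: "scale X T H"
  shows "scale X T (G \<^bold>\<union> H)"
proof (rule scaleI)
  show "G \<^bold>\<union> H \<^bold>\<subseteq> X \<^bold>\<times> E"
    using scale_sub[OF G] scale_sub[OF H] by (auto simp: sub_def)
  show "opair x d \<^bold>\<in> G \<^bold>\<union> H" if "d \<^bold>\<in> E" "opair x c \<^bold>\<in> G \<^bold>\<union> H" "leq c d" for x c d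
    using that scale_up[OF G, of x c d] scale_up[OF H, of x c d] by auto
  show "\<exists>c. c \<^bold>\<in> E \<and> \<not> opair x c \<^bold>\<in> G \<^bold>\<union> H" if x: "x \<^bold>\<in> X" for x
  proof -
    obtain c d where cd: "c \<^bold>\<in> E" "\<not> opair x c \<^bold>\<in> G" "d \<^bold>\<in> E" "\<not> opair x d \<^bold>\<in> H"
      using scale_bounded[OF G x] scale_bounded[OF H x] by blast
    then show ?thesis
      using le_total[OF cd(1,3)] scale_up[OF G, of x d c] scale_up[OF H, of x c d] by auto
  qed
  show "near T x (\<lambda>y. opair y c \<^bold>\<in> G \<^bold>\<union> H)"
    if "opair x c \<^bold>\<in> G \<^bold>\<union> H" for x c
    using that scale_open[OF G, of x c] scale_open[OF H, of x c] by auto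
  show "near T x (\<lambda>y. \<not> opair y e \<^bold>\<in> G \<^bold>\<union> H)"
    if *: "x \<^bold>\<in> X" "d \<^bold>\<in> E" "e \<^bold>\<in> E" "way_below e d" and n: "\<not> opair x d \<^bold>\<in> G \<^bold>\<union> H" for x d e
  proof -
    obtain U where U: "U \<^bold>\<in> T" "x \<^bold>\<in> U" "\<forall>y. y \<^bold>\<in> U \<longrightarrow> \<not> opair y e \<^bold>\<in> G"
      using scale_closed[OF G *] n by auto
    obtain V where V: "V \<^bold>\<in> T" "x \<^bold>\<in> V" "\<forall>y. y \<^bold>\<in> V \<longrightarrow> \<not> opair y e \<^bold>\<in> H"
      using scale_closed[OF H *] n by auto
    show ?thesis using U V topology_int[OF T U(1) V(1)] by (intro exI[of _ "U \<^bold>\<inter> V"]) auto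
  qed
qed

lemma finite_at_union: "finite_at (G \<^bold>\<union> H) x \<longleftrightarrow> finite_at G x \<or> finite_at H x"
  by (auto simp: finite_at_def)

text \<open>
  The new scale is the infimum of \<open>max(H, n)\<close> over all \<open>n\<close> and all \<open>H\<close> in the
  finite set \<open>F n\<close>. Lower semicontinuity is the only delicate point. For a level \<open>d\<close> there is
  \<open>N\<close> such that the terms with \<open>n \<notin> N\<close> are at least \<open>d\<close> everywhere; each
  of the finitely many \<open>n \<in> N\<close> contributes finitely many neighbourhoods of \<open>x\<close>, and their
  intersection is a neighbourhood.
\<close>

lemma scale_countable_union:
  assumes T: "topology X T" and F: "fun_on F omega"
    and fin: "\<And>n. n \<^bold>\<in> omega \<Longrightarrow> finite_set (app F n)"
    and sc: "\<And>n H. n \<^bold>\<in> omega \<Longrightarrow> H \<^bold>\<in> app F n \<Longrightarrow> scale X T H"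
  shows "\<exists>G. scale X T G \<and>
    (\<forall>x. finite_at G x \<longleftrightarrow> (\<exists>n H. n \<^bold>\<in> omega \<and> H \<^bold>\<in> app F n \<and> finite_at H x))"
proof -
  have "definable (\<lambda>e. \<exists>x c n B H. e 0 = opair x c \<and> opair n B \<^bold>\<in> F \<and> H \<^bold>\<in> B \<and>
      opair x c \<^bold>\<in> H \<and> \<not> opair n c \<^bold>\<in> W)" by (intro def_intros)
  from separation_definable[OF this, of "X \<^bold>\<times> E"] obtain G where
    "\<And>u. u \<^bold>\<in> G \<longleftrightarrow> u \<^bold>\<in> X \<^bold>\<times> E \<and> (\<exists>x c n B H. u = opair x c \<and> opair n B \<^bold>\<in> F \<and> H \<^bold>\<in> B \<and>
      opair x c \<^bold>\<in> H \<and> \<not> opair n c \<^bold>\<in> W)" by blast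
  then have Gsub: "G \<^bold>\<subseteq> X \<^bold>\<times> E" and G: "opair x c \<^bold>\<in> G \<longleftrightarrow>
      (\<exists>n H. n \<^bold>\<in> omega \<and> H \<^bold>\<in> app F n \<and> opair x c \<^bold>\<in> H \<and> \<not> opair n c \<^bold>\<in> W)" for x c
    using scale_mem[OF sc] by (auto simp: sub_def fun_on_pair_iff[OF F])
  have "scale X T G"
  proof (rule scaleI[OF Gsub])
    show "opair x d \<^bold>\<in> G" if "c \<^bold>\<in> E" "d \<^bold>\<in> E" "opair x c \<^bold>\<in> G" "leq c d" for x c d
      using that scale_up[OF sc] W_down unfolding G by blast
    show "\<exists>c. c \<^bold>\<in> E \<and> \<not> opair x c \<^bold>\<in> G" for x
      using z0 W_z0 unfolding G by blast
    show "near T x (\<lambda>y. opair y c \<^bold>\<in> G)"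
      if x: "opair x c \<^bold>\<in> G" for x c
    proof -
      obtain n H where H: "n \<^bold>\<in> omega" "H \<^bold>\<in> app F n" "opair x c \<^bold>\<in> H" "\<not> opair n c \<^bold>\<in> W"
        using x unfolding G by blast
      then show ?thesis using scale_open[OF sc[OF H(1,2)] H(3)] unfolding G by blast
    qed
    show "near T x (\<lambda>y. \<not> opair y e \<^bold>\<in> G)"
      if x: "x \<^bold>\<in> X" and d: "d \<^bold>\<in> E" and e: "e \<^bold>\<in> E" and ed: "way_below e d" and "\<not> opair x d \<^bold>\<in> G"
      for x d e
    proof -
      have ed': "leq e d" using way_below_le[OF d ed] .
      obtain N where N: "N \<^bold>\<in> omega" "\<And>n. n \<^bold>\<in> omega \<Longrightarrow> \<not> n \<^bold>\<in> N \<Longrightarrow> opair n d \<^bold>\<in> W"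
        using W_cofinal[OF d] by blast
      have "\<exists>U. U \<^bold>\<in> T \<and> x \<^bold>\<in> U \<and> (\<forall>y n. y \<^bold>\<in> U \<longrightarrow> n \<^bold>\<in> N \<longrightarrow>
          (\<forall>B H. opair n B \<^bold>\<in> F \<longrightarrow> H \<^bold>\<in> B \<longrightarrow> opair y e \<^bold>\<in> H \<longrightarrow> opair n e \<^bold>\<in> W))"
      proof (rule omega_neighbourhood[OF T x _ N(1)])
        show "definable (\<lambda>f. \<forall>B H. opair (f (Suc 0)) B \<^bold>\<in> F \<longrightarrow> H \<^bold>\<in> B \<longrightarrow>
            opair (f 0) e \<^bold>\<in> H \<longrightarrow> opair (f (Suc 0)) e \<^bold>\<in> W)" by (intro def_intros)
        fix n assume "n \<^bold>\<in> N"
        then have n: "n \<^bold>\<in> omega" using omega_trans N(1) by blast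
        have "\<exists>U. U \<^bold>\<in> T \<and> x \<^bold>\<in> U \<and> (\<forall>y H. y \<^bold>\<in> U \<longrightarrow> H \<^bold>\<in> app F n \<longrightarrow>
            opair y e \<^bold>\<in> H \<longrightarrow> opair n e \<^bold>\<in> W)"
        proof (rule finite_neighbourhood[OF T x _ fin[OF n]])
          show "definable (\<lambda>f. opair (f 0) e \<^bold>\<in> f (Suc 0) \<longrightarrow> opair n e \<^bold>\<in> W)" by (intro def_intros)
          fix H assume H: "H \<^bold>\<in> app F n"
          show "near T x (\<lambda>y. opair y e \<^bold>\<in> H \<longrightarrow> opair n e \<^bold>\<in> W)"
          proof (cases "opair n d \<^bold>\<in> W")
            case True
            then show ?thesis using W_down[OF n e d ed'] topology_space[OF T] x by blast
          next
            case False
            then have "\<not> opair x d \<^bold>\<in> H" using \<open>\<not> opair x d \<^bold>\<in> G\<close> n H unfolding G by blast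
            from scale_closed[OF sc[OF n H] x d e ed this] show ?thesis by blast
          qed
        qed
        then show "near T x (\<lambda>y. (\<forall>B H. opair n B \<^bold>\<in> F \<longrightarrow> H \<^bold>\<in> B \<longrightarrow>
            opair y e \<^bold>\<in> H \<longrightarrow> opair n e \<^bold>\<in> W))"
          using n by (auto simp: fun_on_pair_iff[OF F])
      qed
      then obtain U where U: "U \<^bold>\<in> T" "x \<^bold>\<in> U" "\<And>y n H. y \<^bold>\<in> U \<Longrightarrow> n \<^bold>\<in> N \<Longrightarrow> n \<^bold>\<in> omega \<Longrightarrow>
          H \<^bold>\<in> app F n \<Longrightarrow> opair y e \<^bold>\<in> H \<Longrightarrow> opair n e \<^bold>\<in> W"
        by (auto simp: fun_on_pair_iff[OF F])
      have "\<not> opair y e \<^bold>\<in> G" if "y \<^bold>\<in> U" for y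
      proof
        assume "opair y e \<^bold>\<in> G"
        then obtain n H where H: "n \<^bold>\<in> omega" "H \<^bold>\<in> app F n" "opair y e \<^bold>\<in> H" "\<not> opair n e \<^bold>\<in> W"
          unfolding G by blast
        then have "\<not> n \<^bold>\<in> N" using U(3) that by blast
        then show False using N(2) H W_down[OF H(1) e d ed'] by blast
      qed
      then show ?thesis using U by blast
    qed
  qed
  moreover have "finite_at G x \<longleftrightarrow> (\<exists>n H. n \<^bold>\<in> omega \<and> H \<^bold>\<in> app F n \<and> finite_at H x)" for x
  proof
    assume "\<exists>n H. n \<^bold>\<in> omega \<and> H \<^bold>\<in> app F n \<and> finite_at H x"
    then obtain n H c where H: "n \<^bold>\<in> omega" "H \<^bold>\<in> app F n" "c \<^bold>\<in> E" "opair x c \<^bold>\<in> H"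
      by (auto simp: finite_at_def)
    obtain d where d: "d \<^bold>\<in> E" "\<not> opair n d \<^bold>\<in> W" using W_bounded[OF H(1)] by blast
    have "\<exists>b. b \<^bold>\<in> E \<and> opair x b \<^bold>\<in> H \<and> \<not> opair n b \<^bold>\<in> W"
    proof (cases "leq c d")
      case True
      then show ?thesis using scale_up[OF sc[OF H(1,2)] H(4) d(1)] d by blast
    next
      case False
      then have "leq d c" using le_total H d by blast
      then show ?thesis using W_down[OF H(1) d(1) H(3)] H d by blast
    qed
    then show "finite_at G x" unfolding finite_at_def using G H by blast
  qed (auto simp: finite_at_def G)
  ultimately show ?thesis by blast
qed

text \<open>
  Symmetric in \<open>S\<close> and its complement. The condition that \<open>x\<close> and \<open>p\<close> lie on
  different sides of \<open>S\<close> makes unions, differences and countable unions instances of one remark: points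
  distinguished by the compound set are distinguished by one of its constituents.
\<close>

definition scale_separated :: "'a \<Rightarrow> 'a \<Rightarrow> 'a \<Rightarrow> bool" where
  "scale_separated X T S \<longleftrightarrow> (\<forall>p\<in>elts X. \<exists>G. scale X T G \<and> \<not> finite_at G p \<and>
     (\<forall>x\<in>elts X. (x \<^bold>\<in> S \<longleftrightarrow> \<not> p \<^bold>\<in> S) \<longrightarrow> finite_at G x))"

lemma definable_scale_separated:
  assumes "definable_fun t" shows "definable (\<lambda>e. scale_separated X T (t e))"
  unfolding scale_separated_def
  by (intro scale_intros assms definable_fun_rename[OF assms])

lemma empty_scale: "topology X T \<Longrightarrow> scale X T empty"
  using z0 topology_space[of X T] by (intro scaleI) (auto simp: sub_def)

text \<open>
  The sets to which multiple choice is applied consist of all scales that are suitable for the member of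
  \<open>\<C>\<close> with number \<open>n\<close>. A number of no member imposes no condition, and the empty scale,
  infinite everywhere, keeps the set of candidates non-empty.
\<close>

lemma scale_separated_countable_union:
  assumes cmc: CMC and T: "topology X T" and C: "countable_set \<C>"
    and sep: "\<And>S. S \<^bold>\<in> \<C> \<Longrightarrow> scale_separated X T S"
  shows "scale_separated X T (bigun \<C>)"
  unfolding scale_separated_def
proof
  fix p assume "p \<in> elts X"
  then have p: "p \<^bold>\<in> X" by simp
  obtain f where f: "func f \<C> omega" and inj: "injective f \<C>"
    using C by (auto simp: countable_set_def)
  define good where "good n G \<longleftrightarrow> scale X T G \<and> \<not> finite_at G p \<and> (\<forall>S. opair S n \<^bold>\<in> f \<longrightarrow>
      (\<forall>x\<in>elts X. (x \<^bold>\<in> S \<longleftrightarrow> \<not> p \<^bold>\<in> S) \<longrightarrow> finite_at G x))" for n G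
  have good_ex: "\<exists>G. good n G" for n
  proof (cases "\<exists>S. opair S n \<^bold>\<in> f")
    case True
    then obtain S where S: "S \<^bold>\<in> \<C>" "app f S = n" by (auto simp: func_pair_iff[OF f])
    then have "opair S' n \<^bold>\<in> f \<longleftrightarrow> S' = S" for S'
      using inj by (auto simp: func_pair_iff[OF f] injective_def)
    then show ?thesis using sep[OF S(1)] p unfolding good_def scale_separated_def by auto
  next
    case False
    then have "good n empty" using empty_scale[OF T] by (simp add: good_def finite_at_def)
    then show ?thesis by blast
  qed
  define family where "family n B \<longleftrightarrow> (\<forall>G. G \<^bold>\<in> B \<longleftrightarrow> good n G)" for n B
  have Dgood: "definable (\<lambda>e. good (e i) (e j))" for i j
    unfolding good_def by (intro scale_intros)
  have Dfam: "definable (\<lambda>e. family (e 0) (e (Suc 0)))"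
    unfolding family_def by (intro scale_intros Dgood)
  have family_ex: "\<exists>B. B \<^bold>\<in> pow (pow (X \<^bold>\<times> E)) \<and>
      (\<forall>B'. B' \<^bold>\<in> pow (pow (X \<^bold>\<times> E)) \<longrightarrow> family n B' \<longleftrightarrow> B' = B)" for n
  proof -
    have "definable (\<lambda>e. good n (e 0))"
      unfolding good_def by (intro scale_intros)
    from separation_definable[OF this, of "pow (X \<^bold>\<times> E)"] obtain B where
      B: "\<And>G. G \<^bold>\<in> B \<longleftrightarrow> G \<^bold>\<in> pow (X \<^bold>\<times> E) \<and> good n G" by blast
    have "B \<^bold>\<in> pow (pow (X \<^bold>\<times> E))" by (simp add: sub_def B)
    moreover have "family n B" using B scale_sub by (auto simp: family_def good_def)
    moreover have "B' = B" if "family n B'" for B'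
      using that \<open>family n B\<close> by (intro set_eqI) (simp add: family_def)
    ultimately show ?thesis by (intro unique_in_setI[of B])
  qed
  obtain A where A: "func A omega (pow (pow (X \<^bold>\<times> E)))"
    and A_family: "\<And>n. n \<^bold>\<in> omega \<Longrightarrow> family n (app A n)"
    using ex_func[OF Dfam family_ex, of omega] by blast
  have A_mem: "G \<^bold>\<in> app A n \<longleftrightarrow> good n G" if "n \<^bold>\<in> omega" for n G
    using A_family[OF that] by (simp add: family_def)
  have "app A n \<noteq> empty" if "n \<^bold>\<in> omega" for n
    using good_ex[of n] A_mem[OF that] by (auto simp: empty_iff)
  then obtain F where F: "fun_on F omega"
    and F_sub: "\<And>n. n \<^bold>\<in> omega \<Longrightarrow> app F n \<^bold>\<subseteq> app A n"
    and F_ne: "\<And>n. n \<^bold>\<in> omega \<Longrightarrow> app F n \<noteq> empty"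
    and F_fin: "\<And>n. n \<^bold>\<in> omega \<Longrightarrow> finite_set (app F n)"
    using cmc[unfolded CMC_def, rule_format, of A] A by (auto simp: func_def)
  have F_good: "good n H" if "n \<^bold>\<in> omega" "H \<^bold>\<in> app F n" for n H
    using subD[OF F_sub[OF that(1)] that(2)] A_mem[OF that(1)] by simp
  have F_scale: "scale X T H" if "n \<^bold>\<in> omega" "H \<^bold>\<in> app F n" for n H
    using F_good[OF that] by (simp add: good_def)
  have "\<exists>G. scale X T G \<and>
    (\<forall>x. finite_at G x \<longleftrightarrow> (\<exists>n H. n \<^bold>\<in> omega \<and> H \<^bold>\<in> app F n \<and> finite_at H x))"
    by (rule scale_countable_union[OF T F]) (fact F_fin, fact F_scale)
  then obtain G where G: "scale X T G"
    "\<And>x. finite_at G x \<longleftrightarrow> (\<exists>n H. n \<^bold>\<in> omega \<and> H \<^bold>\<in> app F n \<and> finite_at H x)"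
    by blast
  have "\<not> finite_at G p" unfolding G(2) using F_good by (auto simp: good_def)
  moreover have "finite_at G x"
    if x: "x \<^bold>\<in> X" and ne: "x \<^bold>\<in> bigun \<C> \<longleftrightarrow> \<not> p \<^bold>\<in> bigun \<C>" for x
  proof -
    obtain S where S: "S \<^bold>\<in> \<C>" "x \<^bold>\<in> S \<longleftrightarrow> \<not> p \<^bold>\<in> S" using ne by auto
    have n: "app f S \<^bold>\<in> omega" using func_app[OF f S(1)] .
    obtain H where H: "H \<^bold>\<in> app F (app f S)" using F_ne[OF n] by (auto simp: empty_iff)
    have "opair S (app f S) \<^bold>\<in> f" using S(1) by (simp add: func_pair_iff[OF f])
    then have "finite_at H x" using F_good[OF n H] S(2) x by (auto simp: good_def)
    then show ?thesis unfolding G(2) using n H by blast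
  qed
  ultimately show "\<exists>G. scale X T G \<and> \<not> finite_at G p \<and>
      (\<forall>x\<in>elts X. (x \<^bold>\<in> bigun \<C> \<longleftrightarrow> \<not> p \<^bold>\<in> bigun \<C>) \<longrightarrow> finite_at G x)"
    using G(1) by auto
qed

lemma scale_separated_boolean:
  assumes T: "topology X T" and A: "scale_separated X T A" and B: "scale_separated X T B"
    and C: "\<And>x p. x \<^bold>\<in> X \<Longrightarrow> p \<^bold>\<in> X \<Longrightarrow> (x \<^bold>\<in> A \<longleftrightarrow> p \<^bold>\<in> A) \<Longrightarrow> (x \<^bold>\<in> B \<longleftrightarrow> p \<^bold>\<in> B) \<Longrightarrow>
      (x \<^bold>\<in> C \<longleftrightarrow> p \<^bold>\<in> C)"
  shows "scale_separated X T C"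
  unfolding scale_separated_def
proof
  fix p assume p: "p \<in> elts X"
  obtain G where G: "scale X T G" "\<not> finite_at G p"
    "\<And>x. x \<^bold>\<in> X \<Longrightarrow> (x \<^bold>\<in> A \<longleftrightarrow> \<not> p \<^bold>\<in> A) \<Longrightarrow> finite_at G x"
    using A p unfolding scale_separated_def by auto
  obtain H where H: "scale X T H" "\<not> finite_at H p"
    "\<And>x. x \<^bold>\<in> X \<Longrightarrow> (x \<^bold>\<in> B \<longleftrightarrow> \<not> p \<^bold>\<in> B) \<Longrightarrow> finite_at H x"
    using B p unfolding scale_separated_def by auto
  have "finite_at (G \<^bold>\<union> H) x" if "x \<^bold>\<in> X" "x \<^bold>\<in> C \<longleftrightarrow> \<not> p \<^bold>\<in> C" for x
    using C[of x p] G(3)[OF that(1)] H(3)[OF that(1)] that p by (auto simp: finite_at_union)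
  then show "\<exists>G. scale X T G \<and> \<not> finite_at G p \<and>
      (\<forall>x\<in>elts X. (x \<^bold>\<in> C \<longleftrightarrow> \<not> p \<^bold>\<in> C) \<longrightarrow> finite_at G x)"
    using scale_union[OF T G(1) H(1)] G(2) H(2)
    by (intro exI[of _ "G \<^bold>\<union> H"]) (simp add: finite_at_union)
qed

text \<open>
  The separated sets form a sigma-field containing the generators, and a separated set satisfies the hypothesis of the
  embedding theorem.
\<close>

theorem compact_over_generated_sigma_field:
  assumes cmc: CMC and T: "topology X T" and X: "compact_over E TE X T"
    and A: "\<And>S. S \<^bold>\<in> \<A> \<Longrightarrow> S \<^bold>\<subseteq> X \<and> scale_separated X T S"
    and S: "S \<^bold>\<in> generated_sigma_field X \<A>"
  shows "compact_over E TE S (subspace_top T S)"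
proof -
  have "definable (\<lambda>e. scale_separated X T (e 0))"
    by (intro scale_intros definable_scale_separated)
  from separation_definable[OF this, of "pow X"] obtain \<M> where
    M: "\<And>S. S \<^bold>\<in> \<M> \<longleftrightarrow> S \<^bold>\<subseteq> X \<and> scale_separated X T S" by auto
  have "sigma_field X \<M>"
    unfolding sigma_field_def set_field_def
  proof (intro conjI ballI allI impI; (elim conjE)?)
    show "\<M> \<^bold>\<subseteq> pow X" by (simp add: sub_def M)
    show "empty \<^bold>\<in> \<M>" using empty_scale[OF T]
      by (auto simp: M sub_def scale_separated_def finite_at_def intro!: exI[of _ empty])
    fix A B assume AB: "A \<in> elts \<M>" "B \<in> elts \<M>"
    then have "scale_separated X T A" "scale_separated X T B" by (auto simp: M)
    note bool = scale_separated_boolean[OF T this]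
    show "A \<^bold>\<union> B \<^bold>\<in> \<M>" unfolding M using AB by (intro conjI bool) (auto simp: M sub_def)
    show "A \<^bold>- B \<^bold>\<in> \<M>" unfolding M using AB by (intro conjI bool) (auto simp: M sub_def)
  next
    fix \<C> assume C: "\<C> \<^bold>\<subseteq> \<M>" "countable_set \<C>"
    have "S \<^bold>\<subseteq> X" "scale_separated X T S" if "S \<^bold>\<in> \<C>" for S using subD[OF C(1) that] by (auto simp: M)
    then show "bigun \<C> \<^bold>\<in> \<M>" unfolding M
      using scale_separated_countable_union[OF cmc T C(2)] by (auto simp: sub_def)
  qed
  moreover have "\<A> \<^bold>\<subseteq> \<M>" using A by (simp add: sub_def M)
  ultimately have "S \<^bold>\<in> \<M>" using generated_sigma_field_least S by blast
  then have SX: "S \<^bold>\<subseteq> X" and sep: "scale_separated X T S" by (auto simp: M)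
  show ?thesis
  proof (rule compact_over_subspace[OF T X SX])
    fix p assume "p \<^bold>\<in> X" "\<not> p \<^bold>\<in> S"
    then show "\<exists>G. scale X T G \<and> (\<forall>x. x \<^bold>\<in> S \<longrightarrow> finite_at G x) \<and> \<not> finite_at G p"
      using sep subD[OF SX] unfolding scale_separated_def by (metis mem_Collect_eq)
  qed
qed

text \<open>
  The scale is constantly \<open>z0\<close> on \<open>Q\<close> and infinite elsewhere.
\<close>

lemma clopen_scale:
  assumes T: "topology X T" and Q: "Q \<^bold>\<in> T" "X \<^bold>- Q \<^bold>\<in> T"
  shows "\<exists>G. scale X T G \<and> (\<forall>x. x \<^bold>\<in> X \<longrightarrow> finite_at G x \<longleftrightarrow> x \<^bold>\<in> Q)"
proof -
  have QX: "x \<^bold>\<in> Q \<Longrightarrow> x \<^bold>\<in> X" for x using subD[OF topology_sub[OF T Q(1)]] .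
  have "definable (\<lambda>e. \<exists>x c. e 0 = opair x c \<and> x \<^bold>\<in> Q \<and> lt z0 c)" by (intro def_intros)
  from separation_definable[OF this, of "X \<^bold>\<times> E"] obtain G where
    "\<And>u. u \<^bold>\<in> G \<longleftrightarrow> u \<^bold>\<in> X \<^bold>\<times> E \<and> (\<exists>x c. u = opair x c \<and> x \<^bold>\<in> Q \<and> lt z0 c)" by blast
  then have Gsub: "G \<^bold>\<subseteq> X \<^bold>\<times> E" and G: "opair x c \<^bold>\<in> G \<longleftrightarrow> x \<^bold>\<in> Q \<and> c \<^bold>\<in> E \<and> lt z0 c" for x c
    using QX by (auto simp: sub_def)
  have "scale X T G"
  proof (rule scaleI[OF Gsub])
    show "opair x d \<^bold>\<in> G" if "c \<^bold>\<in> E" "d \<^bold>\<in> E" "opair x c \<^bold>\<in> G" "leq c d" for x c d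
      using that lt_le_trans[OF z0, of c d] unfolding G by blast
    show "\<exists>c. c \<^bold>\<in> E \<and> \<not> opair x c \<^bold>\<in> G" for x using z0 unfolding G by blast
    show "near T x (\<lambda>y. opair y c \<^bold>\<in> G)" if "opair x c \<^bold>\<in> G" for x c
      using that Q(1) unfolding G by blast
    show "near T x (\<lambda>y. \<not> opair y e \<^bold>\<in> G)"
      if x: "x \<^bold>\<in> X" and d: "d \<^bold>\<in> E" and e: "e \<^bold>\<in> E" and "way_below e d" and n: "\<not> opair x d \<^bold>\<in> G" for x d e
    proof (cases "x \<^bold>\<in> Q")
      case True
      then have "\<not> lt z0 e" using n d lt_le_trans[OF z0 e d] way_below_le[OF d \<open>way_below e d\<close>]
        unfolding G by blast
      then show ?thesis using topology_space[OF T] x unfolding G by blast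
    next
      case False
      then show ?thesis using Q(2) x by (intro exI[of _ "X \<^bold>- Q"]) (simp add: G)
    qed
  qed
  moreover have "finite_at G x \<longleftrightarrow> x \<^bold>\<in> Q" for x
    unfolding finite_at_def using no_top[OF z0] by (auto simp: G)
  ultimately show ?thesis by blast
qed

lemma clopen_scale_separated:
  assumes T: "topology X T" and Q: "Q \<^bold>\<in> T" "X \<^bold>- Q \<^bold>\<in> T"
  shows "scale_separated X T Q"
proof -
  have "X \<^bold>- (X \<^bold>- Q) = Q"
    using subD[OF topology_sub[OF T Q(1)]] by (intro set_eqI) auto
  then obtain G where G: "scale X T G" "\<And>x. x \<^bold>\<in> X \<Longrightarrow> finite_at G x \<longleftrightarrow> \<not> x \<^bold>\<in> Q"
    using clopen_scale[OF T Q(2)] Q(1) by auto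
  obtain H where H: "scale X T H" "\<And>x. x \<^bold>\<in> X \<Longrightarrow> finite_at H x \<longleftrightarrow> x \<^bold>\<in> Q"
    using clopen_scale[OF T Q] by blast
  show ?thesis unfolding scale_separated_def
  proof
    fix p assume "p \<in> elts X"
    then show "\<exists>G. scale X T G \<and> \<not> finite_at G p \<and>
        (\<forall>x\<in>elts X. (x \<^bold>\<in> Q \<longleftrightarrow> \<not> p \<^bold>\<in> Q) \<longrightarrow> finite_at G x)"
      using G H by (cases "p \<^bold>\<in> Q") auto
  qed
qed

end

section \<open>The natural numbers as an ordered space\<close>

context ZF_model
begin

text \<open>
  Both relations are introduced as sets because an ordered space refers to sets of the model.
\<close>

definition omega_le :: 'a where
  "omega_le = Coll (\<lambda>u. \<exists>m n. u = opair m n \<and> m \<^bold>\<in> omega \<and> n \<^bold>\<in> omega \<and> (m \<^bold>\<in> n \<or> m = n))"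

lemma mem_omega_le:
  "opair m n \<^bold>\<in> omega_le \<longleftrightarrow> m \<^bold>\<in> omega \<and> n \<^bold>\<in> omega \<and> (m \<^bold>\<in> n \<or> m = n)"
proof -
  have "u \<^bold>\<in> omega_le \<longleftrightarrow>
      (\<exists>m n. u = opair m n \<and> m \<^bold>\<in> omega \<and> n \<^bold>\<in> omega \<and> (m \<^bold>\<in> n \<or> m = n))" for u
    unfolding omega_le_def
  proof (rule mem_Coll_bounded[of _ "omega \<^bold>\<times> omega"])
    show "definable (\<lambda>e. \<exists>m n. e 0 = opair m n \<and> m \<^bold>\<in> omega \<and> n \<^bold>\<in> omega \<and> (m \<^bold>\<in> n \<or> m = n))"
      by (intro def_intros)
  qed auto
  then show ?thesis by auto
qed

definition omega_ge :: 'a where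
  "omega_ge = Coll (\<lambda>u. \<exists>m n. u = opair m n \<and> opair n m \<^bold>\<in> omega_le)"

lemma mem_omega_ge: "opair m n \<^bold>\<in> omega_ge \<longleftrightarrow> opair n m \<^bold>\<in> omega_le"
proof -
  have "u \<^bold>\<in> omega_ge \<longleftrightarrow> (\<exists>m n. u = opair m n \<and> opair n m \<^bold>\<in> omega_le)" for u
    unfolding omega_ge_def
  proof (rule mem_Coll_bounded[of _ "omega \<^bold>\<times> omega"])
    show "definable (\<lambda>e. \<exists>m n. e 0 = opair m n \<and> opair n m \<^bold>\<in> omega_le)"
      by (intro def_intros)
  qed (auto simp: mem_omega_le)
  then show ?thesis by auto
qed

lemma omega_ordered_space: "ordered_space mem omega (pow omega) omega_le omega_ge empty"
proof (unfold_locales, goal_cases)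
  case (1 a b)
  then show ?case using omega_trichotomy by (auto simp: mem_omega_le)
next
  case (2 a b)
  then show ?case using not_mem_mem by (auto simp: mem_omega_le)
next
  case (3 a b c)
  then show ?case using omega_trans subD by (metis mem_omega_le)
next
  case (4 A a b)
  have "definable (\<lambda>e. \<forall>x\<in>elts A. opair x (e 0) \<^bold>\<in> omega_le)" by (intro def_intros)
  from separation_definable[OF this, of omega] obtain B where
    B: "\<And>u. u \<^bold>\<in> B \<longleftrightarrow> u \<^bold>\<in> omega \<and> (\<forall>x\<in>elts A. opair x u \<^bold>\<in> omega_le)" by blast
  have "b \<^bold>\<in> B" using 4 by (simp add: B)
  \<comment> \<open>Foundation supplies the least upper bound: the order of \<open>\<omega>\<close> is membership.\<close>
  then obtain s where s: "s \<^bold>\<in> B" "\<And>y. y \<^bold>\<in> s \<Longrightarrow> \<not> y \<^bold>\<in> B" using foundation[of B] by blast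
  have "opair s u \<^bold>\<in> omega_le" if "u \<^bold>\<in> B" for u
    using omega_trichotomy[of s u] s that by (auto simp: mem_omega_le B)
  then show ?case using s(1) by (auto simp: B)
next
  case (5 a)
  then show ?case using mem_irrefl by (intro exI[of _ "succ a"]) (auto simp: mem_omega_le, metis mem_un mem_upair)
next
  case (6 a)
  have "definable (\<lambda>e. opair a (e 0) \<^bold>\<in> omega_le \<and> a \<noteq> e 0)" by (intro def_intros)
  from separation_definable[OF this, of omega] show ?case by (auto simp: sub_def)
next
  case (7 a)
  have "definable (\<lambda>e. opair (e 0) a \<^bold>\<in> omega_le \<and> e 0 \<noteq> a)" by (intro def_intros)
  from separation_definable[OF this, of omega] show ?case by (auto simp: sub_def)
next
  case (8 V z)
  from 8(3) show ?case
  proof (cases rule: omega_cases)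
    case 1
    then show ?thesis using 8 by (auto simp: mem_omega_le)
  next
    case (2 m)
    have "m \<noteq> succ m" using mem_irrefl by (metis mem_un mem_upair)
    moreover have "y = succ m" if "opair m y \<^bold>\<in> omega_le" "m \<noteq> y" "opair y (succ m) \<^bold>\<in> omega_le" for y
      using that not_mem_mem[of m y] by (auto simp: mem_omega_le)
    ultimately show ?thesis using 8 2 by (intro disjI2 exI[of _ m]) (auto simp: mem_omega_le)
  qed
next
  case (9 V z)
  have "z \<noteq> succ z" using mem_irrefl by (metis mem_un mem_upair)
  moreover have "y = z" if "opair z y \<^bold>\<in> omega_le" "opair y (succ z) \<^bold>\<in> omega_le" "y \<noteq> succ z" for y
    using that not_mem_mem[of z y] by (auto simp: mem_omega_le)
  ultimately show ?case using 9 by (intro exI[of _ "succ z"]) (auto simp: mem_omega_le)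
next
  case (10 V)
  then show ?case by simp
next
  case 11
  then show ?case by simp
next
  case (12 n c d)
  then show ?case using omega_trans subD by (metis mem_omega_le mem_omega_ge)
next
  case (13 n)
  then show ?case using zero_mem_omega by (auto simp: mem_omega_le mem_omega_ge)
next
  case (14 n)
  have "\<not> (succ n \<^bold>\<in> n \<or> succ n = n)" using not_mem_mem by (metis mem_un mem_upair)
  then show ?case using 14 by (intro exI[of _ "succ n"]) (auto simp: mem_omega_le mem_omega_ge)
next
  case (15 d)
  then show ?case using omega_trichotomy
    by (intro exI[of _ d]) (auto simp: mem_omega_le mem_omega_ge)
qed

theorem N_compact_zero_Baire:
  assumes cmc: CMC and T: "topology X T" and X: "N_compact X T" and S: "S \<^bold>\<in> zero_Baire X T"
  shows "N_compact S (subspace_top T S)"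
proof -
  interpret ordered_space mem omega "pow omega" omega_le omega_ge empty
    by (rule omega_ordered_space)
  have clopen: "U \<^bold>\<in> clopen_sets X T \<longleftrightarrow> U \<^bold>\<in> T \<and> closed_in X T U" for U
    unfolding clopen_sets_def
  proof (rule mem_Coll_bounded[of _ T])
    show "definable (\<lambda>e. e 0 \<^bold>\<in> T \<and> closed_in X T (e 0))"
      unfolding closed_in_def by (intro def_intros definable_fun_diff)
  qed auto
  show ?thesis unfolding N_compact_def
  proof (rule compact_over_generated_sigma_field[OF cmc T X[unfolded N_compact_def] _ S[unfolded zero_Baire_def]])
    fix U assume "U \<^bold>\<in> clopen_sets X T"
    then show "U \<^bold>\<subseteq> X \<and> scale_separated X T U"
      using clopen_scale_separated[OF T] topology_sub[OF T] by (simp add: clopen closed_in_def)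
  qed
qed

end

section \<open>The real line as an ordered space\<close>

locale real_line = ZF_model +
  fixes R add mul zero one le :: 'a
  assumes cof: "complete_ordered_field R add mul zero one le"
begin

abbreviation plus (infixl "\<oplus>" 65) where "x \<oplus> y \<equiv> app add (opair x y)"
abbreviation times (infixl "\<otimes>" 70) where "x \<otimes> y \<equiv> app mul (opair x y)"
abbreviation leq (infix "\<preceq>" 50) where "x \<preceq> y \<equiv> opair x y \<^bold>\<in> le"
abbreviation less (infix "\<prec>" 50) where "x \<prec> y \<equiv> x \<preceq> y \<and> x \<noteq> y"

text \<open>
  Splitting the conjunction once lets each law below be derived from a single axiom.
\<close>

lemma field_axioms:
  shows
    "func add (R \<^bold>\<times> R) R" and
    "func mul (R \<^bold>\<times> R) R" and
    "zero \<^bold>\<in> R" and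
    "one \<^bold>\<in> R" and
    "zero \<noteq> one" and
    "\<forall>x\<in>elts R. \<forall>y\<in>elts R. \<forall>z\<in>elts R. plus (plus x y) z = plus x (plus y z)" and
    "\<forall>x\<in>elts R. \<forall>y\<in>elts R. plus x y = plus y x" and
    "\<forall>x\<in>elts R. plus x zero = x" and
    "\<forall>x\<in>elts R. \<exists>y\<in>elts R. plus x y = zero" and
    "\<forall>x\<in>elts R. \<forall>y\<in>elts R. \<forall>z\<in>elts R. times (times x y) z = times x (times y z)" and
    "\<forall>x\<in>elts R. \<forall>y\<in>elts R. times x y = times y x" and
    "\<forall>x\<in>elts R. times x one = x" and
    "\<forall>x\<in>elts R. x \<noteq> zero \<longrightarrow> (\<exists>y\<in>elts R. times x y = one)" and
    "\<forall>x\<in>elts R. \<forall>y\<in>elts R. \<forall>z\<in>elts R. times x (plus y z) = plus (times x y) (times x z)" and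
    "le \<^bold>\<subseteq> R \<^bold>\<times> R" and
    "\<forall>x\<in>elts R. \<forall>y\<in>elts R. leq x y \<or> leq y x" and
    "\<forall>x\<in>elts R. \<forall>y\<in>elts R. leq x y \<and> leq y x \<longrightarrow> x = y" and
    "\<forall>x\<in>elts R. \<forall>y\<in>elts R. \<forall>z\<in>elts R. leq x y \<and> leq y z \<longrightarrow> leq x z" and
    "\<forall>x\<in>elts R. \<forall>y\<in>elts R. \<forall>z\<in>elts R. leq x y \<longrightarrow> leq (plus x z) (plus y z)" and
    "\<forall>x\<in>elts R. \<forall>y\<in>elts R. leq zero x \<and> leq zero y \<longrightarrow> leq zero (times x y)" and
    "\<forall>A. A \<^bold>\<subseteq> R \<and> A \<noteq> empty \<and> (\<exists>b\<in>elts R. \<forall>x\<in>elts A. leq x b) \<longrightarrow> (\<exists>s\<in>elts R. (\<forall>x\<in>elts A. leq x s) \<and> (\<forall>b\<in>elts R. (\<forall>x\<in>elts A. leq x b) \<longrightarrow> leq s b))"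
  using cof unfolding complete_ordered_field_def Let_def by - (elim conjE, assumption)+

lemma add_fun: "func add (R \<^bold>\<times> R) R" by (rule field_axioms(1))
lemma mul_fun: "func mul (R \<^bold>\<times> R) R" by (rule field_axioms(2))
lemma plus_in [simp]: "x \<^bold>\<in> R \<Longrightarrow> y \<^bold>\<in> R \<Longrightarrow> x \<oplus> y \<^bold>\<in> R" using func_app[OF add_fun] by simp
lemma times_in [simp]: "x \<^bold>\<in> R \<Longrightarrow> y \<^bold>\<in> R \<Longrightarrow> x \<otimes> y \<^bold>\<in> R" using func_app[OF mul_fun] by simp
lemma zero_in [simp]: "zero \<^bold>\<in> R" by (rule field_axioms(3))
lemma one_in [simp]: "one \<^bold>\<in> R" by (rule field_axioms(4))
lemma zero_neq_one: "zero \<noteq> one" by (rule field_axioms(5))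
lemma plus_assoc: "x \<^bold>\<in> R \<Longrightarrow> y \<^bold>\<in> R \<Longrightarrow> z \<^bold>\<in> R \<Longrightarrow> (x \<oplus> y) \<oplus> z = x \<oplus> (y \<oplus> z)"
  using field_axioms(6) by blast
lemma plus_commute: "x \<^bold>\<in> R \<Longrightarrow> y \<^bold>\<in> R \<Longrightarrow> x \<oplus> y = y \<oplus> x"
  using field_axioms(7) by blast
lemma plus_zero [simp]: "x \<^bold>\<in> R \<Longrightarrow> x \<oplus> zero = x" using field_axioms(8) by blast
lemma neg_exists: "x \<^bold>\<in> R \<Longrightarrow> \<exists>y. y \<^bold>\<in> R \<and> x \<oplus> y = zero" using field_axioms(9) by blast
lemma times_assoc: "x \<^bold>\<in> R \<Longrightarrow> y \<^bold>\<in> R \<Longrightarrow> z \<^bold>\<in> R \<Longrightarrow> (x \<otimes> y) \<otimes> z = x \<otimes> (y \<otimes> z)"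
  using field_axioms(10) by blast
lemma times_commute: "x \<^bold>\<in> R \<Longrightarrow> y \<^bold>\<in> R \<Longrightarrow> x \<otimes> y = y \<otimes> x"
  using field_axioms(11) by blast
lemma times_one [simp]: "x \<^bold>\<in> R \<Longrightarrow> x \<otimes> one = x" using field_axioms(12) by blast
lemma inverse_exists: "x \<^bold>\<in> R \<Longrightarrow> x \<noteq> zero \<Longrightarrow> \<exists>y. y \<^bold>\<in> R \<and> x \<otimes> y = one"
  using field_axioms(13) by blast
lemma distrib: "x \<^bold>\<in> R \<Longrightarrow> y \<^bold>\<in> R \<Longrightarrow> z \<^bold>\<in> R \<Longrightarrow> x \<otimes> (y \<oplus> z) = x \<otimes> y \<oplus> x \<otimes> z"
  using field_axioms(14) by blast
lemma leq_total: "x \<^bold>\<in> R \<Longrightarrow> y \<^bold>\<in> R \<Longrightarrow> x \<preceq> y \<or> y \<preceq> x" using field_axioms(16) by blast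
lemma leq_antisym: "x \<^bold>\<in> R \<Longrightarrow> y \<^bold>\<in> R \<Longrightarrow> x \<preceq> y \<Longrightarrow> y \<preceq> x \<Longrightarrow> x = y"
  using field_axioms(17) by blast
lemma leq_trans: "x \<^bold>\<in> R \<Longrightarrow> y \<^bold>\<in> R \<Longrightarrow> z \<^bold>\<in> R \<Longrightarrow> x \<preceq> y \<Longrightarrow> y \<preceq> z \<Longrightarrow> x \<preceq> z"
  using field_axioms(18) by blast
lemma plus_mono: "x \<^bold>\<in> R \<Longrightarrow> y \<^bold>\<in> R \<Longrightarrow> z \<^bold>\<in> R \<Longrightarrow> x \<preceq> y \<Longrightarrow> x \<oplus> z \<preceq> y \<oplus> z"
  using field_axioms(19) by blast
lemma times_nonneg: "x \<^bold>\<in> R \<Longrightarrow> y \<^bold>\<in> R \<Longrightarrow> zero \<preceq> x \<Longrightarrow> zero \<preceq> y \<Longrightarrow> zero \<preceq> x \<otimes> y"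
  using field_axioms(20) by blast
lemma complete:
  assumes "A \<^bold>\<subseteq> R" "a \<^bold>\<in> A" "b \<^bold>\<in> R" "\<And>x. x \<^bold>\<in> A \<Longrightarrow> x \<preceq> b"
  shows "\<exists>s. s \<^bold>\<in> R \<and> (\<forall>x. x \<^bold>\<in> A \<longrightarrow> x \<preceq> s) \<and>
    (\<forall>b. b \<^bold>\<in> R \<longrightarrow> (\<forall>x. x \<^bold>\<in> A \<longrightarrow> x \<preceq> b) \<longrightarrow> s \<preceq> b)"
proof -
  have "A \<noteq> empty" using assms(2) by (auto simp: empty_iff)
  then have "A \<^bold>\<subseteq> R \<and> A \<noteq> empty \<and> (\<exists>b\<in>elts R. \<forall>x\<in>elts A. x \<preceq> b)" using assms by blast
  from field_axioms(21)[rule_format, OF this] show ?thesis unfolding Ball_def Bex_def mem_Collect_eq .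
qed

lemma leq_refl: "x \<^bold>\<in> R \<Longrightarrow> x \<preceq> x" using leq_total by blast
lemma not_leq: "x \<^bold>\<in> R \<Longrightarrow> y \<^bold>\<in> R \<Longrightarrow> \<not> x \<preceq> y \<longleftrightarrow> y \<prec> x"
  using leq_total leq_antisym leq_refl by blast
lemma less_leq_trans: "x \<^bold>\<in> R \<Longrightarrow> y \<^bold>\<in> R \<Longrightarrow> z \<^bold>\<in> R \<Longrightarrow> x \<prec> y \<Longrightarrow> y \<preceq> z \<Longrightarrow> x \<prec> z"
  using leq_trans leq_antisym by blast
lemma leq_less_trans: "x \<^bold>\<in> R \<Longrightarrow> y \<^bold>\<in> R \<Longrightarrow> z \<^bold>\<in> R \<Longrightarrow> x \<preceq> y \<Longrightarrow> y \<prec> z \<Longrightarrow> x \<prec> z"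
  using leq_trans leq_antisym by blast

lemma zero_plus [simp]: "x \<^bold>\<in> R \<Longrightarrow> zero \<oplus> x = x" by (simp add: plus_commute)

lemma minus_exists:
  assumes "x \<^bold>\<in> R" "y \<^bold>\<in> R" shows "\<exists>d. d \<^bold>\<in> R \<and> d \<oplus> y = x"
proof -
  obtain n where n: "n \<^bold>\<in> R" "y \<oplus> n = zero" using neg_exists assms by blast
  then have "(x \<oplus> n) \<oplus> y = x" using assms by (simp add: plus_assoc plus_commute[of n y])
  then show ?thesis using n assms by (intro exI[of _ "x \<oplus> n"]) simp
qed

lemma plus_cancel:
  assumes "x \<^bold>\<in> R" "y \<^bold>\<in> R" "z \<^bold>\<in> R" shows "x \<oplus> z = y \<oplus> z \<longleftrightarrow> x = y"
proof
  assume eq: "x \<oplus> z = y \<oplus> z"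
  obtain n where n: "n \<^bold>\<in> R" "z \<oplus> n = zero" using neg_exists assms by blast
  have "x = (x \<oplus> z) \<oplus> n" using n assms by (simp add: plus_assoc)
  also have "\<dots> = y" using n assms by (simp add: eq plus_assoc)
  finally show "x = y" .
qed simp

lemma plus_leq_iff:
  assumes "x \<^bold>\<in> R" "y \<^bold>\<in> R" "z \<^bold>\<in> R" shows "x \<oplus> z \<preceq> y \<oplus> z \<longleftrightarrow> x \<preceq> y"
proof
  assume "x \<oplus> z \<preceq> y \<oplus> z"
  then show "x \<preceq> y"
    using leq_total[OF assms(1,2)] plus_mono[OF assms(2,1,3)] leq_antisym[of "x \<oplus> z" "y \<oplus> z"]
      plus_cancel[OF assms] leq_refl[OF assms(1)] assms by auto
qed (rule plus_mono[OF assms])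

lemma plus_less_iff:
  assumes "x \<^bold>\<in> R" "y \<^bold>\<in> R" "z \<^bold>\<in> R" shows "x \<oplus> z \<prec> y \<oplus> z \<longleftrightarrow> x \<prec> y"
  using plus_leq_iff[OF assms] plus_cancel[OF assms] by blast

lemma times_zero [simp]:
  assumes "x \<^bold>\<in> R" shows "x \<otimes> zero = zero"
proof -
  have "zero \<oplus> x \<otimes> zero = x \<otimes> zero \<oplus> x \<otimes> zero"
    using distrib[of x zero zero] assms by simp
  then show ?thesis using plus_cancel[of zero "x \<otimes> zero" "x \<otimes> zero"] assms by simp
qed

lemma zero_less_one: "zero \<prec> one"
proof (rule ccontr)
  assume "\<not> zero \<prec> one"
  then have neg: "one \<prec> zero" using leq_total[of zero one] zero_neq_one by auto
  \<comment> \<open>If \<open>1 < 0\<close>, then \<open>n = -1\<close> is non-negative, and so is its square, which is \<open>1\<close>.\<close>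
  obtain n where n: "n \<^bold>\<in> R" "one \<oplus> n = zero" using neg_exists one_in by blast
  have "zero \<preceq> n" using plus_mono[of one zero n] neg n by simp
  then have "zero \<preceq> n \<otimes> n" using times_nonneg n by blast
  moreover have "n \<otimes> n = one"
  proof -
    have "n \<oplus> n \<otimes> n = zero" using distrib[of n one n] n by simp
    then have "n \<otimes> n \<oplus> n = one \<oplus> n" using n by (simp add: plus_commute[of "n \<otimes> n" n])
    then show ?thesis using plus_cancel[of "n \<otimes> n" one n] n by simp
  qed
  ultimately show False using neg leq_antisym[of zero one] by simp
qed

lemma less_succ: "x \<^bold>\<in> R \<Longrightarrow> x \<prec> x \<oplus> one"
  using plus_less_iff[of zero one x] zero_less_one by (simp add: plus_commute[of one x])

lemma times_pos:
  assumes "x \<^bold>\<in> R" "y \<^bold>\<in> R" "zero \<prec> x" "zero \<prec> y" shows "zero \<prec> x \<otimes> y"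
proof -
  obtain i where i: "i \<^bold>\<in> R" "x \<otimes> i = one" using inverse_exists assms by metis
  have "y = y \<otimes> (x \<otimes> i)" using i assms by simp
  also have "\<dots> = (x \<otimes> y) \<otimes> i" using i assms by (simp add: times_assoc[symmetric] times_commute)
  finally have y: "y = (x \<otimes> y) \<otimes> i" .
  have "x \<otimes> y \<noteq> zero"
  proof
    assume "x \<otimes> y = zero"
    then have "y = zero \<otimes> i" using y by simp
    then show False using i assms by (simp add: times_commute[of zero i])
  qed
  then show ?thesis using times_nonneg assms by auto
qed

lemma times_less:
  assumes "x \<^bold>\<in> R" "y \<^bold>\<in> R" "z \<^bold>\<in> R" "x \<prec> y" "zero \<prec> z" shows "z \<otimes> x \<prec> z \<otimes> y"
proof -
  obtain d where d: "d \<^bold>\<in> R" "d \<oplus> x = y" using minus_exists assms by blast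
  have "zero \<prec> d" using plus_less_iff[of zero d x] d assms by simp
  then have "zero \<prec> z \<otimes> d" using times_pos assms d by blast
  moreover have "z \<otimes> y = z \<otimes> d \<oplus> z \<otimes> x" using d assms distrib[of z d x] by simp
  ultimately show ?thesis using plus_less_iff[of zero "z \<otimes> d" "z \<otimes> x"] assms d by simp
qed

lemma inverse_pos:
  assumes "x \<^bold>\<in> R" "i \<^bold>\<in> R" "zero \<prec> x" "x \<otimes> i = one" shows "zero \<prec> i"
proof (rule ccontr)
  assume "\<not> zero \<prec> i"
  then have "i \<preceq> zero" using leq_total[of zero i] leq_refl[of zero] assms by auto
  moreover have "i \<noteq> zero" using assms zero_neq_one by auto
  ultimately have "x \<otimes> i \<prec> x \<otimes> zero" using times_less[of i zero x] assms by auto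
  then show False using assms zero_less_one leq_antisym[of zero one] by auto
qed

lemma inverse_antimono:
  assumes "r \<^bold>\<in> R" "s \<^bold>\<in> R" "i \<^bold>\<in> R" "j \<^bold>\<in> R" "zero \<prec> r" "r \<preceq> s" "r \<otimes> i = one" "s \<otimes> j = one"
  shows "j \<preceq> i"
proof (rule ccontr)
  assume "\<not> j \<preceq> i"
  then have ij: "i \<prec> j" using not_leq assms by blast
  have j: "zero \<prec> j" using inverse_pos[of s j] less_leq_trans[of zero r s] assms by auto
  have "one \<prec> r \<otimes> j" using times_less[of i j r] ij assms by simp
  moreover have "r \<otimes> j \<preceq> one"
    using times_less[of r s j] j assms leq_refl[of one] by (cases "r = s") (auto simp: times_commute)
  ultimately show False using less_leq_trans[of one "r \<otimes> j" one] assms by simp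
qed

lemma inverse_strict_antimono:
  assumes "r \<^bold>\<in> R" "s \<^bold>\<in> R" "i \<^bold>\<in> R" "j \<^bold>\<in> R" "zero \<prec> r" "r \<prec> s" "r \<otimes> i = one" "s \<otimes> j = one"
  shows "j \<prec> i"
proof -
  have "j \<noteq> i"
  proof
    assume "j = i"
    then have "i \<otimes> r \<prec> i \<otimes> s" using times_less[of r s i] inverse_pos[of r i] assms by auto
    then show False using \<open>j = i\<close> assms by (simp add: times_commute)
  qed
  then show ?thesis using inverse_antimono[of r s i j] assms by auto
qed

lemma dense:
  assumes "x \<^bold>\<in> R" "y \<^bold>\<in> R" "x \<prec> y" shows "\<exists>z. z \<^bold>\<in> R \<and> x \<prec> z \<and> z \<prec> y"
proof -
  have two: "zero \<prec> one \<oplus> one"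
    using less_leq_trans[of zero one "one \<oplus> one"] zero_less_one less_succ[of one] by simp
  then obtain h where h: "h \<^bold>\<in> R" "(one \<oplus> one) \<otimes> h = one"
    using inverse_exists[of "one \<oplus> one"] by auto
  have hpos: "zero \<prec> h" using inverse_pos[OF _ h(1) two h(2)] by simp
  \<comment> \<open>The point between \<open>x\<close> and \<open>y\<close> is their arithmetic mean.\<close>
  have half: "h \<otimes> (u \<oplus> u) = u" if u: "u \<^bold>\<in> R" for u
  proof -
    have "h \<otimes> (u \<oplus> u) = h \<otimes> (u \<otimes> (one \<oplus> one))" using u distrib[of u one one] by simp
    also have "\<dots> = u \<otimes> ((one \<oplus> one) \<otimes> h)"
      using u h by (simp add: times_commute[of h "u \<otimes> (one \<oplus> one)"] times_assoc)
    finally show ?thesis using u h by simp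
  qed
  have "x \<oplus> x \<prec> x \<oplus> y"
    using plus_less_iff[of x y x] assms by (simp add: plus_commute[of y x])
  then have "h \<otimes> (x \<oplus> x) \<prec> h \<otimes> (x \<oplus> y)" using times_less[of "x \<oplus> x" "x \<oplus> y" h] hpos h assms by simp
  moreover have "x \<oplus> y \<prec> y \<oplus> y" using plus_less_iff[of x y y] assms by simp
  then have "h \<otimes> (x \<oplus> y) \<prec> h \<otimes> (y \<oplus> y)" using times_less[of "x \<oplus> y" "y \<oplus> y" h] hpos h assms by simp
  ultimately show ?thesis using half assms h by (intro exI[of _ "h \<otimes> (x \<oplus> y)"]) simp
qed

lemma mem_real_top: "V \<^bold>\<in> real_top R le \<longleftrightarrow> V \<^bold>\<subseteq> R \<and> (\<forall>x. x \<^bold>\<in> V \<longrightarrow>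
    (\<exists>a b. a \<^bold>\<in> R \<and> b \<^bold>\<in> R \<and> a \<prec> x \<and> x \<prec> b \<and> (\<forall>y. y \<^bold>\<in> R \<longrightarrow> a \<prec> y \<longrightarrow> y \<prec> b \<longrightarrow> y \<^bold>\<in> V)))"
proof -
  have "V \<^bold>\<in> real_top R le \<longleftrightarrow> V \<^bold>\<subseteq> R \<and> (\<forall>x\<in>elts V. \<exists>a\<in>elts R. \<exists>b\<in>elts R. a \<prec> x \<and> x \<prec> b \<and>
      (\<forall>y\<in>elts R. a \<prec> y \<and> y \<prec> b \<longrightarrow> y \<^bold>\<in> V))"
    unfolding real_top_def Let_def
  proof (rule mem_Coll_bounded[of _ "pow R"])
    show "definable (\<lambda>e. e 0 \<^bold>\<subseteq> R \<and> (\<forall>x\<in>elts (e 0). \<exists>a\<in>elts R. \<exists>b\<in>elts R. a \<prec> x \<and> x \<prec> b \<and>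
      (\<forall>y\<in>elts R. a \<prec> y \<and> y \<prec> b \<longrightarrow> y \<^bold>\<in> e 0)))" by (intro def_intros)
  qed simp
  then show ?thesis
    by (simp only: Ball_def Bex_def mem_Collect_eq imp_conjL ex_simps conj_assoc)
qed

lemma pred_exists: "x \<^bold>\<in> R \<Longrightarrow> \<exists>y. y \<^bold>\<in> R \<and> y \<prec> x"
  using minus_exists[of x one] less_succ by auto

lemma up_ray_open:
  assumes "a \<^bold>\<in> R" shows "\<exists>V. V \<^bold>\<in> real_top R le \<and> (\<forall>x. x \<^bold>\<in> V \<longleftrightarrow> x \<^bold>\<in> R \<and> a \<prec> x)"
proof -
  have "definable (\<lambda>e. a \<prec> e 0)" by (intro def_intros)
  from separation_definable[OF this, of R] obtain V where
    V: "\<And>x. x \<^bold>\<in> V \<longleftrightarrow> x \<^bold>\<in> R \<and> a \<prec> x" by blast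
  have "V \<^bold>\<in> real_top R le" unfolding mem_real_top
  proof (intro conjI allI impI)
    show "V \<^bold>\<subseteq> R" by (simp add: sub_def V)
    fix x assume "x \<^bold>\<in> V"
    then show "\<exists>a b. a \<^bold>\<in> R \<and> b \<^bold>\<in> R \<and> a \<prec> x \<and> x \<prec> b \<and> (\<forall>y. y \<^bold>\<in> R \<longrightarrow> a \<prec> y \<longrightarrow> y \<prec> b \<longrightarrow> y \<^bold>\<in> V)"
      using assms less_succ[of x] by (intro exI[of _ a] exI[of _ "x \<oplus> one"]) (simp add: V)
  qed
  then show ?thesis using V by blast
qed

lemma down_ray_open:
  assumes "b \<^bold>\<in> R" shows "\<exists>V. V \<^bold>\<in> real_top R le \<and> (\<forall>x. x \<^bold>\<in> V \<longleftrightarrow> x \<^bold>\<in> R \<and> x \<prec> b)"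
proof -
  have "definable (\<lambda>e. e 0 \<prec> b)" by (intro def_intros)
  from separation_definable[OF this, of R] obtain V where
    V: "\<And>x. x \<^bold>\<in> V \<longleftrightarrow> x \<^bold>\<in> R \<and> x \<prec> b" by blast
  have "V \<^bold>\<in> real_top R le" unfolding mem_real_top
  proof (intro conjI allI impI)
    show "V \<^bold>\<subseteq> R" by (simp add: sub_def V)
    fix x assume x: "x \<^bold>\<in> V"
    obtain a where "a \<^bold>\<in> R" "a \<prec> x" using pred_exists x V by blast
    then show "\<exists>a b. a \<^bold>\<in> R \<and> b \<^bold>\<in> R \<and> a \<prec> x \<and> x \<prec> b \<and> (\<forall>y. y \<^bold>\<in> R \<longrightarrow> a \<prec> y \<longrightarrow> y \<prec> b \<longrightarrow> y \<^bold>\<in> V)"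
      using assms x by (intro exI[of _ a] exI[of _ b]) (simp add: V)
  qed
  then show ?thesis using V by blast
qed

subsection \<open>Comparing reals with natural numbers\<close>

text \<open>
  The relation \<open>c \<le> n\<close> between natural numbers and reals is obtained without a recursion theorem as the
  least relation that contains all pairs with \<open>c \<le> 0\<close> and is closed under adding one on both sides.
\<close>

definition counting_closed :: "'a \<Rightarrow> bool" where
  "counting_closed Z \<longleftrightarrow>
    (\<forall>n\<in>elts omega. \<forall>c\<in>elts R. c \<preceq> zero \<longrightarrow> opair n c \<^bold>\<in> Z) \<and>
    (\<forall>n\<in>elts omega. \<forall>c\<in>elts R. \<forall>d. opair n c \<^bold>\<in> Z \<longrightarrow> opair (opair c one) d \<^bold>\<in> add \<longrightarrow>
       opair (succ n) d \<^bold>\<in> Z)"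

lemma counting_closed_iff: "counting_closed Z \<longleftrightarrow>
    (\<forall>n c. n \<^bold>\<in> omega \<longrightarrow> c \<^bold>\<in> R \<longrightarrow> c \<preceq> zero \<longrightarrow> opair n c \<^bold>\<in> Z) \<and>
    (\<forall>n c. n \<^bold>\<in> omega \<longrightarrow> c \<^bold>\<in> R \<longrightarrow> opair n c \<^bold>\<in> Z \<longrightarrow> opair (succ n) (c \<oplus> one) \<^bold>\<in> Z)"
  unfolding counting_closed_def by (auto simp: func_pair_iff[OF add_fun])

definition counting :: 'a where
  "counting = Coll (\<lambda>u. u \<^bold>\<in> omega \<^bold>\<times> R \<and> (\<forall>Z. counting_closed Z \<longrightarrow> u \<^bold>\<in> Z))"

lemma mem_counting: "u \<^bold>\<in> counting \<longleftrightarrow> u \<^bold>\<in> omega \<^bold>\<times> R \<and> (\<forall>Z. counting_closed Z \<longrightarrow> u \<^bold>\<in> Z)"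
  unfolding counting_def
proof (rule mem_Coll_bounded[of _ "omega \<^bold>\<times> R"])
  show "definable (\<lambda>e. e 0 \<^bold>\<in> omega \<^bold>\<times> R \<and> (\<forall>Z. counting_closed Z \<longrightarrow> e 0 \<^bold>\<in> Z))"
    unfolding counting_closed_def by (intro def_intros definable_fun_un definable_fun_upair)
qed simp

lemma counting_nonpos: "n \<^bold>\<in> omega \<Longrightarrow> c \<^bold>\<in> R \<Longrightarrow> c \<preceq> zero \<Longrightarrow> opair n c \<^bold>\<in> counting"
  by (simp add: mem_counting counting_closed_iff)

lemma counting_succ:
  "n \<^bold>\<in> omega \<Longrightarrow> c \<^bold>\<in> R \<Longrightarrow> opair n c \<^bold>\<in> counting \<Longrightarrow> opair (succ n) (c \<oplus> one) \<^bold>\<in> counting"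
  by (simp add: mem_counting counting_closed_iff)

lemma counting_induct:
  assumes D: "definable (\<lambda>e. P (e 0) (e (Suc 0)))" and nc: "opair n c \<^bold>\<in> counting"
    and base: "\<And>n c. n \<^bold>\<in> omega \<Longrightarrow> c \<^bold>\<in> R \<Longrightarrow> c \<preceq> zero \<Longrightarrow> P n c"
    and step: "\<And>n c. n \<^bold>\<in> omega \<Longrightarrow> c \<^bold>\<in> R \<Longrightarrow> opair n c \<^bold>\<in> counting \<Longrightarrow> P n c \<Longrightarrow> P (succ n) (c \<oplus> one)"
  shows "P n c"
proof -
  have D': "definable (\<lambda>e. P (e i) (e j))" for i j
    using definable_rename[OF D, of "\<lambda>n. if n = 0 then i else j"] by simp
  have "definable (\<lambda>e. \<exists>n c. e 0 = opair n c \<and> P n c)" by (intro def_intros D')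
  from separation_definable[OF this, of counting] obtain Z where
    "\<And>u. u \<^bold>\<in> Z \<longleftrightarrow> u \<^bold>\<in> counting \<and> (\<exists>n c. u = opair n c \<and> P n c)" by blast
  then have Z: "opair n c \<^bold>\<in> Z \<longleftrightarrow> opair n c \<^bold>\<in> counting \<and> P n c" for n c by auto
  have "counting_closed Z"
    unfolding counting_closed_iff Z using counting_nonpos counting_succ base step by blast
  then show ?thesis using nc Z unfolding mem_counting by blast
qed

lemma counting_down:
  assumes "opair n d \<^bold>\<in> counting" "c \<^bold>\<in> R" "c \<preceq> d" shows "opair n c \<^bold>\<in> counting"
proof -
  have "\<forall>c. c \<^bold>\<in> R \<longrightarrow> c \<preceq> d \<longrightarrow> opair n c \<^bold>\<in> counting"
  proof (rule counting_induct[of "\<lambda>n d. \<forall>c. c \<^bold>\<in> R \<longrightarrow> c \<preceq> d \<longrightarrow> opair n c \<^bold>\<in> counting", OF _ assms(1)])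
    show "definable (\<lambda>e. \<forall>c. c \<^bold>\<in> R \<longrightarrow> c \<preceq> e (Suc 0) \<longrightarrow> opair (e 0) c \<^bold>\<in> counting)"
      by (intro def_intros)
    show "\<forall>c. c \<^bold>\<in> R \<longrightarrow> c \<preceq> d \<longrightarrow> opair n c \<^bold>\<in> counting" if "n \<^bold>\<in> omega" "d \<^bold>\<in> R" "d \<preceq> zero" for n d
      using that counting_nonpos leq_trans zero_in by blast
    show "\<forall>c. c \<^bold>\<in> R \<longrightarrow> c \<preceq> d \<oplus> one \<longrightarrow> opair (succ n) c \<^bold>\<in> counting"
      if n: "n \<^bold>\<in> omega" and d: "d \<^bold>\<in> R" and IH: "\<forall>c. c \<^bold>\<in> R \<longrightarrow> c \<preceq> d \<longrightarrow> opair n c \<^bold>\<in> counting" for n d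
    proof (intro allI impI)
      fix c assume c: "c \<^bold>\<in> R" "c \<preceq> d \<oplus> one"
      obtain b where b: "b \<^bold>\<in> R" "b \<oplus> one = c" using minus_exists[OF c(1) one_in] by blast
      then have "b \<preceq> d" using plus_leq_iff[of b d one] c d by simp
      then show "opair (succ n) c \<^bold>\<in> counting" using counting_succ[OF n b(1)] IH b by auto
    qed
  qed
  then show ?thesis using assms by blast
qed

lemma counting_cases:
  assumes "opair n c \<^bold>\<in> counting"
  shows "c \<preceq> zero \<or> (\<exists>m b. opair m b \<^bold>\<in> counting \<and> n = succ m \<and> c = b \<oplus> one)"
proof -
  have mem: "m \<^bold>\<in> omega" "b \<^bold>\<in> R" if "opair m b \<^bold>\<in> counting" for m b
    using that by (auto simp: mem_counting)
  have "c \<preceq> zero \<or> (\<exists>m b. opair m b \<^bold>\<in> counting \<and> n = succ m \<and> opair (opair b one) c \<^bold>\<in> add)"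
  proof (rule counting_induct[of "\<lambda>n c. c \<preceq> zero \<or>
      (\<exists>m b. opair m b \<^bold>\<in> counting \<and> n = succ m \<and> opair (opair b one) c \<^bold>\<in> add)", OF _ assms])
    show "definable (\<lambda>e. e (Suc 0) \<preceq> zero \<or>
      (\<exists>m b. opair m b \<^bold>\<in> counting \<and> e 0 = succ m \<and> opair (opair b one) (e (Suc 0)) \<^bold>\<in> add))"
      by (intro def_intros definable_fun_un definable_fun_upair)
  qed (auto simp: func_pair_iff[OF add_fun])
  then show ?thesis using mem by (auto simp: func_pair_iff[OF add_fun])
qed

lemma counting_bounded:
  assumes "n \<^bold>\<in> omega" shows "\<exists>b. b \<^bold>\<in> R \<and> zero \<preceq> b \<and> (\<forall>c. opair n c \<^bold>\<in> counting \<longrightarrow> c \<preceq> b)"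
proof (rule omega_induct[OF assms, of "\<lambda>n. \<exists>b. b \<^bold>\<in> R \<and> zero \<preceq> b \<and> (\<forall>c. opair n c \<^bold>\<in> counting \<longrightarrow> c \<preceq> b)"])
  show "definable (\<lambda>e. \<exists>b. b \<^bold>\<in> R \<and> zero \<preceq> b \<and> (\<forall>c. opair (e 0) c \<^bold>\<in> counting \<longrightarrow> c \<preceq> b))"
    by (intro def_intros)
  show "\<exists>b. b \<^bold>\<in> R \<and> zero \<preceq> b \<and> (\<forall>c. opair empty c \<^bold>\<in> counting \<longrightarrow> c \<preceq> b)"
    using counting_cases[of empty] leq_refl[OF zero_in] succ_neq_empty by (metis zero_in)
  fix n assume "\<exists>b. b \<^bold>\<in> R \<and> zero \<preceq> b \<and> (\<forall>c. opair n c \<^bold>\<in> counting \<longrightarrow> c \<preceq> b)"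
  then obtain b where b: "b \<^bold>\<in> R" "zero \<preceq> b" "\<And>c. opair n c \<^bold>\<in> counting \<Longrightarrow> c \<preceq> b" by blast
  have b1: "zero \<preceq> b \<oplus> one" using leq_trans[of zero b "b \<oplus> one"] b less_succ by simp
  have "c \<preceq> b \<oplus> one" if c: "opair (succ n) c \<^bold>\<in> counting" for c
    using counting_cases[OF c]
  proof
    assume "c \<preceq> zero"
    then show ?thesis using leq_trans[of c zero "b \<oplus> one"] b1 b c by (simp add: mem_counting)
  next
    assume "\<exists>m d. opair m d \<^bold>\<in> counting \<and> succ n = succ m \<and> c = d \<oplus> one"
    then obtain d where d: "opair n d \<^bold>\<in> counting" "c = d \<oplus> one" unfolding succ_inject by blast
    then show ?thesis using plus_mono[of d b one] b by (simp add: mem_counting)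
  qed
  then show "\<exists>b. b \<^bold>\<in> R \<and> zero \<preceq> b \<and> (\<forall>c. opair (succ n) c \<^bold>\<in> counting \<longrightarrow> c \<preceq> b)"
    using b b1 by (intro exI[of _ "b \<oplus> one"]) simp
qed

text \<open>
  The Archimedean property. The reals \<open>y\<close> below almost all natural numbers are closed under adding one, so
  they have no supremum and are unbounded by completeness.
\<close>

lemma counting_cofinal:
  assumes d: "d \<^bold>\<in> R"
  shows "\<exists>N. N \<^bold>\<in> omega \<and> (\<forall>n. n \<^bold>\<in> omega \<longrightarrow> \<not> n \<^bold>\<in> N \<longrightarrow> opair n d \<^bold>\<in> counting)"
proof (rule ccontr)
  assume no: "\<not> ?thesis"
  have "definable (\<lambda>e. \<exists>N. N \<^bold>\<in> omega \<and> (\<forall>n. n \<^bold>\<in> omega \<longrightarrow> \<not> n \<^bold>\<in> N \<longrightarrow> opair n (e 0) \<^bold>\<in> counting))"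
    by (intro def_intros)
  from separation_definable[OF this, of R] obtain Y where
    Y: "\<And>y. y \<^bold>\<in> Y \<longleftrightarrow> y \<^bold>\<in> R \<and>
      (\<exists>N. N \<^bold>\<in> omega \<and> (\<forall>n. n \<^bold>\<in> omega \<longrightarrow> \<not> n \<^bold>\<in> N \<longrightarrow> opair n y \<^bold>\<in> counting))" by blast
  have "Y \<^bold>\<subseteq> R" by (simp add: sub_def Y)
  moreover have "zero \<^bold>\<in> Y"
    using counting_nonpos leq_refl by (auto simp: Y intro!: exI[of _ empty])
  moreover have "y \<preceq> d" if "y \<^bold>\<in> Y" for y
  proof (rule ccontr)
    assume "\<not> y \<preceq> d"
    then have "d \<preceq> y" using leq_total d that Y by blast
    then show False using that no d counting_down unfolding Y by blast
  qed
  ultimately obtain s where s: "s \<^bold>\<in> R" "\<And>y. y \<^bold>\<in> Y \<Longrightarrow> y \<preceq> s"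
    "\<And>b. b \<^bold>\<in> R \<Longrightarrow> (\<And>y. y \<^bold>\<in> Y \<Longrightarrow> y \<preceq> b) \<Longrightarrow> s \<preceq> b"
    using complete[of Y zero d] d by blast
  \<comment> \<open>\<open>r = s - 1\<close> is no upper bound, so some \<open>y\<close> in \<open>Y\<close> exceeds it, and \<open>y + 1\<close> exceeds \<open>s\<close>.\<close>
  obtain r where r: "r \<^bold>\<in> R" "r \<oplus> one = s" using minus_exists[OF s(1) one_in] by blast
  have "\<not> s \<preceq> r" using less_succ[of r] r leq_antisym[of r s] s by auto
  then obtain y where y: "y \<^bold>\<in> Y" "\<not> y \<preceq> r" using s(3)[OF r(1)] by blast
  obtain N where N: "N \<^bold>\<in> omega" "\<And>n. n \<^bold>\<in> omega \<Longrightarrow> \<not> n \<^bold>\<in> N \<Longrightarrow> opair n y \<^bold>\<in> counting"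
    using y Y by blast
  have yR: "y \<^bold>\<in> R" using y Y by blast
  have "opair n (y \<oplus> one) \<^bold>\<in> counting" if n: "n \<^bold>\<in> omega" "\<not> n \<^bold>\<in> succ N" for n
    using n(1)
  proof (cases rule: omega_cases)
    case 1
    then show ?thesis using n zero_mem_omega[OF N(1)] by auto
  next
    case (2 m)
    then have "\<not> m \<^bold>\<in> N" using succ_mem_omega[OF N(1), of m] n by auto
    then show ?thesis using counting_succ[OF 2(1) yR] N(2)[OF 2(1)] 2(2) by simp
  qed
  then have "y \<oplus> one \<^bold>\<in> Y" using yR succ_omega[OF N(1)] unfolding Y by (metis plus_in one_in)
  then have "y \<oplus> one \<preceq> r \<oplus> one" using s(2) r by simp
  then show False using plus_leq_iff[of y r one] yR r y by simp
qed

lemma real_ordered_space: "ordered_space mem R (real_top R le) le counting zero"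
proof (unfold_locales, goal_cases)
  case (1 a b) then show ?case using leq_total by blast
next
  case (2 a b) then show ?case using leq_antisym by blast
next
  case (3 a b c) then show ?case using leq_trans by blast
next
  case (4 A a b) then show ?case using complete[of A a b] by auto
next
  case (5 a) then show ?case using less_succ[of a] by (intro exI[of _ "a \<oplus> one"]) simp
next
  case (6 a) then show ?case by (rule up_ray_open)
next
  case (7 a) then show ?case by (rule down_ray_open)
next
  case (8 V z)
  then obtain a b where ab: "a \<^bold>\<in> R" "b \<^bold>\<in> R" "a \<prec> z" "z \<prec> b"
    "\<And>y. y \<^bold>\<in> R \<Longrightarrow> a \<prec> y \<Longrightarrow> y \<prec> b \<Longrightarrow> y \<^bold>\<in> V" unfolding mem_real_top by blast
  then have "y \<^bold>\<in> V" if "y \<^bold>\<in> R" "a \<prec> y" "y \<preceq> z" for y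
    using that leq_less_trans[of y z b] 8(3) by blast
  then show ?case using ab by blast
next
  case (9 V z)
  then obtain a b where ab: "a \<^bold>\<in> R" "b \<^bold>\<in> R" "a \<prec> z" "z \<prec> b"
    "\<And>y. y \<^bold>\<in> R \<Longrightarrow> a \<prec> y \<Longrightarrow> y \<prec> b \<Longrightarrow> y \<^bold>\<in> V" unfolding mem_real_top by blast
  then have "y \<^bold>\<in> V" if "y \<^bold>\<in> R" "y \<prec> b" "z \<preceq> y" for y
    using that less_leq_trans[of a z y] 9(3) by blast
  then show ?case using ab by blast
next
  case (10 V) then show ?case by (simp add: mem_real_top)
next
  case 11 show ?case by simp
next
  case (12 n c d) then show ?case using counting_down by blast
next
  case (13 n) then show ?case using counting_nonpos leq_refl by simp
next
  case (14 n)
  then obtain b where "b \<^bold>\<in> R" "\<And>c. opair n c \<^bold>\<in> counting \<Longrightarrow> c \<preceq> b" using counting_bounded by blast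
  then show ?case using less_succ[of b] leq_antisym[of b "b \<oplus> one"] by (metis plus_in one_in)
next
  case (15 d) then show ?case by (rule counting_cofinal)
qed

subsection \<open>Zero-sets\<close>

text \<open>
  On the elements of \<open>R\<close> this says \<open>1 / \<bar>y - t\<bar> < r\<close> with \<open>1 / 0 =
  \<infinity>\<close>, rewritten as \<open>\<bar>y - t\<bar> > 1 / r\<close> and with subtraction and absolute value
  eliminated. Sums and products appear as members of the graphs of the operations, to make the predicate definable.
\<close>

definition far :: "'a \<Rightarrow> 'a \<Rightarrow> 'a \<Rightarrow> bool" where
  "far t r y \<longleftrightarrow> zero \<prec> r \<and> (\<exists>i u. i \<^bold>\<in> R \<and> opair (opair r i) one \<^bold>\<in> mul \<and>
     (opair (opair t i) u \<^bold>\<in> add \<and> u \<prec> y \<or> opair (opair y i) u \<^bold>\<in> add \<and> u \<prec> t))"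

lemma far_iff:
  assumes "t \<^bold>\<in> R" "r \<^bold>\<in> R" "y \<^bold>\<in> R"
  shows "far t r y \<longleftrightarrow> zero \<prec> r \<and> (\<exists>i. i \<^bold>\<in> R \<and> r \<otimes> i = one \<and> (t \<oplus> i \<prec> y \<or> y \<oplus> i \<prec> t))"
  unfolding far_def using assms by (auto simp: func_pair_iff[OF add_fun] func_pair_iff[OF mul_fun])

lemma far_inverse:
  assumes "t \<^bold>\<in> R" "r \<^bold>\<in> R" "y \<^bold>\<in> R" "i \<^bold>\<in> R" "zero \<prec> r" "r \<otimes> i = one"
  shows "far t r y \<longleftrightarrow> t \<oplus> i \<prec> y \<or> y \<oplus> i \<prec> t"
proof -
  have "j = i" if "j \<^bold>\<in> R" "r \<otimes> j = one" for j
    using that assms inverse_antimono[of r r i j] inverse_antimono[of r r j i] leq_refl leq_antisym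
    by blast
  then show ?thesis using assms far_iff[OF assms(1-3)] by blast
qed

lemma pos_inverse: "r \<^bold>\<in> R \<Longrightarrow> zero \<prec> r \<Longrightarrow> \<exists>i. i \<^bold>\<in> R \<and> r \<otimes> i = one \<and> zero \<prec> i"
  using inverse_exists inverse_pos by metis

lemma far_up:
  assumes "t \<^bold>\<in> R" "r \<^bold>\<in> R" "s \<^bold>\<in> R" "y \<^bold>\<in> R" "far t r y" "r \<preceq> s"
  shows "far t s y"
proof -
  have r: "zero \<prec> r" using assms by (simp add: far_def)
  have s: "zero \<prec> s" using less_leq_trans[of zero r s] r assms by simp
  obtain i where i: "i \<^bold>\<in> R" "r \<otimes> i = one" using pos_inverse r assms by blast
  obtain j where j: "j \<^bold>\<in> R" "s \<otimes> j = one" using pos_inverse s assms by blast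
  have ji: "j \<preceq> i" using inverse_antimono[of r s i j] r assms i j by blast
  have le: "u \<oplus> j \<preceq> u \<oplus> i" if "u \<^bold>\<in> R" for u
    using plus_mono[of j i u] ji i j that by (simp add: plus_commute[of _ u])
  have "t \<oplus> i \<prec> y \<or> y \<oplus> i \<prec> t" using far_inverse[of t r y i] assms r i by simp
  then have "t \<oplus> j \<prec> y \<or> y \<oplus> j \<prec> t"
    using le[of t] le[of y] leq_less_trans[of "t \<oplus> j" "t \<oplus> i" y]
      leq_less_trans[of "y \<oplus> j" "y \<oplus> i" t] assms i j by auto
  then show ?thesis using far_inverse[of t s y j] assms s j by simp
qed

lemma far_exists_iff:
  assumes "t \<^bold>\<in> R" "y \<^bold>\<in> R" shows "(\<exists>r. r \<^bold>\<in> R \<and> far t r y) \<longleftrightarrow> y \<noteq> t"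
proof
  assume "\<exists>r. r \<^bold>\<in> R \<and> far t r y"
  then obtain r where r: "r \<^bold>\<in> R" "zero \<prec> r" "far t r y" by (auto simp: far_def)
  then obtain i where i: "i \<^bold>\<in> R" "r \<otimes> i = one" "zero \<prec> i" using pos_inverse by blast
  have "t \<prec> t \<oplus> i" using plus_less_iff[of zero i t] i assms by (simp add: plus_commute[of i t])
  then show "y \<noteq> t"
    using far_inverse[of t r y i] r i assms leq_antisym[of t "t \<oplus> i"] by auto
next
  assume ne: "y \<noteq> t"
  have step: "\<exists>r i. r \<^bold>\<in> R \<and> zero \<prec> r \<and> i \<^bold>\<in> R \<and> r \<otimes> i = one \<and> a \<oplus> i \<prec> b"
    if a: "a \<^bold>\<in> R" and b: "b \<^bold>\<in> R" and ab: "a \<prec> b" for a b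
  proof -
    obtain d where d: "d \<^bold>\<in> R" "d \<oplus> a = b" using minus_exists a b by blast
    have "zero \<prec> d" using plus_less_iff[of zero d a] d a ab by simp
    then obtain i where i: "i \<^bold>\<in> R" "zero \<prec> i" "i \<prec> d" using dense[of zero d] d by auto
    obtain r where r: "r \<^bold>\<in> R" "i \<otimes> r = one" "zero \<prec> r" using pos_inverse i by blast
    have "a \<oplus> i \<prec> b" using plus_less_iff[of i d a] i d a by (simp add: plus_commute[of a i])
    moreover have "r \<otimes> i = one" using times_commute[of r i] i r by simp
    ultimately show ?thesis using i r by blast
  qed
  have "t \<prec> y \<or> y \<prec> t" using leq_total assms ne by auto
  then obtain r i where "r \<^bold>\<in> R" "zero \<prec> r" "i \<^bold>\<in> R" "r \<otimes> i = one" "t \<oplus> i \<prec> y \<or> y \<oplus> i \<prec> t"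
    using step[of t y] step[of y t] assms by blast
  then show "\<exists>r. r \<^bold>\<in> R \<and> far t r y" using far_inverse[of t r y i] assms by blast
qed

lemma far_open:
  assumes t: "t \<^bold>\<in> R" and r: "r \<^bold>\<in> R" and y: "y \<^bold>\<in> R" and far: "far t r y"
  shows "\<exists>V. V \<^bold>\<in> real_top R le \<and> y \<^bold>\<in> V \<and> (\<forall>z. z \<^bold>\<in> V \<longrightarrow> far t r z)"
proof -
  have rpos: "zero \<prec> r" using far by (simp add: far_def)
  obtain i where i: "i \<^bold>\<in> R" "r \<otimes> i = one" using pos_inverse r rpos by blast
  note far_i = far_inverse[OF t r _ i(1) rpos i(2)]
  consider "t \<oplus> i \<prec> y" | "y \<oplus> i \<prec> t" using far far_i[OF y] by blast
  then show ?thesis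
  proof cases
    case 1
    obtain V where "V \<^bold>\<in> real_top R le" "\<And>z. z \<^bold>\<in> V \<longleftrightarrow> z \<^bold>\<in> R \<and> t \<oplus> i \<prec> z"
      using up_ray_open[of "t \<oplus> i"] t i by auto
    then show ?thesis using 1 y far_i by blast
  next
    case 2
    obtain u where u: "u \<^bold>\<in> R" "u \<oplus> i = t" using minus_exists t i by blast
    obtain V where "V \<^bold>\<in> real_top R le" "\<And>z. z \<^bold>\<in> V \<longleftrightarrow> z \<^bold>\<in> R \<and> z \<prec> u"
      using down_ray_open[of u] u by auto
    moreover have "z \<oplus> i \<prec> t \<longleftrightarrow> z \<prec> u" if "z \<^bold>\<in> R" for z
      using plus_less_iff[of z u i] u i that by simp
    ultimately show ?thesis using 2 y far_i by blast
  qed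
qed

lemma not_far_open:
  assumes t: "t \<^bold>\<in> R" and e: "e \<^bold>\<in> R" and d: "d \<^bold>\<in> R" and y: "y \<^bold>\<in> R" and ed: "e \<prec> d"
    and e0: "zero \<prec> e" and far: "\<not> far t d y"
  shows "\<exists>V V'. V \<^bold>\<in> real_top R le \<and> V' \<^bold>\<in> real_top R le \<and> y \<^bold>\<in> V \<and> y \<^bold>\<in> V' \<and>
    (\<forall>z. z \<^bold>\<in> V \<longrightarrow> z \<^bold>\<in> V' \<longrightarrow> \<not> far t e z)"
proof -
  have d0: "zero \<prec> d" using less_leq_trans[of zero e d] e0 ed e d by simp
  obtain i where i: "i \<^bold>\<in> R" "e \<otimes> i = one" using pos_inverse e e0 by blast
  obtain j where j: "j \<^bold>\<in> R" "d \<otimes> j = one" using pos_inverse d d0 by blast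
  have ji: "j \<prec> i" using inverse_strict_antimono[of e d i j] e d e0 ed i j by blast
  have lt: "u \<oplus> j \<prec> u \<oplus> i" if "u \<^bold>\<in> R" for u
    using plus_less_iff[of j i u] ji i j that by (simp add: plus_commute[of _ u])
  have "y \<preceq> t \<oplus> j" "t \<preceq> y \<oplus> j"
    using far_inverse[OF t d y j(1) d0 j(2)] far not_leq[of y "t \<oplus> j"] not_leq[of t "y \<oplus> j"] t y j
    by auto
  \<comment> \<open>\<open>\<bar>y - t\<bar> \<le> 1 / d < 1 / e\<close>, so \<open>y\<close> lies strictly between \<open>t - i\<close> and \<open>t + i\<close>.\<close>
  then have y1: "y \<prec> t \<oplus> i" and y2: "t \<prec> y \<oplus> i"
    using leq_less_trans[of y "t \<oplus> j" "t \<oplus> i"] leq_less_trans[of t "y \<oplus> j" "y \<oplus> i"]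
      lt[of t] lt[of y] t y i j by auto
  obtain u where u: "u \<^bold>\<in> R" "u \<oplus> i = t" using minus_exists t i by blast
  have shift: "t \<prec> z \<oplus> i \<longleftrightarrow> u \<prec> z" if "z \<^bold>\<in> R" for z
    using plus_less_iff[of u z i] u i that by simp
  obtain V where V: "V \<^bold>\<in> real_top R le" "\<And>z. z \<^bold>\<in> V \<longleftrightarrow> z \<^bold>\<in> R \<and> z \<prec> t \<oplus> i"
    using down_ray_open[of "t \<oplus> i"] t i by auto
  obtain V' where V': "V' \<^bold>\<in> real_top R le" "\<And>z. z \<^bold>\<in> V' \<longleftrightarrow> z \<^bold>\<in> R \<and> u \<prec> z"
    using up_ray_open[of u] u by auto
  have "\<not> far t e z" if "z \<^bold>\<in> V" "z \<^bold>\<in> V'" for z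
    using far_inverse[OF t e _ i(1) e0 i(2), of z] that V(2) V'(2) shift[of z] t i
      leq_antisym[of z "t \<oplus> i"] leq_antisym[of t "z \<oplus> i"] by auto
  moreover have "y \<^bold>\<in> V" "y \<^bold>\<in> V'" using y1 y2 V(2) V'(2) shift y by auto
  ultimately show ?thesis using V(1) V'(1) by blast
qed

lemma definable_far:
  assumes "definable_fun r" "definable_fun y" shows "definable (\<lambda>e. far t (r e) (y e))"
  unfolding far_def
  by (intro def_intros assms assms[THEN definable_fun_rename])

text \<open>
  For a continuous \<open>f\<close> and a real \<open>t\<close>, the function \<open>1 / \<bar>f - t\<bar>\<close> is a
  scale that is infinite precisely where \<open>f\<close> takes the value \<open>t\<close>. With \<open>t = f p\<close>
  it separates \<open>p\<close> from the other side of the zero-set of \<open>f\<close>, whichever side \<open>p\<close>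
  is on.
\<close>

theorem realcompact_Baire:
  assumes cmc: CMC and T: "topology X T" and X: "realcompact R le X T"
    and S: "S \<^bold>\<in> Baire R le zero X T"
  shows "realcompact R le S (subspace_top T S)"
proof -
  interpret O: ordered_space mem R "real_top R le" le counting zero
    by (rule real_ordered_space)
  have way_below: "e \<prec> d" if wb: "O.way_below e d" and e: "e \<^bold>\<in> R" and d: "d \<^bold>\<in> R" for e d
  proof -
    obtain c where c: "c \<^bold>\<in> R" "c \<prec> d" "\<And>b. b \<^bold>\<in> R \<Longrightarrow> c \<prec> b \<Longrightarrow> e \<preceq> b"
      using wb unfolding O.way_below_def by blast
    obtain b where "b \<^bold>\<in> R" "c \<prec> b" "b \<prec> d" using dense[OF c(1) d c(2)] by blast
    then show ?thesis using c(3)[of b] leq_less_trans[of e b d] e d by blast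
  qed
  have scale: "\<exists>G. O.scale X T G \<and> (\<forall>x. x \<^bold>\<in> X \<longrightarrow> O.finite_at G x \<longleftrightarrow> app f x \<noteq> t)"
    if f: "continuous X T R (real_top R le) f" and t: "t \<^bold>\<in> R" for f t
  proof -
    have f_fun: "func f X R" using f by (simp add: continuous_def)
    have pull: "\<exists>U. U \<^bold>\<in> T \<and> (\<forall>x. x \<^bold>\<in> U \<longleftrightarrow> x \<^bold>\<in> X \<and> app f x \<^bold>\<in> V)" if "V \<^bold>\<in> real_top R le" for V
      using f that mem_preimage[OF f_fun] unfolding continuous_def by blast
    have "definable (\<lambda>e. \<exists>x r y. e 0 = opair x r \<and> opair x y \<^bold>\<in> f \<and> far t r y)"
      by (intro def_intros definable_far)
    from separation_definable[OF this, of "X \<^bold>\<times> R"] obtain G where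
      "\<And>u. u \<^bold>\<in> G \<longleftrightarrow> u \<^bold>\<in> X \<^bold>\<times> R \<and> (\<exists>x r y. u = opair x r \<and> opair x y \<^bold>\<in> f \<and> far t r y)" by blast
    then have Gsub: "G \<^bold>\<subseteq> X \<^bold>\<times> R"
      and G: "opair x r \<^bold>\<in> G \<longleftrightarrow> x \<^bold>\<in> X \<and> r \<^bold>\<in> R \<and> far t r (app f x)" for x r
      by (auto simp: sub_def func_pair_iff[OF f_fun])
    have fx: "app f x \<^bold>\<in> R" if "x \<^bold>\<in> X" for x using func_app[OF f_fun that] .
    have "O.scale X T G"
    proof (rule O.scaleI[OF Gsub])
      show "opair x d \<^bold>\<in> G" if "x \<^bold>\<in> X" "c \<^bold>\<in> R" "d \<^bold>\<in> R" "opair x c \<^bold>\<in> G" "c \<preceq> d" for x c d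
        using that far_up[OF t that(2,3) fx[OF that(1)] _ that(5)] by (simp add: G)
      show "\<exists>c. c \<^bold>\<in> R \<and> \<not> opair x c \<^bold>\<in> G" for x
        by (intro exI[of _ zero]) (simp add: G far_def)
      show "near T x (\<lambda>y. opair y c \<^bold>\<in> G)"
        if x: "x \<^bold>\<in> X" and c: "c \<^bold>\<in> R" and xc: "opair x c \<^bold>\<in> G" for x c
      proof -
        obtain V where V: "V \<^bold>\<in> real_top R le" "app f x \<^bold>\<in> V" "\<And>z. z \<^bold>\<in> V \<Longrightarrow> far t c z"
          using far_open[OF t c fx[OF x]] xc unfolding G by blast
        show ?thesis using pull[OF V(1)] V(2,3) x c unfolding G by blast
      qed
      show "near T x (\<lambda>y. \<not> opair y e \<^bold>\<in> G)"
        if x: "x \<^bold>\<in> X" and d: "d \<^bold>\<in> R" and e: "e \<^bold>\<in> R" and wb: "O.way_below e d"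
          and xd: "\<not> opair x d \<^bold>\<in> G" for x d e
      proof (cases "zero \<prec> e")
        case True
        have "\<not> far t d (app f x)" using xd x d by (simp add: G)
        from not_far_open[OF t e d fx[OF x] way_below[OF wb e d] True this] obtain V V' where
          V: "V \<^bold>\<in> real_top R le" "app f x \<^bold>\<in> V" and V': "V' \<^bold>\<in> real_top R le" "app f x \<^bold>\<in> V'"
          and not_far: "\<And>z. z \<^bold>\<in> V \<Longrightarrow> z \<^bold>\<in> V' \<Longrightarrow> \<not> far t e z" by blast
        obtain U where U: "U \<^bold>\<in> T" "\<And>x. x \<^bold>\<in> U \<longleftrightarrow> x \<^bold>\<in> X \<and> app f x \<^bold>\<in> V" using pull[OF V(1)] by blast
        obtain U' where U': "U' \<^bold>\<in> T" "\<And>x. x \<^bold>\<in> U' \<longleftrightarrow> x \<^bold>\<in> X \<and> app f x \<^bold>\<in> V'" using pull[OF V'(1)] by blast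
        show ?thesis using topology_int[OF T U(1) U'(1)] x V(2) V'(2) not_far
          by (intro exI[of _ "U \<^bold>\<inter> U'"]) (simp add: U(2) U'(2) G)
      next
        case False
        then have "\<not> opair y e \<^bold>\<in> G" for y by (auto simp: G far_def)
        then show ?thesis using topology_space[OF T] x by blast
      qed
    qed
    moreover have "O.finite_at G x \<longleftrightarrow> app f x \<noteq> t" if x: "x \<^bold>\<in> X" for x
      using far_exists_iff[OF t fx[OF x]] x by (auto simp: O.finite_at_def G)
    ultimately show ?thesis by blast
  qed
  have zero_set: "\<exists>f. continuous X T R (real_top R le) f \<and> (\<forall>x. x \<^bold>\<in> Z \<longleftrightarrow> x \<^bold>\<in> X \<and> app f x = zero)"
    if Z: "Z \<^bold>\<in> zero_sets R le zero X T" for Z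
  proof -
    \<comment> \<open>Applications are restated by membership of pairs, which makes the collection of zero-sets definable.\<close>
    have eq: "continuous X T R (real_top R le) f \<and> Z = preimage f X (upair zero zero) \<longleftrightarrow>
        func f X R \<and> (\<forall>V\<in>elts (real_top R le). \<exists>U. U \<^bold>\<in> T \<and>
          (\<forall>x. x \<^bold>\<in> U \<longleftrightarrow> (\<exists>y. opair x y \<^bold>\<in> f \<and> y \<^bold>\<in> V))) \<and>
        (\<forall>x. x \<^bold>\<in> Z \<longleftrightarrow> opair x zero \<^bold>\<in> f)" for f Z
    proof (cases "func f X R")
      case f: True
      have "preimage f X V \<^bold>\<in> T \<longleftrightarrow>
          (\<exists>U. U \<^bold>\<in> T \<and> (\<forall>x. x \<^bold>\<in> U \<longleftrightarrow> (\<exists>y. opair x y \<^bold>\<in> f \<and> y \<^bold>\<in> V)))" for V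
      proof
        assume "\<exists>U. U \<^bold>\<in> T \<and> (\<forall>x. x \<^bold>\<in> U \<longleftrightarrow> (\<exists>y. opair x y \<^bold>\<in> f \<and> y \<^bold>\<in> V))"
        then obtain U where U: "U \<^bold>\<in> T" "\<And>x. x \<^bold>\<in> U \<longleftrightarrow> (\<exists>y. opair x y \<^bold>\<in> f \<and> y \<^bold>\<in> V)" by blast
        have "preimage f X V = U"
          by (rule set_eqI) (auto simp: mem_preimage[OF f] U(2) func_pair_iff[OF f])
        then show "preimage f X V \<^bold>\<in> T" using U(1) by simp
      qed (rule exI[of _ "preimage f X V"], auto simp: mem_preimage[OF f] func_pair_iff[OF f])
      moreover have "Z = preimage f X (upair zero zero) \<longleftrightarrow> (\<forall>x. x \<^bold>\<in> Z \<longleftrightarrow> opair x zero \<^bold>\<in> f)"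
      proof
        assume Z: "\<forall>x. x \<^bold>\<in> Z \<longleftrightarrow> opair x zero \<^bold>\<in> f"
        show "Z = preimage f X (upair zero zero)"
          by (rule set_eqI) (simp add: Z mem_preimage[OF f] func_pair_iff[OF f])
      qed (simp add: mem_preimage[OF f] func_pair_iff[OF f])
      ultimately show ?thesis using f by (simp add: continuous_def)
    qed (simp add: continuous_def)
    have "Z \<^bold>\<in> zero_sets R le zero X T \<longleftrightarrow>
        (\<exists>f. continuous X T R (real_top R le) f \<and> Z = preimage f X (upair zero zero))"
      unfolding zero_sets_def
    proof (rule mem_Coll_bounded[of _ "pow X"])
      show "definable (\<lambda>e. \<exists>f. continuous X T R (real_top R le) f \<and>
          e 0 = preimage f X (upair zero zero))"
        unfolding eq func_iff by (intro def_intros)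
    qed (auto simp: sub_def mem_preimage continuous_def)
    then show ?thesis using Z unfolding continuous_def by (auto simp: mem_preimage)
  qed
  show ?thesis unfolding realcompact_def
  proof (rule O.compact_over_generated_sigma_field[OF cmc T X[unfolded realcompact_def] _ S[unfolded Baire_def]])
    fix Z assume "Z \<^bold>\<in> zero_sets R le zero X T"
    from zero_set[OF this] obtain f where f: "continuous X T R (real_top R le) f"
      and Z: "\<And>x. x \<^bold>\<in> Z \<longleftrightarrow> x \<^bold>\<in> X \<and> app f x = zero" by blast
    have "O.scale_separated X T Z"
      unfolding O.scale_separated_def
    proof
      fix p assume "p \<in> elts X"
      then have p: "p \<^bold>\<in> X" by simp
      have "app f p \<^bold>\<in> R" using f p func_app by (auto simp: continuous_def)
      from scale[OF f this] obtain G where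
        "O.scale X T G" "\<And>x. x \<^bold>\<in> X \<Longrightarrow> O.finite_at G x \<longleftrightarrow> app f x \<noteq> app f p" by blast
      then show "\<exists>G. O.scale X T G \<and> \<not> O.finite_at G p \<and>
          (\<forall>x\<in>elts X. (x \<^bold>\<in> Z \<longleftrightarrow> \<not> p \<^bold>\<in> Z) \<longrightarrow> O.finite_at G x)"
        using p by (intro exI[of _ G]) (auto simp: Z)
    qed
    then show "Z \<^bold>\<subseteq> X \<and> O.scale_separated X T Z" by (simp add: sub_def Z)
  qed
qed

end

section \<open>Baire subspaces\<close>

theorem theorem6p9:
  fixes mem :: "'a \<Rightarrow> 'a \<Rightarrow> bool"
  assumes "ZF_model mem"
    and "membership.CMC mem"
  shows "\<forall>X T. membership.topology mem X T \<longrightarrow>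
    (\<forall>R add mul zero one le. membership.complete_ordered_field mem R add mul zero one le \<longrightarrow>
       membership.realcompact mem R le X T \<longrightarrow>
       (\<forall>S. mem S (membership.Baire mem R le zero X T) \<longrightarrow>
          membership.realcompact mem R le S (membership.subspace_top mem T S))) \<and>
    (membership.N_compact mem X T \<longrightarrow>
       (\<forall>S. mem S (membership.zero_Baire mem X T) \<longrightarrow>
          membership.N_compact mem S (membership.subspace_top mem T S)))"
proof (intro allI impI conjI)
  fix X T R add mul zero one le S
  assume T: "membership.topology mem X T"
    and R: "membership.complete_ordered_field mem R add mul zero one le"
    and X: "membership.realcompact mem R le X T" and S: "mem S (membership.Baire mem R le zero X T)"
  interpret real_line mem R add mul zero one le
    using assms(1) R by (simp add: real_line_def real_line_axioms_def)
  show "membership.realcompact mem R le S (membership.subspace_top mem T S)"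
    by (rule realcompact_Baire[OF assms(2) T X S])
next
  fix X T S
  assume T: "membership.topology mem X T" and X: "membership.N_compact mem X T"
    and S: "mem S (membership.zero_Baire mem X T)"
  interpret ZF_model mem by (rule assms(1))
  show "membership.N_compact mem S (membership.subspace_top mem T S)"
    by (rule N_compact_zero_Baire[OF assms(2) T X S])
qed

end
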